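(* Let $A=A(V,R)$ be a commutative QLC algebra over a field $k$ of characteristic zero. Let $(qA)^{¡}$ be the Koszul dual graded Lie coalgebra of the associated nonunital commutative quadratic algebra $qA$, and let $(qA^+)^{¡}$ be the Koszul dual graded coassociative coalgebra of $A$ regarded as an associative QLC algebra. Then there is a natural isomorphism of graded coalgebras $$\mathcal U^c((qA)^{¡})\cong(qA^+)^{¡},$$ where $\mathcal U^c$ is the universal coenveloping coalgebra functor from graded Lie coalgebras to graded coassociative coalgebras.
   Context: Conventions. $k$ has characteristic zero; Koszul sign rule; $sV$ is the suspension, $(sV)_i=V_{i-1}$. Graded coalgebras are coassociative and counital. A graded Lie coalgebra is a graded vector space $\mathfrak G$ with a degree $0$ cobracket $]-[\,:\mathfrak G\to\mathfrak G\otimes\mathfrak G$ with $\tau_{(12)}\circ]-[\,=-\,]-[$ and satisfying the co-Jacobi identity $(\mathrm{id}+\tau_{(123)}+\tau_{(123)}^2)\circ(]-[\otimes\mathrm{id})\circ]-[\,=0$ ($\tau$ = signed permutations). The functor $\mathcal Lie^c$ from graded coalgebras to graded Lie coalgebras keeps the underlying graded space and takes cobracket $\Delta-\tau_{(12)}\Delta$. The functor $\mathcal U^c$ is its right adjoint. Commutative QLC algebras. $V$ is a vector space in degree $0$, and $R\subset k\oplus V\oplus\mathrm{Sym}^2(V)$ is a subspace; $A=A(V,R):=\mathrm{Sym}(V)/(R)$. It is assumed throughout that $R\cap(k\oplus V)=\{0\}$ and $(R)\cap(k\oplus V\oplus\mathrm{Sym}^2(V))=R$. Let $q:\mathrm{Sym}(V)\to\mathrm{Sym}^2(V)$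 be the projection, $qR=q(R)$, $qA:=\overline{\mathrm{Sym}(V)}/(qR)$ with $\overline{\mathrm{Sym}(V)}=\mathrm{Sym}(V)/k$ (identified with the positive-degree symmetric polynomials), and $qA^+=k\oplus qA$. Koszul dual Lie coalgebra. Let $L^c(sV)$ be the cofree (conilpotent) graded Lie coalgebra on $sV$; its weight $2$ part is the graded exterior square $\wedge^2(sV)$, identified with $s^2\mathrm{Sym}^2(V)$ via $s^2(vw)\leftrightarrow sv\wedge sw$ (with $sv\wedge sw\mapsto sv\otimes sw+sw\otimes sv$ under the cobracket). Then $(qA)^{¡}$ is the Lie subcoalgebra of $L^c(sV)$ universal among Lie subcoalgebras $\mathfrak G\hookrightarrow L^c(sV)$ for which the composite $\mathfrak G\hookrightarrow L^c(sV)\twoheadrightarrow\wedge^2(sV)/s^2qR$ is zero. It is weight graded, with weight $1$ part $sV$ and weight $2$ part $s^2qR$. Koszul dual coalgebra. With $p:T(V)\to\mathrm{Sym}(V)$ the canonical projection, $A\cong T(V)/(p^{-1}(R))$ is an associative QLC algebra, with associated quadratic algebra $qA^+=T(V)/(R')$, where $R'\subset V^{\otimes2}$ is the preimage of $qR$ under $V^{\otimes 2}\to\mathrm{Sym}^2(V)$; that is, $R'=qR\oplus[V,V]$ with $\mathrm{Sym}^2(V)\hookrightarrow V^{\otimes2}$ by symmetrization and $[V,V]=\mathrm{span}\{v\otimes w-w\otimes v\}$. Its Koszul dual coalgebra $(qA^+)^{¡}\subset T^c(sV)$ (tensor coalgebra with deconcatenation) is the graded subcoalgebra $k\oplus sV\oplus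 s^2R'\oplus\cdots\oplus\bigcap_{i+2+j=n}(sV)^{\otimes i}\otimes s^2R'\otimes(sV)^{\otimes j}\oplus\cdots$, where $s^2(v\otimes w)=sv\otimes sw$. *)

theory Defs
  imports Complex_Main "HOL-Library.Function_Algebras" "HOL-Library.Multiset"
begin

section \<open>Tensors\<close>

text \<open>
  A vector space is a type with a scalar multiplication \<open>s\<close> such that \<open>vector_space s\<close>
  (theory HOL.Vector_Spaces); subobjects are subspaces of the type.

  The tensor algebra \<open>T(V)\<close> is modelled inside the dual of the space of families of multilinear
  forms on \<open>V\<^sup>n\<close>, \<open>n \<ge> 0\<close>.  Such a family is one function \<open>\<mu>\<close> on lists that is linear in every entry,
  and \<open>v\<^sub>1 \<otimes> \<dots> \<otimes> v\<^sub>n\<close> is evaluation at the list \<open>[v\<^sub>1, \<dots>, v\<^sub>n]\<close>.  Over a field multilinear forms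
  separate tensors, so the span of these evaluations is the tensor algebra.  If \<open>A\<close> is a subspace
  of \<open>V\<close>, then the map \<open>A\<^sup>\<otimes>\<^sup>n \<rightarrow> V\<^sup>\<otimes>\<^sup>n\<close> is injective and \<open>A\<^sup>\<otimes>\<^sup>n\<close> is identified with its image.
\<close>

type_synonym ('k, 'a) tens = "('a list \<Rightarrow> 'k) \<Rightarrow> 'k"

definition multilinear :: "('k::field \<Rightarrow> 'a::ab_group_add \<Rightarrow> 'a) \<Rightarrow> ('a list \<Rightarrow> 'k) \<Rightarrow> bool" where
  "multilinear s \<mu> \<longleftrightarrow>
     (\<forall>xs ys a b. \<mu> (xs @ (a + b) # ys) = \<mu> (xs @ a # ys) + \<mu> (xs @ b # ys)) \<and>
     (\<forall>xs ys c a. \<mu> (xs @ s c a # ys) = c * \<mu> (xs @ a # ys))"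

definition tscale :: "'k::field \<Rightarrow> ('b \<Rightarrow> 'k) \<Rightarrow> ('b \<Rightarrow> 'k)" where
  "tscale c t = (\<lambda>\<mu>. c * t \<mu>)"

text \<open>\<open>ptens s [v\<^sub>1, \<dots>, v\<^sub>n]\<close> is the pure tensor \<open>v\<^sub>1 \<otimes> \<dots> \<otimes> v\<^sub>n\<close>; \<open>ptens s []\<close> is the unit of \<open>T(V)\<close>.\<close>

definition ptens :: "('k::field \<Rightarrow> 'a::ab_group_add \<Rightarrow> 'a) \<Rightarrow> 'a list \<Rightarrow> ('k, 'a) tens" where
  "ptens s xs = (\<lambda>\<mu>. if multilinear s \<mu> then \<mu> xs else 0)"

definition tprod :: "('k::field \<Rightarrow> 'a::ab_group_add \<Rightarrow> 'a) \<Rightarrow>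
    ('k, 'a) tens \<Rightarrow> ('k, 'a) tens \<Rightarrow> ('k, 'a) tens" where
  "tprod s t u = (\<lambda>\<mu>. if multilinear s \<mu> then t (\<lambda>xs. u (\<lambda>ys. \<mu> (xs @ ys))) else 0)"

definition tensor_algebra :: "('k::field \<Rightarrow> 'a::ab_group_add \<Rightarrow> 'a) \<Rightarrow> ('k, 'a) tens set" where
  "tensor_algebra s = module.span tscale (range (ptens s))"

definition words :: "'a set \<Rightarrow> nat \<Rightarrow> 'a list set" where
  "words A n = {xs. set xs \<subseteq> A \<and> length xs = n}"

definition tensor_power :: "('k::field \<Rightarrow> 'a::ab_group_add \<Rightarrow> 'a) \<Rightarrow> 'a set \<Rightarrow> nat \<Rightarrow>
    ('k, 'a) tens set" where
  "tensor_power s A n = module.span tscale (ptens s ` words A n)"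

text \<open>
  Linear extension: \<open>tlift s W f\<close> is the linear map with \<open>ptens s xs \<mapsto> f xs\<close> for \<open>xs \<in> W\<close>, defined
  on the span of these pure tensors; it is well defined when \<open>f\<close> respects the multilinear
  relations between the words in \<open>W\<close>, as in all uses below.
\<close>

definition tlift :: "('k::field \<Rightarrow> 'a::ab_group_add \<Rightarrow> 'a) \<Rightarrow> 'a list set \<Rightarrow>
    ('a list \<Rightarrow> ('k, 'b) tens) \<Rightarrow> ('k, 'a) tens \<Rightarrow> ('k, 'b) tens" where
  "tlift s W f t = (THE y. \<exists>cs. snd ` set cs \<subseteq> W \<and>
      t = (\<Sum>(c, xs)\<leftarrow>cs. tscale c (ptens s xs)) \<and>
      y = (\<Sum>(c, xs)\<leftarrow>cs. tscale c (f xs)))"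

text \<open>
  \<open>tensor_fun s A s' f g\<close> is \<open>f \<otimes> g\<close> on \<open>A \<otimes> A\<close>, for \<open>f\<close>, \<open>g\<close> linear on \<open>A\<close> with values in
  \<open>T(B)\<close>.  An element \<open>b\<close> of \<open>B\<close> itself is the tensor \<open>ptens s' [b]\<close>.  All maps tensored in this way have
  degree \<open>0\<close>, so there is no sign.
\<close>

definition tensor_fun :: "('k::field \<Rightarrow> 'a::ab_group_add \<Rightarrow> 'a) \<Rightarrow> 'a set \<Rightarrow>
    ('k \<Rightarrow> 'b::ab_group_add \<Rightarrow> 'b) \<Rightarrow> ('a \<Rightarrow> ('k, 'b) tens) \<Rightarrow> ('a \<Rightarrow> ('k, 'b) tens) \<Rightarrow>
    ('k, 'a) tens \<Rightarrow> ('k, 'b) tens" where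
  "tensor_fun s A s' f g = tlift s (words A 2) (\<lambda>xs. tprod s' (f (xs ! 0)) (g (xs ! 1)))"

definition tensor_map :: "('k::field \<Rightarrow> 'a::ab_group_add \<Rightarrow> 'a) \<Rightarrow> ('k \<Rightarrow> 'b::ab_group_add \<Rightarrow> 'b) \<Rightarrow>
    ('a \<Rightarrow> 'b) \<Rightarrow> ('k, 'a) tens \<Rightarrow> ('k, 'b) tens" where
  "tensor_map s s' \<phi> = tlift s UNIV (\<lambda>xs. ptens s' (map \<phi> xs))"

definition tensor_proj :: "('k::field \<Rightarrow> 'a::ab_group_add \<Rightarrow> 'a) \<Rightarrow> nat \<Rightarrow>
    ('k, 'a) tens \<Rightarrow> ('k, 'a) tens" where
  "tensor_proj s n = tlift s UNIV (\<lambda>xs. if length xs = n then ptens s xs else 0)"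


section \<open>Graded vector spaces, coalgebras and Lie coalgebras\<close>

record ('k, 'a) gspace =
  scl :: "'k \<Rightarrow> 'a \<Rightarrow> 'a"
  gr :: "int \<Rightarrow> 'a set"

record ('k, 'a) coalg = "('k, 'a) gspace" +
  comult :: "'a \<Rightarrow> ('k, 'a) tens"
  counit :: "'a \<Rightarrow> 'k"

record ('k, 'a) lie_coalg = "('k, 'a) gspace" +
  cobr :: "'a \<Rightarrow> ('k, 'a) tens"

definition homog :: "('k, 'a, 'z) gspace_scheme \<Rightarrow> 'a set" where
  "homog M = (\<Union>i. gr M i)"

definition carr :: "('k::field, 'a::ab_group_add, 'z) gspace_scheme \<Rightarrow> 'a set" where
  "carr M = module.span (scl M) (homog M)"

text \<open>The graded vector space is \<open>carr M\<close>, the internal direct sum of the subspaces \<open>gr M i\<close>; structure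
  maps matter only on \<open>carr M\<close>.\<close>

definition graded_space :: "('k::field, 'a::ab_group_add, 'z) gspace_scheme \<Rightarrow> bool" where
  "graded_space M \<longleftrightarrow> vector_space (scl M) \<and> (\<forall>i. module.subspace (scl M) (gr M i)) \<and>
     (\<forall>I x. finite I \<and> (\<forall>i\<in>I. x i \<in> gr M i) \<and> (\<Sum>i\<in>I. x i) = 0 \<longrightarrow> (\<forall>i\<in>I. x i = 0))"

text \<open>The degree of a nonzero homogeneous element.  The value at \<open>0\<close> is irrelevant: it only enters as
  the sign of a pure tensor with an entry \<open>0\<close>.\<close>

definition deg :: "('k, 'a, 'z) gspace_scheme \<Rightarrow> 'a \<Rightarrow> int" where
  "deg M a = (THE i. a \<in> gr M i)"

definition ksign :: "int \<Rightarrow> 'k::field" where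
  "ksign n = (if even n then 1 else - 1)"

definition linear_on :: "('k::field, 'a::ab_group_add, 'z) gspace_scheme \<Rightarrow>
    ('k \<Rightarrow> 'b::ab_group_add \<Rightarrow> 'b) \<Rightarrow> ('a \<Rightarrow> 'b) \<Rightarrow> bool" where
  "linear_on M s' f \<longleftrightarrow> (\<forall>x\<in>carr M. \<forall>y\<in>carr M. f (x + y) = f x + f y) \<and>
     (\<forall>c. \<forall>x\<in>carr M. f (scl M c x) = s' c (f x))"

definition graded_map :: "('k::field, 'a::ab_group_add, 'z) gspace_scheme \<Rightarrow>
    ('k, 'b::ab_group_add, 'y) gspace_scheme \<Rightarrow> ('a \<Rightarrow> 'b) \<Rightarrow> bool" where
  "graded_map M N f \<longleftrightarrow> linear_on M (scl N) f \<and> (\<forall>i. f ` gr M i \<subseteq> gr N i)"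

definition square_gr :: "('k::field, 'a::ab_group_add, 'z) gspace_scheme \<Rightarrow> int \<Rightarrow>
    ('k, 'a) tens set" where
  "square_gr M n = module.span tscale
     {ptens (scl M) [a, b] | a b i j. a \<in> gr M i \<and> b \<in> gr M j \<and> i + j = n}"

text \<open>\<open>twist M\<close> is \<open>\<tau>\<^sub>(\<^sub>1\<^sub>2\<^sub>)\<close> on \<open>M \<otimes> M\<close> and \<open>cycle M\<close> is the cyclic permutation
  \<open>a \<otimes> b \<otimes> c \<mapsto> \<plusminus> c \<otimes> a \<otimes> b\<close> on \<open>M \<otimes> M \<otimes> M\<close>, with Koszul signs.\<close>

definition twist :: "('k::field, 'a::ab_group_add, 'z) gspace_scheme \<Rightarrow>
    ('k, 'a) tens \<Rightarrow> ('k, 'a) tens" where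
  "twist M = tlift (scl M) (words (homog M) 2)
     (\<lambda>xs. tscale (ksign (deg M (xs ! 0) * deg M (xs ! 1))) (ptens (scl M) [xs ! 1, xs ! 0]))"

definition cycle :: "('k::field, 'a::ab_group_add, 'z) gspace_scheme \<Rightarrow>
    ('k, 'a) tens \<Rightarrow> ('k, 'a) tens" where
  "cycle M = tlift (scl M) (words (homog M) 3)
     (\<lambda>xs. tscale (ksign (deg M (xs ! 2) * (deg M (xs ! 0) + deg M (xs ! 1))))
       (ptens (scl M) [xs ! 2, xs ! 0, xs ! 1]))"

definition graded_coalgebra :: "('k::field, 'a::ab_group_add) coalg \<Rightarrow> bool" where
  "graded_coalgebra D \<longleftrightarrow>
     (let \<iota> = (\<lambda>a. ptens (scl D) [a]);
          \<epsilon> = (\<lambda>a. tscale (counit D a) (ptens (scl D) []));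
          tfun = tensor_fun (scl D) (carr D) (scl D)
      in graded_space D \<and>
         linear_on D tscale (comult D) \<and> (\<forall>i. comult D ` gr D i \<subseteq> square_gr D i) \<and>
         linear_on D (*) (counit D) \<and> (\<forall>i x. i \<noteq> 0 \<and> x \<in> gr D i \<longrightarrow> counit D x = 0) \<and>
         (\<forall>x\<in>carr D. tfun (comult D) \<iota> (comult D x) = tfun \<iota> (comult D) (comult D x)) \<and>
         (\<forall>x\<in>carr D. tfun \<epsilon> \<iota> (comult D x) = \<iota> x \<and> tfun \<iota> \<epsilon> (comult D x) = \<iota> x))"

definition coalg_morphism :: "('k::field, 'a::ab_group_add) coalg \<Rightarrow>
    ('k, 'b::ab_group_add) coalg \<Rightarrow> ('a \<Rightarrow> 'b) \<Rightarrow> bool" where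
  "coalg_morphism D E f \<longleftrightarrow> graded_map D E f \<and>
     (\<forall>x\<in>carr D. tensor_fun (scl D) (carr D) (scl E)
        (\<lambda>a. ptens (scl E) [f a]) (\<lambda>a. ptens (scl E) [f a]) (comult D x) = comult E (f x)) \<and>
     (\<forall>x\<in>carr D. counit E (f x) = counit D x)"

definition coalg_iso :: "('k::field, 'a::ab_group_add) coalg \<Rightarrow>
    ('k, 'b::ab_group_add) coalg \<Rightarrow> ('a \<Rightarrow> 'b) \<Rightarrow> bool" where
  "coalg_iso D E f \<longleftrightarrow> coalg_morphism D E f \<and> bij_betw f (carr D) (carr E)"

definition lie_coalgebra :: "('k::field, 'a::ab_group_add) lie_coalg \<Rightarrow> bool" where
  "lie_coalgebra L \<longleftrightarrow> graded_space L \<and>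
     linear_on L tscale (cobr L) \<and> (\<forall>i. cobr L ` gr L i \<subseteq> square_gr L i) \<and>
     (\<forall>x\<in>carr L. twist L (cobr L x) = - cobr L x) \<and>
     (\<forall>x\<in>carr L. let t = tensor_fun (scl L) (carr L) (scl L) (cobr L) (\<lambda>a. ptens (scl L) [a]) (cobr L x)
        in t + cycle L t + cycle L (cycle L t) = 0)"

definition lie_morphism :: "('k::field, 'a::ab_group_add) lie_coalg \<Rightarrow>
    ('k, 'b::ab_group_add) lie_coalg \<Rightarrow> ('a \<Rightarrow> 'b) \<Rightarrow> bool" where
  "lie_morphism L M f \<longleftrightarrow> graded_map L M f \<and>
     (\<forall>x\<in>carr L. tensor_fun (scl L) (carr L) (scl M)
        (\<lambda>a. ptens (scl M) [f a]) (\<lambda>a. ptens (scl M) [f a]) (cobr L x) = cobr M (f x))"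

definition Liec :: "('k::field, 'a::ab_group_add) coalg \<Rightarrow> ('k, 'a) lie_coalg" where
  "Liec D = \<lparr>scl = scl D, gr = gr D, cobr = (\<lambda>x. comult D x - twist D (comult D x))\<rparr>"

text \<open>
  \<open>(U, \<eta>)\<close> is the universal coenveloping coalgebra of \<open>G\<close>, i.e. the value at \<open>G\<close> of the right adjoint of
  \<open>Liec\<close> together with the counit \<open>\<eta> : Liec U \<rightarrow> G\<close> of the adjunction.  The coalgebras \<open>D\<close> in the
  universal property range over the type given by the first argument.
\<close>

definition coenveloping :: "'d::ab_group_add itself \<Rightarrow> ('k::field, 'a::ab_group_add) lie_coalg \<Rightarrow>
    ('k, 'u::ab_group_add) coalg \<Rightarrow> ('u \<Rightarrow> 'a) \<Rightarrow> bool" where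
  "coenveloping (_ :: 'd itself) G U \<eta> \<longleftrightarrow>
     lie_coalgebra G \<and> graded_coalgebra U \<and> lie_morphism (Liec U) G \<eta> \<and>
     (\<forall>(D :: ('k, 'd) coalg) f. graded_coalgebra D \<and> lie_morphism (Liec D) G f \<longrightarrow>
        (\<exists>F. coalg_morphism D U F \<and> (\<forall>x\<in>carr D. \<eta> (F x) = f x) \<and>
           (\<forall>F'. coalg_morphism D U F' \<and> (\<forall>x\<in>carr D. \<eta> (F' x) = f x) \<longrightarrow>
              (\<forall>x\<in>carr D. F' x = F x))))"


section \<open>The cofree conilpotent Lie coalgebra on \<open>sV\<close>\<close>

text \<open>\<open>V\<close> (the whole type, with scalar multiplication \<open>s\<close>) sits in degree \<open>0\<close>; \<open>sV\<close> is the same vector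
  space placed in degree \<open>1\<close>, with \<open>sv\<close> written as \<open>v\<close>.  This is a degree \<open>0\<close> linear map \<open>M \<rightarrow> sV\<close>:\<close>

definition map_to_sV :: "('k::field \<Rightarrow> 'v::ab_group_add \<Rightarrow> 'v) \<Rightarrow>
    ('k, 'a::ab_group_add, 'z) gspace_scheme \<Rightarrow> ('a \<Rightarrow> 'v) \<Rightarrow> bool" where
  "map_to_sV s M g \<longleftrightarrow> linear_on M s g \<and> (\<forall>i x. i \<noteq> 1 \<and> x \<in> gr M i \<longrightarrow> g x = 0)"

fun iter_cobr :: "('k::field, 'a::ab_group_add) lie_coalg \<Rightarrow> nat \<Rightarrow> 'a \<Rightarrow> ('k, 'a) tens" where
  "iter_cobr L 0 x = ptens (scl L) [x]"
| "iter_cobr L (Suc n) x = tlift (scl L) (words (carr L) (Suc n))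
     (\<lambda>xs. tprod (scl L) (cobr L (hd xs)) (ptens (scl L) (tl xs))) (iter_cobr L n x)"

definition conilpotent :: "('k::field, 'a::ab_group_add) lie_coalg \<Rightarrow> bool" where
  "conilpotent L \<longleftrightarrow> (\<forall>x\<in>carr L. \<exists>n. iter_cobr L n x = 0)"

definition cofree_among :: "'m::ab_group_add itself \<Rightarrow> ('k::field \<Rightarrow> 'v::ab_group_add \<Rightarrow> 'v) \<Rightarrow>
    ('k, 'l::ab_group_add) lie_coalg \<Rightarrow> ('l \<Rightarrow> 'v) \<Rightarrow> bool" where
  "cofree_among (_ :: 'm itself) s L pr \<longleftrightarrow>
     (\<forall>(M :: ('k, 'm) lie_coalg) g. lie_coalgebra M \<and> conilpotent M \<and> map_to_sV s M g \<longrightarrow>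
        (\<exists>h. lie_morphism M L h \<and> (\<forall>x\<in>carr M. pr (h x) = g x) \<and>
           (\<forall>h'. lie_morphism M L h' \<and> (\<forall>x\<in>carr M. pr (h' x) = g x) \<longrightarrow>
              (\<forall>x\<in>carr M. h' x = h x))))"

text \<open>
  \<open>L\<close> with \<open>pr : L \<rightarrow> sV\<close> is a cofree conilpotent graded Lie coalgebra \<open>L\<^sup>c(sV)\<close>.  A formula cannot
  quantify over types, so the universal property is only demanded for \<open>M\<close> living in the type
  of \<open>L\<close> or in the type of tensors over \<open>V\<close>.  As this predicate is only used as a hypothesis,
  this loses no generality: a Lie coalgebra cofree in the full sense satisfies it.
\<close>

definition cofree_conilpotent_lie :: "('k::field \<Rightarrow> 'v::ab_group_add \<Rightarrow> 'v) \<Rightarrow>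
    ('k, 'l::ab_group_add) lie_coalg \<Rightarrow> ('l \<Rightarrow> 'v) \<Rightarrow> bool" where
  "cofree_conilpotent_lie s L pr \<longleftrightarrow> lie_coalgebra L \<and> conilpotent L \<and> map_to_sV s L pr \<and>
     cofree_among TYPE('l) s L pr \<and> cofree_among TYPE(('k, 'v) tens) s L pr"


section \<open>Commutative QLC algebras\<close>

text \<open>
  \<open>Sym(V)\<close> is modelled like \<open>T(V)\<close>, by evaluations on families of symmetric multilinear forms, and
  the canonical projection \<open>p : T(V) \<rightarrow> Sym(V)\<close> is restriction to such families.
\<close>

definition sym_form :: "('k::field \<Rightarrow> 'v::ab_group_add \<Rightarrow> 'v) \<Rightarrow> ('v list \<Rightarrow> 'k) \<Rightarrow> bool" where
  "sym_form s \<mu> \<longleftrightarrow> multilinear s \<mu> \<and> (\<forall>xs ys. mset xs = mset ys \<longrightarrow> \<mu> xs = \<mu> ys)"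

definition sym_of :: "('k::field \<Rightarrow> 'v::ab_group_add \<Rightarrow> 'v) \<Rightarrow> ('k, 'v) tens \<Rightarrow> ('k, 'v) tens" where
  "sym_of s t = (\<lambda>\<mu>. if sym_form s \<mu> then t \<mu> else 0)"

definition Sym :: "('k::field \<Rightarrow> 'v::ab_group_add \<Rightarrow> 'v) \<Rightarrow> ('k, 'v) tens set" where
  "Sym s = sym_of s ` tensor_algebra s"

text \<open>\<open>Sym_le s n\<close> is \<open>k \<oplus> V \<oplus> \<dots> \<oplus> Sym\<^sup>n(V)\<close>.\<close>

definition Sym_le :: "('k::field \<Rightarrow> 'v::ab_group_add \<Rightarrow> 'v) \<Rightarrow> nat \<Rightarrow> ('k, 'v) tens set" where
  "Sym_le s n = sym_of s ` module.span tscale (ptens s ` {xs. length xs \<le> n})"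

definition sym_mult :: "('k::field \<Rightarrow> 'v::ab_group_add \<Rightarrow> 'v) \<Rightarrow>
    ('k, 'v) tens \<Rightarrow> ('k, 'v) tens \<Rightarrow> ('k, 'v) tens" where
  "sym_mult s x y = (\<lambda>\<mu>. if sym_form s \<mu> then x (\<lambda>xs. y (\<lambda>ys. \<mu> (xs @ ys))) else 0)"

definition sym_ideal :: "('k::field \<Rightarrow> 'v::ab_group_add \<Rightarrow> 'v) \<Rightarrow> ('k, 'v) tens set \<Rightarrow>
    ('k, 'v) tens set" where
  "sym_ideal s R = module.span tscale {sym_mult s x r | x r. x \<in> Sym s \<and> r \<in> R}"

text \<open>The algebra \<open>A(V, R) = Sym(V) / (R)\<close> is given by its data \<open>(V, R)\<close>.\<close>

definition comm_QLC :: "('k::field \<Rightarrow> 'v::ab_group_add \<Rightarrow> 'v) \<Rightarrow> ('k, 'v) tens set \<Rightarrow> bool" where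
  "comm_QLC s R \<longleftrightarrow> vector_space s \<and> module.subspace tscale R \<and> R \<subseteq> Sym_le s 2 \<and>
     R \<inter> Sym_le s 1 = {0} \<and> sym_ideal s R \<inter> Sym_le s 2 = R"

text \<open>The projection \<open>q : Sym(V) \<rightarrow> Sym\<^sup>2(V)\<close>.\<close>

definition sym_q :: "('k::field \<Rightarrow> 'v::ab_group_add \<Rightarrow> 'v) \<Rightarrow> ('k, 'v) tens \<Rightarrow> ('k, 'v) tens" where
  "sym_q s x = (\<lambda>\<mu>. if sym_form s \<mu> then x (\<lambda>xs. if length xs = 2 then \<mu> xs else 0) else 0)"

abbreviation qR :: "('k::field \<Rightarrow> 'v::ab_group_add \<Rightarrow> 'v) \<Rightarrow> ('k, 'v) tens set \<Rightarrow> ('k, 'v) tens set" where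
  "qR s R \<equiv> sym_q s ` R"

text \<open>\<open>Sym(\<phi>) : Sym(V) \<rightarrow> Sym(V')\<close>.\<close>

definition sym_map :: "('k::field \<Rightarrow> 'w::ab_group_add \<Rightarrow> 'w) \<Rightarrow> ('v \<Rightarrow> 'w) \<Rightarrow>
    ('k, 'v) tens \<Rightarrow> ('k, 'w) tens" where
  "sym_map s' \<phi> x = (\<lambda>\<mu>. if sym_form s' \<mu> then x (\<lambda>xs. \<mu> (map \<phi> xs)) else 0)"

text \<open>The symmetrization \<open>Sym\<^sup>2(V) \<rightarrow> V \<otimes> V\<close>, \<open>vw \<mapsto> v \<otimes> w + w \<otimes> v\<close>.  Read in \<open>sV \<otimes> sV\<close> it is
  \<open>s\<^sup>2(vw) = sv \<and> sw \<mapsto> sv \<otimes> sw + sw \<otimes> sv\<close>.\<close>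

definition symmetrize :: "('k::field \<Rightarrow> 'v::ab_group_add \<Rightarrow> 'v) \<Rightarrow> ('k, 'v) tens \<Rightarrow> ('k, 'v) tens" where
  "symmetrize s y = (\<lambda>\<mu>. if multilinear s \<mu>
     then y (\<lambda>xs. if length xs = 2 then \<mu> xs + \<mu> (rev xs) else 0) else 0)"


section \<open>The Koszul dual Lie coalgebra\<close>

text \<open>The projection of \<open>L = L\<^sup>c(sV)\<close> onto its weight \<open>2\<close> part \<open>\<and>\<^sup>2(sV)\<close>, the latter embedded in
  \<open>sV \<otimes> sV\<close> by the cobracket, is \<open>(pr \<otimes> pr) \<circ> cobr\<close>: on weights \<open>\<noteq> 2\<close> this map vanishes for degree reasons.\<close>

definition wedge2_proj :: "('k::field \<Rightarrow> 'v::ab_group_add \<Rightarrow> 'v) \<Rightarrow>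
    ('k, 'l::ab_group_add) lie_coalg \<Rightarrow> ('l \<Rightarrow> 'v) \<Rightarrow> 'l \<Rightarrow> ('k, 'v) tens" where
  "wedge2_proj s L pr x = tensor_fun (scl L) (carr L) s
     (\<lambda>a. ptens s [pr a]) (\<lambda>a. ptens s [pr a]) (cobr L x)"

definition lie_subcoalgebra :: "('k::field, 'l::ab_group_add) lie_coalg \<Rightarrow> 'l set \<Rightarrow> bool" where
  "lie_subcoalgebra L H \<longleftrightarrow> module.span (scl L) (H \<inter> homog L) = H \<and>
     (\<forall>x\<in>H. cobr L x \<in> tensor_power (scl L) H 2)"

text \<open>\<open>(qA)\<^sup>\<exclamdown>\<close>: the largest (the sum of all) graded Lie subcoalgebra whose image in
  \<open>\<and>\<^sup>2(sV) / s\<^sup>2qR\<close> is zero.\<close>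

definition lie_koszul_carrier :: "('k::field \<Rightarrow> 'v::ab_group_add \<Rightarrow> 'v) \<Rightarrow> ('k, 'v) tens set \<Rightarrow>
    ('k, 'l::ab_group_add) lie_coalg \<Rightarrow> ('l \<Rightarrow> 'v) \<Rightarrow> 'l set" where
  "lie_koszul_carrier s R L pr = module.span (scl L)
     (\<Union>{H. lie_subcoalgebra L H \<and> (\<forall>x\<in>H. wedge2_proj s L pr x \<in> symmetrize s ` qR s R)})"

definition lie_koszul_dual :: "('k::field \<Rightarrow> 'v::ab_group_add \<Rightarrow> 'v) \<Rightarrow> ('k, 'v) tens set \<Rightarrow>
    ('k, 'l::ab_group_add) lie_coalg \<Rightarrow> ('l \<Rightarrow> 'v) \<Rightarrow> ('k, 'l) lie_coalg" where
  "lie_koszul_dual s R L pr = L\<lparr>gr := (\<lambda>i. lie_koszul_carrier s R L pr \<inter> gr L i)\<rparr>"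


section \<open>The Koszul dual coalgebra\<close>

text \<open>The tensor coalgebra \<open>T\<^sup>c(sV)\<close>: the tensors over \<open>V\<close>, with \<open>V\<^sup>\<otimes>\<^sup>n\<close> in degree \<open>n\<close>, and deconcatenation.\<close>

definition deconcat :: "('k::field \<Rightarrow> 'v::ab_group_add \<Rightarrow> 'v) \<Rightarrow>
    ('k, 'v) tens \<Rightarrow> ('k, ('k, 'v) tens) tens" where
  "deconcat s = tlift s UNIV
     (\<lambda>xs. \<Sum>i\<le>length xs. ptens tscale [ptens s (take i xs), ptens s (drop i xs)])"

definition tensor_coalg :: "('k::field \<Rightarrow> 'v::ab_group_add \<Rightarrow> 'v) \<Rightarrow> ('k, ('k, 'v) tens) coalg" where
  "tensor_coalg s = \<lparr>scl = tscale,
     gr = (\<lambda>i. if i < 0 then {0} else tensor_power s UNIV (nat i)),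
     comult = deconcat s,
     counit = (\<lambda>t. t (\<lambda>xs. if xs = [] then 1 else 0))\<rparr>"

text \<open>\<open>R'\<close>, the preimage of \<open>qR\<close> under \<open>V \<otimes> V \<rightarrow> Sym\<^sup>2(V)\<close>.\<close>

definition R_assoc :: "('k::field \<Rightarrow> 'v::ab_group_add \<Rightarrow> 'v) \<Rightarrow> ('k, 'v) tens set \<Rightarrow> ('k, 'v) tens set" where
  "R_assoc s R = {t \<in> tensor_power s UNIV 2. sym_of s t \<in> qR s R}"

text \<open>\<open>(qA\<^sup>+)\<^sup>\<exclamdown>\<close>; for \<open>n < 2\<close> the intersection is empty and the degree \<open>n\<close> part is \<open>V\<^sup>\<otimes>\<^sup>n\<close>.\<close>

definition assoc_koszul_gr :: "('k::field \<Rightarrow> 'v::ab_group_add \<Rightarrow> 'v) \<Rightarrow> ('k, 'v) tens set \<Rightarrow> nat \<Rightarrow>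
    ('k, 'v) tens set" where
  "assoc_koszul_gr s R n = {t \<in> tensor_power s UNIV n. \<forall>i j. i + 2 + j = n \<longrightarrow>
     t \<in> module.span tscale {tprod s (tprod s x r) y | x r y.
       x \<in> tensor_power s UNIV i \<and> r \<in> R_assoc s R \<and> y \<in> tensor_power s UNIV j}}"

definition assoc_koszul_dual :: "('k::field \<Rightarrow> 'v::ab_group_add \<Rightarrow> 'v) \<Rightarrow> ('k, 'v) tens set \<Rightarrow>
    ('k, ('k, 'v) tens) coalg" where
  "assoc_koszul_dual s R = (tensor_coalg s)
     \<lparr>gr := (\<lambda>i. if i < 0 then {0} else assoc_koszul_gr s R (nat i))\<rparr>"


section \<open>The comparison\<close>

text \<open>The canonical morphism \<open>Liec ((qA\<^sup>+)\<^sup>\<exclamdown>) \<rightarrow> (qA)\<^sup>\<exclamdown>\<close>: the one compatible with the projections of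
  both sides to \<open>sV\<close>.\<close>

definition canonical_counit :: "('k::field \<Rightarrow> 'v::ab_group_add \<Rightarrow> 'v) \<Rightarrow> ('k, 'v) tens set \<Rightarrow>
    ('k, 'l::ab_group_add) lie_coalg \<Rightarrow> ('l \<Rightarrow> 'v) \<Rightarrow> (('k, 'v) tens \<Rightarrow> 'l) \<Rightarrow> bool" where
  "canonical_counit s R L pr \<epsilon> \<longleftrightarrow>
     lie_morphism (Liec (assoc_koszul_dual s R)) (lie_koszul_dual s R L pr) \<epsilon> \<and>
     (\<forall>x\<in>carr (assoc_koszul_dual s R). ptens s [pr (\<epsilon> x)] = tensor_proj s 1 x)"

text \<open>\<open>(U, \<eta>)\<close> is \<open>\<U>\<^sup>c((qA)\<^sup>\<exclamdown>)\<close>.  The remark on types at \<open>cofree_conilpotent_lie\<close> applies here too, as this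
  predicate only occurs as a hypothesis.\<close>

definition is_Uc_koszul :: "('k::field \<Rightarrow> 'v::ab_group_add \<Rightarrow> 'v) \<Rightarrow> ('k, 'v) tens set \<Rightarrow>
    ('k, 'l::ab_group_add) lie_coalg \<Rightarrow> ('l \<Rightarrow> 'v) \<Rightarrow> ('k, 'u::ab_group_add) coalg \<Rightarrow> ('u \<Rightarrow> 'l) \<Rightarrow> bool" where
  "is_Uc_koszul s R L pr U \<eta> \<longleftrightarrow>
     coenveloping TYPE('u) (lie_koszul_dual s R L pr) U \<eta> \<and>
     coenveloping TYPE(('k, 'v) tens) (lie_koszul_dual s R L pr) U \<eta>"

definition canonical_iso :: "('k::field \<Rightarrow> 'v::ab_group_add \<Rightarrow> 'v) \<Rightarrow> ('k, 'v) tens set \<Rightarrow>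
    ('l \<Rightarrow> 'v) \<Rightarrow> ('k, 'u::ab_group_add) coalg \<Rightarrow> ('u \<Rightarrow> 'l) \<Rightarrow> ('u \<Rightarrow> ('k, 'v) tens) \<Rightarrow> bool" where
  "canonical_iso s R pr U \<eta> \<Phi> \<longleftrightarrow> coalg_iso U (assoc_koszul_dual s R) \<Phi> \<and>
     (\<forall>x\<in>carr U. tensor_proj s 1 (\<Phi> x) = ptens s [pr (\<eta> x)])"

text \<open>\<open>\<phi> : V \<rightarrow> V'\<close> is linear with \<open>Sym\<^sup>2(\<phi>)(qR) \<subseteq> qR'\<close>.  Every morphism of filtered algebras
  \<open>A(V, R) \<rightarrow> A(V', R')\<close> has such a map as its leading part, and it is this part which acts on the
  Koszul duals.\<close>

definition quadratic_map :: "('k::field \<Rightarrow> 'v::ab_group_add \<Rightarrow> 'v) \<Rightarrow> ('k, 'v) tens set \<Rightarrow>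
    ('k \<Rightarrow> 'w::ab_group_add \<Rightarrow> 'w) \<Rightarrow> ('k, 'w) tens set \<Rightarrow> ('v \<Rightarrow> 'w) \<Rightarrow> bool" where
  "quadratic_map s R s' R' \<phi> \<longleftrightarrow> Vector_Spaces.linear s s' \<phi> \<and> sym_map s' \<phi> ` qR s R \<subseteq> qR s' R'"

text \<open>\<open>h : L \<rightarrow> L'\<close> is the morphism \<open>L\<^sup>c(s\<phi>)\<close>.\<close>

definition lie_lift :: "('k::field, 'l::ab_group_add) lie_coalg \<Rightarrow> ('l \<Rightarrow> 'v) \<Rightarrow>
    ('k, 'm::ab_group_add) lie_coalg \<Rightarrow> ('m \<Rightarrow> 'w) \<Rightarrow> ('v \<Rightarrow> 'w) \<Rightarrow> ('l \<Rightarrow> 'm) \<Rightarrow> bool" where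
  "lie_lift L pr L' pr' \<phi> h \<longleftrightarrow> lie_morphism L L' h \<and> (\<forall>x\<in>carr L. pr' (h x) = \<phi> (pr x))"

end

theory Submission
  imports Defs
begin

text \<open>
  As \<open>V\<close> sits in degree \<open>0\<close>, weight and degree agree on both Koszul duals, and everything is
  controlled by degree \<open>1\<close>. A coalgebra map \<open>F : D \<rightarrow> T\<^sup>c(sV)\<close> is determined by its component
  \<open>\<gamma> : D \<rightarrow> sV\<close>, because the component in \<open>(sV)\<^sup>\<otimes>\<^sup>n\<close> is the \<open>n\<close>-fold convolution power of \<open>\<gamma>\<close>
  (\<open>coalg_morphism_proj\<close>). Conversely the powers of any degree \<open>0\<close> map \<open>\<gamma>\<close> assemble to a coalgebra map:
  the \<open>n\<close>-th power vanishes outside degree \<open>n\<close>, so only one of them is nonzero on a homogeneous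
  element and no sum is infinite. By associativity of convolution the map lands in \<open>(qA\<^sup>+)\<^sup>\<exclamdown>\<close> as soon
  as the convolution square of \<open>\<gamma>\<close> has values in \<open>R'\<close> (\<open>coalg_morphism_exists\<close>).

  A Lie morphism \<open>f\<close> from \<open>Liec D\<close> to \<open>L = L\<^sup>c(sV)\<close> is likewise determined by \<open>\<gamma> = pr \<circ> f\<close>
  (\<open>lie_morphism_to_cofree_unique\<close>). The universal property of \<open>L\<close> only speaks of conilpotent Lie
  coalgebras, but it has two consequences that suffice: \<open>L\<close> is concentrated in positive degrees,
  because the truncation of a Lie coalgebra to positive degrees is a conilpotent quotient of it,
  and \<open>pr\<close> is injective on homogeneous elements with zero cobracket. The claim follows by induction
  on the degree.

  The two sides are matched by the Koszul sign. For \<open>y = (\<gamma> \<otimes> \<gamma>)(\<Delta> x)\<close> one has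
  \<open>(\<gamma> \<otimes> \<gamma>)(\<Delta> x - \<tau> \<Delta> x) = y + y'\<close> with \<open>y'\<close> the unsigned flip of \<open>y\<close>, since only degree \<open>1\<close> elements
  contribute; this is the symmetrization of the class of \<open>y\<close> in \<open>Sym\<^sup>2(V)\<close>. As symmetrization is
  injective in characteristic zero, the image of \<open>f\<close> in \<open>\<and>\<^sup>2(sV)\<close> lies in \<open>s\<^sup>2qR\<close> if and only if \<open>y\<close> lies in
  \<open>R'\<close> (\<open>cobracket_symmetrize\<close>, \<open>R_assoc_iff\<close>). So a Lie morphism \<open>Liec D \<rightarrow> (qA)\<^sup>\<exclamdown>\<close> and its lift to a
  coalgebra morphism \<open>D \<rightarrow> (qA\<^sup>+)\<^sup>\<exclamdown>\<close> are both given by the same \<open>\<gamma>\<close>, which is the universal property. The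
  counit of the adjunction exists because \<open>L\<close> is cofree for the truncation of \<open>Liec ((qA\<^sup>+)\<^sup>\<exclamdown>)\<close>.

  The isomorphism with any other model of \<open>\<U>\<^sup>c((qA)\<^sup>\<exclamdown>)\<close> is uniqueness of universal objects, and
  naturality holds because two coalgebra maps with the same degree \<open>1\<close> component coincide. What
  remains is multilinear algebra: well-definedness of maps given on pure tensors, co-Jacobi for
  the commutator cobracket (\<open>lie_coalgebra_Liec\<close>), and closure of \<open>(qA\<^sup>+)\<^sup>\<exclamdown>\<close> under deconcatenation
  (\<open>koszul_deconcat\<close>), which comes down to \<open>(C \<otimes> T) \<inter> (T \<otimes> C') = C \<otimes> C'\<close>.
\<close>

section \<open>Linear maps on subspaces\<close>

text \<open>
  The maps of interest are only meaningful on subspaces of a type (the carrier of a graded space,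
  the span of some pure tensors), so linearity is relativised.
\<close>

definition lin_on :: "'a::ab_group_add set \<Rightarrow> ('k::field \<Rightarrow> 'a \<Rightarrow> 'a) \<Rightarrow>
    ('k \<Rightarrow> 'b::ab_group_add \<Rightarrow> 'b) \<Rightarrow> ('a \<Rightarrow> 'b) \<Rightarrow> bool" where
  "lin_on A s s' f \<longleftrightarrow> (\<forall>x\<in>A. \<forall>y\<in>A. f (x + y) = f x + f y) \<and> (\<forall>c. \<forall>x\<in>A. f (s c x) = s' c (f x))"

lemma linear_on_iff: "linear_on M s' f \<longleftrightarrow> lin_on (carr M) (scl M) s' f"
  by (simp add: linear_on_def lin_on_def)

lemma lin_onI:
  assumes "\<And>x y. x \<in> A \<Longrightarrow> y \<in> A \<Longrightarrow> f (x + y) = f x + f y"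
    and "\<And>c x. x \<in> A \<Longrightarrow> f (s c x) = s' c (f x)"
  shows "lin_on A s s' f"
  using assms by (simp add: lin_on_def)

lemma lin_on_add: "lin_on A s s' f \<Longrightarrow> x \<in> A \<Longrightarrow> y \<in> A \<Longrightarrow> f (x + y) = f x + f y"
  by (simp add: lin_on_def)

lemma lin_on_scale: "lin_on A s s' f \<Longrightarrow> x \<in> A \<Longrightarrow> f (s c x) = s' c (f x)"
  by (simp add: lin_on_def)

lemma lin_on_zero:
  assumes "lin_on A s s' f" "0 \<in> A" shows "f 0 = 0"
proof -
  have "f (0 + 0) = f 0 + f 0" using assms by (blast intro: lin_on_add)
  then show ?thesis by simp
qed

lemma lin_on_subset: "lin_on A s s' f \<Longrightarrow> B \<subseteq> A \<Longrightarrow> lin_on B s s' f"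
  by (simp add: lin_on_def subset_iff)

lemma lin_on_comp:
  assumes "lin_on A s s' f" "\<And>x. x \<in> A \<Longrightarrow> f x \<in> B" "lin_on B s' s'' g"
  shows "lin_on A s s'' (\<lambda>x. g (f x))"
  using assms by (auto simp: lin_on_def)

lemma lin_on_cong:
  assumes "vector_space s" "module.subspace s A" "\<And>x. x \<in> A \<Longrightarrow> f x = g x"
  shows "lin_on A s s' f \<longleftrightarrow> lin_on A s s' g"
proof -
  interpret vector_space s by fact
  show ?thesis using assms(2,3) by (auto simp: lin_on_def subspace_add subspace_scale)
qed

lemma linear_lin_on: "Vector_Spaces.linear s s' f \<Longrightarrow> lin_on A s s' f"
  by (simp add: lin_on_def Vector_Spaces.linear_iff)

lemma lin_on_diff:
  assumes "vector_space s" "module.subspace s A" "lin_on A s s' f" "x \<in> A" "y \<in> A"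
  shows "f (x - y) = f x - f y"
proof -
  interpret vector_space s by fact
  have "f (x - y + y) = f (x - y) + f y"
    using assms by (intro lin_on_add[OF assms(3)] subspace_diff)
  then show ?thesis by simp
qed

lemma lin_on_sum:
  assumes "vector_space s" "module.subspace s A" "lin_on A s s' f" "finite I" "\<And>i. i \<in> I \<Longrightarrow> x i \<in> A"
  shows "f (\<Sum>i\<in>I. x i) = (\<Sum>i\<in>I. f (x i))"
proof -
  interpret vector_space s by fact
  show ?thesis using assms(4,5)
    by (induction I rule: finite_induct)
      (use assms(2,3) in \<open>auto simp: lin_on_zero subspace_0 lin_on_add subspace_sum\<close>)
qed

lemma lin_on_eq_span:
  assumes "vector_space s" "lin_on (module.span s S) s s' f" "lin_on (module.span s S) s s' g"
    and "\<And>x. x \<in> S \<Longrightarrow> f x = g x" and "x \<in> module.span s S"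
  shows "f x = g x"
proof -
  interpret vector_space s by fact
  have "x \<in> span S \<and> f x = g x" using assms(5)
  proof (induction rule: span_induct)
    case base
    show ?case
      using lin_on_zero[OF assms(2)] lin_on_zero[OF assms(3)] lin_on_add[OF assms(2)] lin_on_add[OF assms(3)]
        lin_on_scale[OF assms(2)] lin_on_scale[OF assms(3)]
      by (auto intro!: subspaceI simp: span_zero span_add span_scale)
  qed (use assms(4) in \<open>auto simp: span_base\<close>)
  then show ?thesis by blast
qed

lemma lin_on_image_span:
  assumes "vector_space s" "lin_on (module.span s S) s s' f" "vector_space s'" "module.subspace s' B"
    and "\<And>x. x \<in> S \<Longrightarrow> f x \<in> B" and "x \<in> module.span s S"
  shows "f x \<in> B"
proof -
  interpret vector_space s by fact
  interpret t: vector_space s' by fact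
  have "x \<in> span S \<and> f x \<in> B" using assms(6)
  proof (induction rule: span_induct)
    case base
    show ?case
      using lin_on_zero[OF assms(2)] lin_on_add[OF assms(2)] lin_on_scale[OF assms(2)] assms(4)
      by (auto intro!: subspaceI simp: span_zero span_add span_scale t.subspace_0 t.subspace_add t.subspace_scale)
  qed (use assms(5) in \<open>auto simp: span_base\<close>)
  then show ?thesis by blast
qed

lemma lin_on_image_subspace:
  assumes "vector_space s" "module.subspace s A" "lin_on A s s' f" "vector_space s'"
  shows "module.subspace s' (f ` A)"
proof -
  interpret vector_space s by fact
  interpret t: vector_space s' by fact
  show ?thesis
  proof (rule t.subspaceI)
    show "0 \<in> f ` A" using lin_on_zero[OF assms(3)] subspace_0[OF assms(2)] by (metis imageI)
  next
    fix x y assume "x \<in> f ` A" "y \<in> f ` A"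
    then obtain a b where "a \<in> A" "b \<in> A" "x = f a" "y = f b" by auto
    then show "x + y \<in> f ` A" using lin_on_add[OF assms(3)] subspace_add[OF assms(2)] by (metis imageI)
  next
    fix c x assume "x \<in> f ` A"
    then show "s' c x \<in> f ` A" using lin_on_scale[OF assms(3)] subspace_scale[OF assms(2)] by (metis imageE imageI)
  qed
qed

lemma lin_on_minus:
  assumes "vector_space s'" "lin_on A s s' f" "lin_on A s s' g" 
  shows "lin_on A s s' (\<lambda>x. f x - g x)"
proof -
  interpret t: vector_space s' by fact
  show ?thesis using assms(2,3) by (auto simp: lin_on_def t.scale_right_diff_distrib)
qed

lemma lin_on_id: "lin_on A s s (\<lambda>x. x)"
  by (simp add: lin_on_def)

lemma lin_on_const_zero: "vector_space s' \<Longrightarrow> lin_on A s s' (\<lambda>x. 0)"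
proof -
  assume "vector_space s'"
  then interpret t: vector_space s' .
  show ?thesis by (simp add: lin_on_def)
qed

lemma lin_on_scaled:
  assumes "vector_space s'" "lin_on A s s' f"
  shows "lin_on A s s' (\<lambda>x. s' c (f x))"
proof -
  interpret t: vector_space s' by fact
  show ?thesis using assms(2) by (auto simp: lin_on_def t.scale_right_distrib mult.commute)
qed

lemma lin_on_sum_fun:
  assumes "vector_space s'" "\<And>i. i \<in> I \<Longrightarrow> lin_on A s s' (f i)"
  shows "lin_on A s s' (\<lambda>x. \<Sum>i\<in>I. f i x)"
proof -
  interpret t: vector_space s' by fact
  show ?thesis using assms(2) by (auto simp: lin_on_def t.scale_sum_right sum.distrib[symmetric] intro!: sum.cong)
qed

text \<open>
  Turns maps given on a subspace into maps on the whole type by composition with the projection.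
\<close>

lemma subspace_projection:
  assumes "vector_space s" "module.subspace s A"
  shows "\<exists>P. Vector_Spaces.linear s s P \<and> (\<forall>x. P x \<in> A) \<and> (\<forall>x\<in>A. P x = x)"
proof -
  interpret vector_space s by fact
  interpret vector_space_pair s s ..
  have "\<exists>g. g ` UNIV \<subseteq> A \<and> Vector_Spaces.linear s s g \<and> (\<forall>v\<in>A. g (id v) = v)"
    by (rule linear_exists_left_inverse_on) (use assms in \<open>auto simp: Vector_Spaces.linear_iff scale_right_distrib\<close>)
  then show ?thesis by auto
qed

lemma graded_space_vs: "graded_space M \<Longrightarrow> vector_space (scl M)"
  by (simp add: graded_space_def)

lemma carr_subspace: assumes "graded_space M" shows "module.subspace (scl M) (carr M)"
proof -
  interpret vector_space "scl M" using assms graded_space_vs by blast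
  show ?thesis by (simp add: carr_def)
qed

lemma gr_subspace: "graded_space M \<Longrightarrow> module.subspace (scl M) (gr M i)"
  by (simp add: graded_space_def)

lemma gr_homog: "x \<in> gr M i \<Longrightarrow> x \<in> homog M"
  by (auto simp: homog_def)

lemma homog_carr: assumes "graded_space M" "x \<in> homog M" shows "x \<in> carr M"
proof -
  interpret vector_space "scl M" using assms graded_space_vs by blast
  show ?thesis using assms(2) by (simp add: carr_def span_base)
qed

lemma gr_carr: "graded_space M \<Longrightarrow> x \<in> gr M i \<Longrightarrow> x \<in> carr M"
  by (rule homog_carr[OF _ gr_homog])

lemma graded_space_independent:
  assumes "graded_space M" "finite I" "\<And>i. i \<in> I \<Longrightarrow> x i \<in> gr M i" "(\<Sum>i\<in>I. x i) = 0" "i \<in> I"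
  shows "x i = 0"
  using assms unfolding graded_space_def by blast

lemma graded_space_sub:
  assumes "graded_space M" "scl N = scl M" "\<And>i. gr N i \<subseteq> gr M i" "\<And>i. module.subspace (scl M) (gr N i)"
  shows "graded_space N"
  unfolding graded_space_def
proof (intro conjI allI impI)
  show "vector_space (scl N)" "module.subspace (scl N) (gr N i)" for i
    using assms graded_space_vs by simp_all
  fix I x assume "finite I \<and> (\<forall>i\<in>I. x i \<in> gr N i) \<and> sum x I = 0"
  then show "\<forall>i\<in>I. x i = 0" using graded_space_independent[OF assms(1), of I x] assms(3) by blast
qed

lemma gr_disjoint:
  assumes "graded_space M" "x \<in> gr M i" "x \<in> gr M j" "i \<noteq> j"
  shows "x = 0"
proof -
  interpret vector_space "scl M" using assms graded_space_vs by blast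
  have "- x \<in> gr M j" using subspace_neg[OF gr_subspace[OF assms(1)] assms(3)] .
  define y where "y l = (if l = i then x else - x)" for l
  have "\<forall>l\<in>{i,j}. y l \<in> gr M l" using assms \<open>- x \<in> gr M j\<close> by (auto simp: y_def)
  moreover have "(\<Sum>l\<in>{i,j}. y l) = 0" using assms(4) by (simp add: y_def)
  ultimately have "\<forall>l\<in>{i,j}. y l = 0"
    using graded_space_independent[OF assms(1), of "{i, j}" y] by blast
  then show ?thesis by (simp add: y_def)
qed

lemma deg_eq: assumes "graded_space M" "x \<in> gr M i" "x \<noteq> 0" shows "deg M x = i"
  unfolding deg_def by (rule the_equality) (use assms gr_disjoint[OF assms(1)] in auto)

text \<open>
  Bases of the components are jointly independent because the sum of the components is direct, so
  a linear map may be prescribed separately in each degree. This is the source of parity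
  operators, truncations and degree-preserving projections that are defined on the whole type.
\<close>

lemma graded_extension:
  assumes M: "graded_space M" and s': "vector_space s'"
    and f: "\<And>i. lin_on (gr M i) (scl M) s' (f i)"
  shows "\<exists>F. Vector_Spaces.linear (scl M) s' F \<and> (\<forall>i. \<forall>x\<in>gr M i. F x = f i x)"
proof -
  interpret vector_space "scl M" using M graded_space_vs by blast
  interpret t: vector_space s' by fact
  interpret vector_space_pair "scl M" s' ..
  have "\<exists>C. C \<subseteq> gr M i \<and> independent C \<and> gr M i \<subseteq> span C" for i
    by (metis basis_exists)
  then obtain C where C: "\<And>i. C i \<subseteq> gr M i" "\<And>i. independent (C i)" "\<And>i. gr M i \<subseteq> span (C i)"
    by metis
  have nz: "0 \<notin> C i" for i using C(2) dependent_zero by blast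
  define ix where "ix b = (SOME i. b \<in> C i)" for b
  have ix: "ix b = i" if "b \<in> C i" for b i
  proof -
    have "b \<in> C (ix b)" unfolding ix_def using that by (rule someI)
    then show ?thesis using gr_disjoint[OF M, of b i "ix b"] C(1) that nz by blast
  qed
  have ind: "independent (\<Union>i. C i)"
    unfolding independent_explicit_finite_subsets
  proof (intro allI impI ballI)
    fix S u v assume S: "S \<subseteq> (\<Union>i. C i)" "finite S" "(\<Sum>v\<in>S. scl M (u v) v) = 0" "v \<in> S"
    define y where "y i = (\<Sum>b\<in>{b\<in>S. ix b = i}. scl M (u b) b)" for i
    have SC: "b \<in> C (ix b)" if "b \<in> S" for b using that S(1) ix by (metis UN_E subsetD)
    have "(\<Sum>i\<in>ix ` S. y i) = 0" unfolding y_def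
      using S(3) sum.image_gen[OF S(2), of "\<lambda>v. scl M (u v) v" ix] by simp
    moreover have "y i \<in> gr M i" for i
      unfolding y_def using SC C(1) gr_subspace[OF M]
      by (intro subspace_sum subspace_scale) auto
    ultimately have "\<forall>i\<in>ix ` S. y i = 0"
      using graded_space_independent[OF M, of "ix ` S" y] S(2) by blast
    then have "y (ix v) = 0" using S(4) by simp
    moreover have "{b\<in>S. ix b = ix v} \<subseteq> C (ix v)" using SC by force
    moreover have "finite {b\<in>S. ix b = ix v}" using S(2) by simp
    ultimately show "u v = 0"
      using C(2)[of "ix v"] S(4) unfolding independent_explicit_finite_subsets y_def by blast
  qed
  obtain F where F: "Vector_Spaces.linear (scl M) s' F" "\<forall>b\<in>(\<Union>i. C i). F b = f (ix b) b"
    using linear_independent_extend[OF ind, of "\<lambda>b. f (ix b) b"] by blast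
  have "F x = f i x" if "x \<in> gr M i" for i x
  proof (rule lin_on_eq_span[of "scl M" "C i" s'])
    show "lin_on (span (C i)) (scl M) s' F" using F(1) by (rule linear_lin_on)
    have "span (C i) \<subseteq> gr M i" using C(1) gr_subspace[OF M] by (simp add: span_minimal)
    then show "lin_on (span (C i)) (scl M) s' (f i)" using f lin_on_subset by blast
    show "x \<in> span (C i)" using that C(3) by blast
    show "F b = f i b" if "b \<in> C i" for b using F(2) ix that by auto
  qed unfold_locales
  with F(1) show ?thesis by blast
qed

section \<open>Tensors and linear extension\<close>

lemma tens_vector_space: "vector_space (tscale :: 'k::field \<Rightarrow> ('b \<Rightarrow> 'k) \<Rightarrow> _)"
  by unfold_locales (auto simp: tscale_def fun_eq_iff algebra_simps)

interpretation tens: vector_space "tscale :: 'k::field \<Rightarrow> ('b \<Rightarrow> 'k) \<Rightarrow> _"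
  by (rule tens_vector_space)

lemma tscale_apply: "tscale c t \<mu> = c * t \<mu>" by (simp add: tscale_def)

lemma multilinear_add: "multilinear s \<mu> \<Longrightarrow> \<mu> (xs @ (a + b) # ys) = \<mu> (xs @ a # ys) + \<mu> (xs @ b # ys)"
  by (simp add: multilinear_def)

lemma multilinear_scale: "multilinear s \<mu> \<Longrightarrow> \<mu> (xs @ s c a # ys) = c * \<mu> (xs @ a # ys)"
  by (simp add: multilinear_def)

lemma multilinearI:
  assumes "\<And>xs ys a b. \<mu> (xs @ (a + b) # ys) = \<mu> (xs @ a # ys) + \<mu> (xs @ b # ys)"
    "\<And>xs ys c a. \<mu> (xs @ s c a # ys) = c * \<mu> (xs @ a # ys)"
  shows "multilinear s \<mu>"
  using assms by (simp add: multilinear_def)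

lemma ptens_add: "ptens s (xs @ (a + b) # ys) = ptens s (xs @ a # ys) + ptens s (xs @ b # ys)"
  by (auto simp: ptens_def fun_eq_iff multilinear_add)

lemma ptens_scale: "ptens s (xs @ s c a # ys) = tscale c (ptens s (xs @ a # ys))"
  by (auto simp: ptens_def fun_eq_iff multilinear_scale tscale_def)

lemma ptens_zero: "ptens s (xs @ 0 # ys) = 0"
proof -
  have "ptens s (xs @ (0 + 0) # ys) = ptens s (xs @ 0 # ys) + ptens s (xs @ 0 # ys)"
    by (rule ptens_add)
  then show ?thesis by simp
qed

lemma lin_on_ptens1: "lin_on A s tscale (\<lambda>a. ptens s [a])"
  using ptens_add[of s "[]" _ _ "[]"] ptens_scale[of s "[]" _ _ "[]"] by (auto simp: lin_on_def)

text \<open>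
  The linear map that \<open>tlift s W f\<close> is meant to be exists if, for each form \<open>\<mu>\<close> on the target, the
  function \<open>xs \<mapsto> f xs \<mu>\<close> on \<open>W\<close> is the restriction of a multilinear form: tensors are functionals on
  forms, so the linear map is precomposition with \<open>\<mu> \<mapsto> \<nu>\<close>.
\<close>

definition extendable :: "('k::field \<Rightarrow> 'a::ab_group_add \<Rightarrow> 'a) \<Rightarrow> 'a list set \<Rightarrow> ('a list \<Rightarrow> ('k, 'b) tens) \<Rightarrow> bool" where
  "extendable s W f \<longleftrightarrow> (\<forall>\<mu>. \<exists>\<nu>. multilinear s \<nu> \<and> (\<forall>xs\<in>W. \<nu> xs = f xs \<mu>))"

lemma extendable_subset:
  assumes "extendable s W f" "V \<subseteq> W" "\<And>xs. xs \<in> V \<Longrightarrow> f xs = g xs"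
  shows "extendable s V g"
  unfolding extendable_def using assms unfolding extendable_def by (metis subsetD)

lemma extendable_UNIV: "(\<And>\<mu>. multilinear s (\<lambda>xs. f xs \<mu>)) \<Longrightarrow> extendable s W f"
  unfolding extendable_def by blast

lemma span_ptens_list:
  assumes "t \<in> tens.span (ptens s ` W)"
  obtains cs where "snd ` set cs \<subseteq> W" "t = (\<Sum>(c, xs)\<leftarrow>cs. tscale c (ptens s xs))"
proof -
  from assms have "\<exists>cs. snd ` set cs \<subseteq> W \<and> t = (\<Sum>(c, xs)\<leftarrow>cs. tscale c (ptens s xs))"
  proof (induction rule: tens.span_induct_alt)
    case base
    show ?case by (rule exI[of _ "[]"]) auto
  next
    case (step c x y)
    then obtain cs xs where "snd ` set cs \<subseteq> W" "y = (\<Sum>(c, xs)\<leftarrow>cs. tscale c (ptens s xs))" "xs \<in> W" "x = ptens s xs"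
      by auto
    then show ?case by (intro exI[of _ "(c, xs) # cs"]) auto
  qed
  with that show ?thesis by blast
qed

text \<open>
  Precomposition with a choice of extending forms is linear on all functionals and has the right
  values on pure tensors, hence on every representation of a tensor by pure tensors; this makes
  the definite description unique.
\<close>

lemma tlift_extension:
  assumes "extendable s W f"
  obtains G where "lin_on UNIV tscale tscale G" "\<And>xs. xs \<in> W \<Longrightarrow> G (ptens s xs) = f xs"
    "\<And>t. t \<in> tens.span (ptens s ` W) \<Longrightarrow> tlift s W f t = G t"
proof -
  obtain T where T: "\<And>\<mu>. multilinear s (T \<mu>)" "\<And>\<mu> xs. xs \<in> W \<Longrightarrow> T \<mu> xs = f xs \<mu>"
    using assms unfolding extendable_def by metis
  define G where "G t = (\<lambda>\<mu>. t (T \<mu>))" for t :: "('b list \<Rightarrow> 'a) \<Rightarrow> 'a"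
  have G: "lin_on UNIV tscale tscale G"
    by (auto simp: lin_on_def G_def fun_eq_iff tscale_def)
  have Gp: "G (ptens s xs) = f xs" if "xs \<in> W" for xs
    using T that by (auto simp: G_def ptens_def fun_eq_iff)
  have Gl: "G (\<Sum>(c, xs)\<leftarrow>cs. tscale c (ptens s xs)) = (\<Sum>(c, xs)\<leftarrow>cs. tscale c (f xs))"
    if "snd ` set cs \<subseteq> W" for cs
    using that
  proof (induction cs)
    case Nil
    show ?case by (simp only: list.map sum_list.Nil lin_on_zero[OF G UNIV_I])
  next
    case (Cons p cs)
    obtain c xs where p: "p = (c, xs)" by (cases p)
    have "snd ` set cs \<subseteq> W" "xs \<in> W" using Cons.prems p by auto
    then show ?case
      by (simp only: p list.map sum_list.Cons prod.case lin_on_add[OF G UNIV_I UNIV_I]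
          lin_on_scale[OF G UNIV_I] Gp Cons.IH)
  qed
  have "tlift s W f t = G t" if t: "t \<in> tens.span (ptens s ` W)" for t
    unfolding tlift_def
  proof (rule the_equality)
    from t obtain cs where "snd ` set cs \<subseteq> W" "t = (\<Sum>(c, xs)\<leftarrow>cs. tscale c (ptens s xs))"
      by (rule span_ptens_list)
    then show "\<exists>cs. snd ` set cs \<subseteq> W \<and> t = (\<Sum>(c, xs)\<leftarrow>cs. tscale c (ptens s xs)) \<and>
      G t = (\<Sum>(c, xs)\<leftarrow>cs. tscale c (f xs))" using Gl by blast
  qed (use Gl in metis)
  with G Gp that show ?thesis by blast
qed

lemma tlift_lin:
  assumes "extendable s W f"
  shows "lin_on (tens.span (ptens s ` W)) tscale tscale (tlift s W f)"
proof -
  obtain G where "lin_on UNIV tscale tscale G" "\<And>t. t \<in> tens.span (ptens s ` W) \<Longrightarrow> tlift s W f t = G t"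
    using assms by (rule tlift_extension) blast
  note G = this
  show ?thesis
    by (rule lin_on_cong[OF tens_vector_space tens.subspace_span, THEN iffD2, OF G(2)])
      (use lin_on_subset[OF G(1)] in auto)
qed

lemma tlift_ptens:
  assumes "extendable s W f" "xs \<in> W"
  shows "tlift s W f (ptens s xs) = f xs"
proof -
  obtain G where "\<And>xs. xs \<in> W \<Longrightarrow> G (ptens s xs) = f xs"
    "\<And>t. t \<in> tens.span (ptens s ` W) \<Longrightarrow> tlift s W f t = G t"
    using assms(1) by (rule tlift_extension) blast
  then show ?thesis using assms(2) by (simp add: tens.span_base)
qed

lemma multilinear_map:
  assumes "multilinear s' \<mu>" "Vector_Spaces.linear s s' P"
  shows "multilinear s (\<lambda>xs. \<mu> (map P xs))"
proof -
  have "lin_on UNIV s s' P" using assms(2) by (rule linear_lin_on)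
  then show ?thesis using assms(1) by (intro multilinearI) (simp_all add: lin_on_def multilinear_add multilinear_scale)
qed

definition multilin_on :: "'a::ab_group_add set \<Rightarrow> nat \<Rightarrow> ('k::field \<Rightarrow> 'a \<Rightarrow> 'a) \<Rightarrow> ('a list \<Rightarrow> ('k, 'b) tens) \<Rightarrow> bool" where
  "multilin_on A n s f \<longleftrightarrow> (\<forall>xs ys. set xs \<subseteq> A \<longrightarrow> set ys \<subseteq> A \<longrightarrow> Suc (length xs + length ys) = n \<longrightarrow>
      lin_on A s tscale (\<lambda>a. f (xs @ a # ys)))"

lemma extendable_words:
  assumes "vector_space s" "module.subspace s A" "multilin_on A n s f"
  shows "extendable s (words A n) f"
  unfolding extendable_def
proof
  fix \<mu>
  obtain P where P: "Vector_Spaces.linear s s P" "\<And>x. P x \<in> A" "\<And>x. x \<in> A \<Longrightarrow> P x = x"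
    using subspace_projection[OF assms(1,2)] by blast
  have P1: "lin_on UNIV s s P" using P(1) by (rule linear_lin_on)
  define \<nu> where "\<nu> xs = (if length xs = n then f (map P xs) \<mu> else 0)" for xs
  have "lin_on A s tscale (\<lambda>a. f (map P xs @ a # map P ys))" if "Suc (length xs + length ys) = n" for xs ys
    using assms(3) P(2) that unfolding multilin_on_def by (simp add: image_subset_iff)
  then have "multilinear s \<nu>"
    by (intro multilinearI) (auto simp: \<nu>_def lin_on_add[OF P1] lin_on_scale[OF P1] P(2) lin_on_def tscale_def)
  moreover have "\<forall>xs\<in>words A n. \<nu> xs = f xs \<mu>"
  proof
    fix xs assume "xs \<in> words A n"
    moreover have "map P xs = xs" if "set xs \<subseteq> A" using that P(3) by (simp add: map_idI subset_iff)
    ultimately show "\<nu> xs = f xs \<mu>" by (auto simp: words_def \<nu>_def)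
  qed
  ultimately show "\<exists>\<nu>. multilinear s \<nu> \<and> (\<forall>xs\<in>words A n. \<nu> xs = f xs \<mu>)" by blast
qed

section \<open>The tensor algebra\<close>

lemma multilinear_append_left: "multilinear s \<mu> \<Longrightarrow> multilinear s (\<lambda>ys. \<mu> (xs @ ys))"
  by (rule multilinearI) (simp_all add: multilinear_add[where xs = "xs @ zs" for zs, simplified]
      multilinear_scale[where xs = "xs @ zs" for zs, simplified])

lemma multilinear_append_right: "multilinear s \<mu> \<Longrightarrow> multilinear s (\<lambda>xs. \<mu> (xs @ ys))"
  by (rule multilinearI) (simp_all add: multilinear_add multilinear_scale)

lemma multilinear_plus: "multilinear s \<mu> \<Longrightarrow> multilinear s \<nu> \<Longrightarrow> multilinear s (\<lambda>xs. \<mu> xs + \<nu> xs)"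
  by (rule multilinearI) (simp_all add: multilinear_add multilinear_scale algebra_simps)

lemma multilinear_times: "multilinear s \<mu> \<Longrightarrow> multilinear s (\<lambda>xs. c * \<mu> xs)"
  by (rule multilinearI) (simp_all add: multilinear_add multilinear_scale algebra_simps)

lemma multilinear_zero: "multilinear s (\<lambda>xs. 0)"
  by (rule multilinearI) simp_all

lemma multilinear_length: "multilinear s \<mu> \<Longrightarrow> multilinear s (\<lambda>xs. if P (length xs) then \<mu> xs else 0)"
  by (rule multilinearI) (simp_all add: multilinear_add multilinear_scale)

lemma ptens_in_T [simp]: "ptens s xs \<in> tensor_algebra s"
  by (simp add: tensor_algebra_def tens.span_base)

lemma T_subspace: "tens.subspace (tensor_algebra s)"
  by (simp add: tensor_algebra_def)

lemma T_zero: "0 \<in> tensor_algebra s"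
  by (simp add: T_subspace tens.subspace_0)

lemma tensor_power_T: "t \<in> tensor_power s A n \<Longrightarrow> t \<in> tensor_algebra s"
  unfolding tensor_power_def tensor_algebra_def by (rule subsetD[OF tens.span_mono[OF image_mono[OF subset_UNIV]]])

lemma tensor_power_subspace: "tens.subspace (tensor_power s A n)"
  by (simp add: tensor_power_def)

lemma T_induct [consumes 1, case_names zero add scale ptens]:
  assumes "t \<in> tensor_algebra s" "P 0" "\<And>t u. P t \<Longrightarrow> P u \<Longrightarrow> P (t + u)" "\<And>c t. P t \<Longrightarrow> P (tscale c t)"
    "\<And>xs. P (ptens s xs)"
  shows "P t"
  using assms(1) unfolding tensor_algebra_def
  by (induction rule: tens.span_induct) (auto intro!: tens.subspaceI assms)

text \<open>
  Tensors are linear on multilinear forms, although as functions they are defined on arbitrary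
  ones. Bilinearity of \<open>tprod\<close> in its second argument rests on this.
\<close>

lemma T_apply_plus:
  assumes "t \<in> tensor_algebra s" "multilinear s \<mu>" "multilinear s \<nu>"
  shows "t (\<lambda>xs. \<mu> xs + \<nu> xs) = t \<mu> + t \<nu>"
  using assms(1)
  by (induction rule: T_induct) (simp_all add: tscale_def distrib_left ptens_def assms multilinear_plus)

lemma T_apply_times:
  assumes "t \<in> tensor_algebra s" "multilinear s \<mu>"
  shows "t (\<lambda>xs. c * \<mu> xs) = c * t \<mu>"
  using assms(1)
  by (induction rule: T_induct) (simp_all add: tscale_def distrib_left ptens_def assms multilinear_times)

lemma T_apply_nonlinear: "t \<in> tensor_algebra s \<Longrightarrow> \<not> multilinear s \<mu> \<Longrightarrow> t \<mu> = 0"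
  by (induction rule: T_induct) (simp_all add: tscale_def ptens_def)

lemma multilinear_contract_right:
  assumes "u \<in> tensor_algebra s" "multilinear s \<mu>"
  shows "multilinear s (\<lambda>xs. u (\<lambda>ys. \<mu> (xs @ ys)))"
  using assms(1)
proof (induction rule: T_induct)
  case (ptens zs)
  then show ?case using assms(2) by (simp add: ptens_def multilinear_append_left multilinear_append_right)
qed (simp_all add: tscale_def multilinear_zero multilinear_plus multilinear_times)

lemma tprod_add_left: "tprod s (t + t') u = tprod s t u + tprod s t' u"
  by (auto simp: tprod_def fun_eq_iff)

lemma tprod_scale_left: "tprod s (tscale c t) u = tscale c (tprod s t u)"
  by (auto simp: tprod_def fun_eq_iff tscale_def)

lemma tprod_lin_left: "lin_on A tscale tscale (\<lambda>t. tprod s t u)"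
  by (simp add: lin_on_def tprod_add_left tprod_scale_left)

lemma tprod_lin_right: "t \<in> tensor_algebra s \<Longrightarrow> lin_on (tensor_algebra s) tscale tscale (tprod s t)"
  by (auto simp: lin_on_def tprod_def fun_eq_iff tscale_def multilinear_contract_right
      T_apply_plus[where t = t and s = s] T_apply_times[where t = t and s = s])

lemmas tprod_add_right = lin_on_add[OF tprod_lin_right]
lemmas tprod_scale_right = lin_on_scale[OF tprod_lin_right]

lemma tprod_zero_left [simp]: "tprod s 0 u = 0"
  using lin_on_zero[OF tprod_lin_left UNIV_I] .

lemma tprod_zero_right: "t \<in> tensor_algebra s \<Longrightarrow> tprod s t 0 = 0"
  using lin_on_zero[OF tprod_lin_right T_zero] .

lemma tprod_ptens: "tprod s (ptens s xs) (ptens s ys) = ptens s (xs @ ys)"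
  by (auto simp: tprod_def ptens_def fun_eq_iff multilinear_append_left multilinear_append_right)

lemma T_closed:
  "t \<in> tensor_algebra s \<Longrightarrow> u \<in> tensor_algebra s \<Longrightarrow> t + u \<in> tensor_algebra s"
  "t \<in> tensor_algebra s \<Longrightarrow> u \<in> tensor_algebra s \<Longrightarrow> t - u \<in> tensor_algebra s"
  "t \<in> tensor_algebra s \<Longrightarrow> tscale c t \<in> tensor_algebra s"
  by (simp_all add: T_subspace tens.subspace_add tens.subspace_diff tens.subspace_scale)

lemma tprod_span:
  assumes t: "t \<in> tens.span S" and u: "u \<in> tens.span S'" and S: "S \<subseteq> tensor_algebra s" and S': "S' \<subseteq> tensor_algebra s"
    and X: "tens.subspace X" "\<And>x y. x \<in> S \<Longrightarrow> y \<in> S' \<Longrightarrow> tprod s x y \<in> X"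
  shows "tprod s t u \<in> X"
proof (rule lin_on_image_span[OF tens_vector_space tprod_lin_left tens_vector_space X(1) _ t])
  fix x assume x: "x \<in> S"
  have "tens.span S' \<subseteq> tensor_algebra s" using S' by (simp add: T_subspace tens.span_minimal)
  with x S have "lin_on (tens.span S') tscale tscale (tprod s x)"
    by (intro lin_on_subset[OF tprod_lin_right]) auto
  then show "tprod s x u \<in> X"
    by (rule lin_on_image_span[OF tens_vector_space _ tens_vector_space X(1) _ u]) (use x X(2) in auto)
qed

lemma tprod_T: "t \<in> tensor_algebra s \<Longrightarrow> u \<in> tensor_algebra s \<Longrightarrow> tprod s t u \<in> tensor_algebra s"
  by (rule tprod_span[where S = "range (ptens s)" and S' = "range (ptens s)"])
    (auto simp: T_subspace tprod_ptens, auto simp: tensor_algebra_def)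

lemma tprod_tensor_power:
  assumes "t \<in> tensor_power s A m" "u \<in> tensor_power s A n"
  shows "tprod s t u \<in> tensor_power s A (m + n)"
  by (rule tprod_span[OF assms[unfolded tensor_power_def]])
    (auto simp: tensor_power_subspace tprod_ptens, auto simp: tensor_power_def words_def intro!: tens.span_base)

lemma tprod_assoc:
  assumes "v \<in> tensor_algebra s"
  shows "tprod s (tprod s t u) v = tprod s t (tprod s u v)"
  by (auto simp: tprod_def fun_eq_iff multilinear_contract_right[OF assms] multilinear_append_left)

lemma tprod_one_left: "u \<in> tensor_algebra s \<Longrightarrow> tprod s (ptens s []) u = u"
  by (auto simp: tprod_def ptens_def fun_eq_iff multilinear_contract_right T_apply_nonlinear)

lemma tprod_one_right: "u \<in> tensor_algebra s \<Longrightarrow> tprod s u (ptens s []) = u"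
  by (auto simp: tprod_def ptens_def fun_eq_iff multilinear_append_left T_apply_nonlinear)

lemma words_2: "words A 2 = {[a, b] | a b. a \<in> A \<and> b \<in> A}"
  by (auto simp: words_def numeral_2_eq_2 length_Suc_conv)

lemma words_3: "words A 3 = {[a, b, c] | a b c. a \<in> A \<and> b \<in> A \<and> c \<in> A}"
  by (auto simp: words_def numeral_3_eq_3 length_Suc_conv)

lemma ptens_add2:
  "ptens s [a + a', b] = ptens s [a, b] + ptens s [a', b]" "ptens s [a, b + b'] = ptens s [a, b] + ptens s [a, b']"
  "ptens s [s c a, b] = tscale c (ptens s [a, b])" "ptens s [a, s c b] = tscale c (ptens s [a, b])"
  using ptens_add[of s "[]" a a' "[b]"] ptens_add[of s "[a]" b b' "[]"]
    ptens_scale[of s "[]" c a "[b]"] ptens_scale[of s "[a]" c b "[]"] by simp_all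

lemma ptens_add3:
  "ptens s [a + a', b, d] = ptens s [a, b, d] + ptens s [a', b, d]"
  "ptens s [a, b + b', d] = ptens s [a, b, d] + ptens s [a, b', d]"
  "ptens s [a, b, d + d'] = ptens s [a, b, d] + ptens s [a, b, d']"
  "ptens s [s c a, b, d] = tscale c (ptens s [a, b, d])" "ptens s [a, s c b, d] = tscale c (ptens s [a, b, d])"
  "ptens s [a, b, s c d] = tscale c (ptens s [a, b, d])"
  using ptens_add[of s "[]" a a' "[b, d]"] ptens_add[of s "[a]" b b' "[d]"] ptens_add[of s "[a, b]" d d' "[]"]
    ptens_scale[of s "[]" c a "[b, d]"] ptens_scale[of s "[a]" c b "[d]"] ptens_scale[of s "[a, b]" c d "[]"] by simp_all

lemma ptens_zero_entry: assumes "0 \<in> set xs" shows "ptens s xs = 0"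
proof -
  obtain ys zs where "xs = ys @ 0 # zs" using split_list[OF assms] by blast
  then show ?thesis by (simp add: ptens_zero)
qed

text \<open>
  The prefix \<open>zs\<close> lets the induction expand one entry after the other from the left.
\<close>

lemma ptens_words_span:
  assumes "vector_space s" "xs \<in> words (module.span s S) n"
  shows "ptens s (zs @ xs) \<in> tens.span ((\<lambda>ys. ptens s (zs @ ys)) ` words S n)"
  using assms(2)
proof (induction n arbitrary: xs zs)
  case 0
  then have "xs = []" "[] \<in> words S 0" by (auto simp: words_def)
  then show ?case by (metis imageI tens.span_base)
next
  case (Suc n)
  interpret vector_space s by fact
  from Suc.prems obtain a ys where xs: "xs = a # ys" and a: "a \<in> span S" and ys: "ys \<in> words (span S) n"
    by (auto simp: words_def length_Suc_conv)
  have lin: "lin_on A s tscale (\<lambda>a. ptens s (zs @ a # ys))" for A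
    by (simp add: lin_on_def ptens_add ptens_scale)
  have "ptens s (zs @ a # ys) \<in> tens.span ((\<lambda>ys. ptens s (zs @ ys)) ` words S (Suc n))"
  proof (rule lin_on_image_span[OF assms(1) lin tens_vector_space tens.subspace_span _ a])
    fix x assume x: "x \<in> S"
    have "ptens s ((zs @ [x]) @ ys) \<in> tens.span ((\<lambda>ys. ptens s ((zs @ [x]) @ ys)) ` words S n)"
      by (rule Suc.IH[OF ys])
    moreover have "(\<lambda>ys. ptens s ((zs @ [x]) @ ys)) ` words S n \<subseteq> (\<lambda>ys. ptens s (zs @ ys)) ` words S (Suc n)"
    proof clarify
      fix w assume "w \<in> words S n"
      then have "x # w \<in> words S (Suc n)" using x by (auto simp: words_def)
      then show "ptens s ((zs @ [x]) @ w) \<in> (\<lambda>ys. ptens s (zs @ ys)) ` words S (Suc n)" by force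
    qed
    ultimately show "ptens s (zs @ x # ys) \<in> tens.span ((\<lambda>ys. ptens s (zs @ ys)) ` words S (Suc n))"
      using tens.span_mono by (metis (no_types, lifting) append.assoc append_Cons append_Nil subsetD)
  qed
  then show ?case by (simp add: xs)
qed

lemma words_mono: "A \<subseteq> B \<Longrightarrow> words A n \<subseteq> words B n"
  by (auto simp: words_def)

lemma tensor_power_mono: "A \<subseteq> B \<Longrightarrow> tensor_power s A n \<subseteq> tensor_power s B n"
  unfolding tensor_power_def by (intro tens.span_mono image_mono words_mono)

lemma tensor_power_span:
  assumes "vector_space s"
  shows "tensor_power s (module.span s S) n = tensor_power s S n"
proof
  interpret vector_space s by fact
  show "tensor_power s (span S) n \<subseteq> tensor_power s S n"
    unfolding tensor_power_def
    by (rule tens.span_minimal) (use ptens_words_span[OF assms, where zs = "[]"] in auto)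
  show "tensor_power s S n \<subseteq> tensor_power s (span S) n"
    by (rule tensor_power_mono) (rule span_superset)
qed

lemma tensor_power_carr: "graded_space M \<Longrightarrow> tensor_power (scl M) (carr M) n = tensor_power (scl M) (homog M) n"
  unfolding carr_def by (rule tensor_power_span) (rule graded_space_vs)

lemma square_gr_tensor_power: "graded_space M \<Longrightarrow> t \<in> square_gr M i \<Longrightarrow> t \<in> tensor_power (scl M) (carr M) 2"
  unfolding square_gr_def tensor_power_def
  by (erule rev_subsetD, rule tens.span_mono) (auto simp: words_2 gr_carr)

lemma ptens_tensor_power_2: "a \<in> A \<Longrightarrow> b \<in> A \<Longrightarrow> ptens s [a, b] \<in> tensor_power s A 2"
  unfolding tensor_power_def by (rule tens.span_base) (auto simp: words_2)

lemma square_gr_subspace: "tens.subspace (square_gr M i)"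
  by (simp add: square_gr_def)

lemma ptens_square_gr: "a \<in> gr M i \<Longrightarrow> b \<in> gr M j \<Longrightarrow> i + j = n \<Longrightarrow> ptens (scl M) [a, b] \<in> square_gr M n"
  unfolding square_gr_def by (rule tens.span_base) blast

lemma power_eqI:
  assumes "t \<in> tensor_power s A n" "lin_on (tensor_power s A n) tscale s' F" "lin_on (tensor_power s A n) tscale s' G"
    "\<And>xs. xs \<in> words A n \<Longrightarrow> F (ptens s xs) = G (ptens s xs)"
  shows "F t = G t"
  by (rule lin_on_eq_span[OF tens_vector_space assms(2)[unfolded tensor_power_def] assms(3)[unfolded tensor_power_def]
        _ assms(1)[unfolded tensor_power_def]]) (auto simp: assms(4))

lemma power_imageI:
  assumes "t \<in> tensor_power s A n" "lin_on (tensor_power s A n) tscale s' F" "vector_space s'" "module.subspace s' X"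
    "\<And>xs. xs \<in> words A n \<Longrightarrow> F (ptens s xs) \<in> X"
  shows "F t \<in> X"
  by (rule lin_on_image_span[OF tens_vector_space assms(2)[unfolded tensor_power_def] assms(3,4)
        _ assms(1)[unfolded tensor_power_def]]) (auto simp: assms(5))

lemma square_eqI:
  assumes "t \<in> tensor_power s A 2" "lin_on (tensor_power s A 2) tscale s' F" "lin_on (tensor_power s A 2) tscale s' G"
    "\<And>a b. a \<in> A \<Longrightarrow> b \<in> A \<Longrightarrow> F (ptens s [a, b]) = G (ptens s [a, b])"
  shows "F t = G t"
  using assms(1) unfolding tensor_power_def
  by (rule lin_on_eq_span[OF tens_vector_space assms(2)[unfolded tensor_power_def] assms(3)[unfolded tensor_power_def], rotated])
    (auto simp: words_2 assms(4))

lemma square_imageI: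
  assumes "t \<in> tensor_power s A 2" "lin_on (tensor_power s A 2) tscale s' F" "vector_space s'" "module.subspace s' X"
    "\<And>a b. a \<in> A \<Longrightarrow> b \<in> A \<Longrightarrow> F (ptens s [a, b]) \<in> X"
  shows "F t \<in> X"
  using assms(1) unfolding tensor_power_def
  by (rule lin_on_image_span[OF tens_vector_space assms(2)[unfolded tensor_power_def] assms(3,4), rotated])
    (auto simp: words_2 assms(5))

text \<open>
  A carrier is spanned by homogeneous elements, so identities of linear maps on its tensor square
  need only be checked there, where the Koszul signs are explicit.
\<close>

lemma square_homog_eqI:
  assumes "graded_space M" "t \<in> tensor_power (scl M) (carr M) 2"
    "lin_on (tensor_power (scl M) (carr M) 2) tscale s' F" "lin_on (tensor_power (scl M) (carr M) 2) tscale s' G"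
    "\<And>a b i j. a \<in> gr M i \<Longrightarrow> b \<in> gr M j \<Longrightarrow> F (ptens (scl M) [a, b]) = G (ptens (scl M) [a, b])"
  shows "F t = G t"
  using assms(2,3,4) unfolding tensor_power_carr[OF assms(1)]
  by (rule square_eqI) (auto simp: homog_def assms(5))

lemma square_homog_imageI:
  assumes "graded_space M" "t \<in> tensor_power (scl M) (carr M) 2"
    "lin_on (tensor_power (scl M) (carr M) 2) tscale s' F" "vector_space s'" "module.subspace s' X"
    "\<And>a b i j. a \<in> gr M i \<Longrightarrow> b \<in> gr M j \<Longrightarrow> F (ptens (scl M) [a, b]) \<in> X"
  shows "F t \<in> X"
  using assms(2,3,4,5) unfolding tensor_power_carr[OF assms(1)]
  by (rule square_imageI) (auto simp: homog_def assms(6))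

lemma square_gr_eqI:
  assumes M: "graded_space M" and t: "t \<in> square_gr M n"
    and F: "lin_on (tensor_power (scl M) (carr M) 2) tscale s' F" and G: "lin_on (tensor_power (scl M) (carr M) 2) tscale s' G"
    and eq: "\<And>a b i j. a \<in> gr M i \<Longrightarrow> b \<in> gr M j \<Longrightarrow> i + j = n \<Longrightarrow> F (ptens (scl M) [a, b]) = G (ptens (scl M) [a, b])"
  shows "F t = G t"
proof -
  have sub: "square_gr M n \<subseteq> tensor_power (scl M) (carr M) 2" using square_gr_tensor_power[OF M] by blast
  show ?thesis
    by (rule lin_on_eq_span[OF tens_vector_space lin_on_subset[OF F sub, unfolded square_gr_def]
          lin_on_subset[OF G sub, unfolded square_gr_def] _ t[unfolded square_gr_def]]) (auto simp: eq)
qed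

lemma square_gr_imageI:
  assumes M: "graded_space M" and t: "t \<in> square_gr M n"
    and F: "lin_on (tensor_power (scl M) (carr M) 2) tscale s' F" and X: "vector_space s'" "module.subspace s' X"
    and im: "\<And>a b i j. a \<in> gr M i \<Longrightarrow> b \<in> gr M j \<Longrightarrow> i + j = n \<Longrightarrow> F (ptens (scl M) [a, b]) \<in> X"
  shows "F t \<in> X"
proof -
  have sub: "square_gr M n \<subseteq> tensor_power (scl M) (carr M) 2" using square_gr_tensor_power[OF M] by blast
  show ?thesis
    by (rule lin_on_image_span[OF tens_vector_space lin_on_subset[OF F sub, unfolded square_gr_def]
          X _ t[unfolded square_gr_def]]) (auto simp: im)
qed

section \<open>Tensor products of maps\<close>

text \<open>
  A linear map with values in a tensor algebra, the admissible arguments of \<open>tensor_fun\<close>. Values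
  outside the tensor algebra would destroy bilinearity of \<open>tprod\<close>.
\<close>

definition tens_hom :: "'a::ab_group_add set \<Rightarrow> ('k::field \<Rightarrow> 'a \<Rightarrow> 'a) \<Rightarrow> ('k \<Rightarrow> 'b::ab_group_add \<Rightarrow> 'b) \<Rightarrow>
    ('a \<Rightarrow> ('k, 'b) tens) \<Rightarrow> bool" where
  "tens_hom A s s' f \<longleftrightarrow> vector_space s \<and> module.subspace s A \<and> lin_on A s tscale f \<and> (\<forall>a\<in>A. f a \<in> tensor_algebra s')"

lemma tens_homD:
  assumes "tens_hom A s s' f"
  shows "vector_space s" "module.subspace s A" "lin_on A s tscale f" "\<And>a. a \<in> A \<Longrightarrow> f a \<in> tensor_algebra s'"
  using assms by (auto simp: tens_hom_def)

lemma tens_hom_ptens1: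
  "vector_space s \<Longrightarrow> module.subspace s A \<Longrightarrow> lin_on A s s' f \<Longrightarrow> tens_hom A s s' (\<lambda>a. ptens s' [f a])"
  using lin_on_comp[of A s s' f UNIV tscale "\<lambda>a. ptens s' [a]"] lin_on_ptens1[of UNIV s'] by (simp add: tens_hom_def)

lemma tens_hom_subset:
  "tens_hom A s s' f \<Longrightarrow> module.subspace s B \<Longrightarrow> B \<subseteq> A \<Longrightarrow> tens_hom B s s' f"
  unfolding tens_hom_def using lin_on_subset by blast

lemma tensor_fun_extendable:
  assumes f: "tens_hom A s s' f" and g: "tens_hom A s s' g"
  shows "extendable s (words A 2) (\<lambda>xs. tprod s' (f (xs ! 0)) (g (xs ! 1)))"
proof (rule extendable_words[OF tens_homD(1,2)[OF f]])
  show "multilin_on A 2 s (\<lambda>xs. tprod s' (f (xs ! 0)) (g (xs ! 1)))"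
    unfolding multilin_on_def
  proof (intro allI impI)
    fix xs ys assume *: "set xs \<subseteq> A" "set ys \<subseteq> A" "Suc (length xs + length ys) = 2"
    then consider b where "xs = []" "ys = [b]" | a where "xs = [a]" "ys = []"
      by (cases xs; cases ys) auto
    then show "lin_on A s tscale (\<lambda>a. tprod s' (f ((xs @ a # ys) ! 0)) (g ((xs @ a # ys) ! 1)))"
    proof cases
      case 1
      then show ?thesis using lin_on_comp[OF tens_homD(3)[OF f] _ tprod_lin_left[of UNIV]] by simp
    next
      case 2
      then have "a \<in> A" using * by simp
      then show ?thesis using 2 lin_on_comp[OF tens_homD(3)[OF g] tens_homD(4)[OF g] tprod_lin_right] tens_homD(4)[OF f] by simp
    qed
  qed
qed

lemma tensor_fun_ptens:
  "tens_hom A s s' f \<Longrightarrow> tens_hom A s s' g \<Longrightarrow> a \<in> A \<Longrightarrow> b \<in> A \<Longrightarrow>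
    tensor_fun s A s' f g (ptens s [a, b]) = tprod s' (f a) (g b)"
  unfolding tensor_fun_def by (subst tlift_ptens[OF tensor_fun_extendable]) (auto simp: words_2)

lemma tensor_fun_lin:
  "tens_hom A s s' f \<Longrightarrow> tens_hom A s s' g \<Longrightarrow> lin_on (tensor_power s A 2) tscale tscale (tensor_fun s A s' f g)"
  unfolding tensor_fun_def tensor_power_def by (rule tlift_lin[OF tensor_fun_extendable])

lemma tensor_fun_T:
  "tens_hom A s s' f \<Longrightarrow> tens_hom A s s' g \<Longrightarrow> t \<in> tensor_power s A 2 \<Longrightarrow> tensor_fun s A s' f g t \<in> tensor_algebra s'"
  by (erule square_imageI[OF _ tensor_fun_lin tens_vector_space T_subspace])
    (simp_all add: tensor_fun_ptens tprod_T tens_homD)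

lemma tlift_cong:
  assumes "\<And>xs. xs \<in> W \<Longrightarrow> f xs = g xs"
  shows "tlift s W f = tlift s W g"
proof -
  have "(\<Sum>(c, xs)\<leftarrow>cs. tscale c (f xs)) = (\<Sum>(c, xs)\<leftarrow>cs. tscale c (g xs))" if "snd ` set cs \<subseteq> W" for cs
    using assms that by (intro arg_cong[where f = sum_list] map_cong) auto
  then show ?thesis unfolding tlift_def by (intro ext arg_cong[where f = The]) (metis (no_types, lifting))
qed

lemma tensor_fun_cong:
  "(\<And>a. a \<in> A \<Longrightarrow> f a = f' a) \<Longrightarrow> (\<And>a. a \<in> A \<Longrightarrow> g a = g' a) \<Longrightarrow>
    tensor_fun s A s' f g = tensor_fun s A s' f' g'"
  unfolding tensor_fun_def by (rule tlift_cong) (auto simp: words_2)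

lemma tensor_fun_restrict:
  assumes "tens_hom A s s' f" "tens_hom A s s' g" "module.subspace s B" "B \<subseteq> A" "t \<in> tensor_power s B 2"
  shows "tensor_fun s B s' f g t = tensor_fun s A s' f g t"
proof (rule square_eqI[OF assms(5)])
  note h = tens_hom_subset[OF assms(1,3,4)] tens_hom_subset[OF assms(2,3,4)]
  show "lin_on (tensor_power s B 2) tscale tscale (tensor_fun s B s' f g)" using h by (rule tensor_fun_lin)
  show "lin_on (tensor_power s B 2) tscale tscale (tensor_fun s A s' f g)"
    using lin_on_subset[OF tensor_fun_lin[OF assms(1,2)] tensor_power_mono[OF assms(4)]] .
  show "tensor_fun s B s' f g (ptens s [a, b]) = tensor_fun s A s' f g (ptens s [a, b])" if "a \<in> B" "b \<in> B" for a b
    using that assms(4) by (simp add: tensor_fun_ptens[OF h] tensor_fun_ptens[OF assms(1,2)] subset_iff)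
qed

lemma tensor_fun_map_power:
  assumes "vector_space s" "module.subspace s A" "lin_on A s s' f" "lin_on A s s' g"
    "\<And>a. a \<in> A \<Longrightarrow> f a \<in> B" "\<And>a. a \<in> A \<Longrightarrow> g a \<in> B" "t \<in> tensor_power s A 2"
  shows "tensor_fun s A s' (\<lambda>a. ptens s' [f a]) (\<lambda>a. ptens s' [g a]) t \<in> tensor_power s' B 2"
proof (rule square_imageI[OF assms(7) tensor_fun_lin tens_vector_space tensor_power_subspace])
  note h = tens_hom_ptens1[OF assms(1,2,3)] tens_hom_ptens1[OF assms(1,2,4)]
  show "tens_hom A s s' (\<lambda>a. ptens s' [f a])" "tens_hom A s s' (\<lambda>a. ptens s' [g a])" by fact+
  fix a b assume "a \<in> A" "b \<in> A"
  then show "tensor_fun s A s' (\<lambda>a. ptens s' [f a]) (\<lambda>a. ptens s' [g a]) (ptens s [a, b]) \<in> tensor_power s' B 2"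
    by (simp add: tensor_fun_ptens[OF h] tprod_ptens ptens_tensor_power_2 assms)
qed

lemma tens_hom_comp:
  assumes "vector_space s" "module.subspace s A" "lin_on A s s' f" "\<And>a. a \<in> A \<Longrightarrow> f a \<in> B" "tens_hom B s' s'' u"
  shows "tens_hom A s s'' (\<lambda>a. u (f a))"
  unfolding tens_hom_def using assms(1,2,4) tens_homD(4)[OF assms(5)] lin_on_comp[OF assms(3,4) tens_homD(3)[OF assms(5)]] by blast

lemma tensor_fun_comp:
  assumes "vector_space s" "module.subspace s A" "lin_on A s s' f" "lin_on A s s' g"
    "\<And>a. a \<in> A \<Longrightarrow> f a \<in> B" "\<And>a. a \<in> A \<Longrightarrow> g a \<in> B" "t \<in> tensor_power s A 2"
    and u: "tens_hom B s' s'' u" and v: "tens_hom B s' s'' v"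
  shows "tensor_fun s' B s'' u v (tensor_fun s A s' (\<lambda>a. ptens s' [f a]) (\<lambda>a. ptens s' [g a]) t) =
    tensor_fun s A s'' (\<lambda>a. u (f a)) (\<lambda>a. v (g a)) t"
proof (rule square_eqI[OF assms(7)])
  note h = tens_hom_ptens1[OF assms(1,2,3)] tens_hom_ptens1[OF assms(1,2,4)]
  note h' = tens_hom_comp[OF assms(1,2,3,5) u] tens_hom_comp[OF assms(1,2,4,6) v]
  show "lin_on (tensor_power s A 2) tscale tscale
     (\<lambda>t. tensor_fun s' B s'' u v (tensor_fun s A s' (\<lambda>a. ptens s' [f a]) (\<lambda>a. ptens s' [g a]) t))"
    by (rule lin_on_comp[OF tensor_fun_lin[OF h] _ tensor_fun_lin[OF u v]])
      (rule tensor_fun_map_power[OF assms(1-6)])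
  show "lin_on (tensor_power s A 2) tscale tscale (tensor_fun s A s'' (\<lambda>a. u (f a)) (\<lambda>a. v (g a)))"
    by (rule tensor_fun_lin[OF h'])
  fix a b assume "a \<in> A" "b \<in> A"
  then show "tensor_fun s' B s'' u v (tensor_fun s A s' (\<lambda>a. ptens s' [f a]) (\<lambda>a. ptens s' [g a]) (ptens s [a, b])) =
    tensor_fun s A s'' (\<lambda>a. u (f a)) (\<lambda>a. v (g a)) (ptens s [a, b])"
    by (simp add: tensor_fun_ptens[OF h] tensor_fun_ptens[OF h'] tensor_fun_ptens[OF u v] tprod_ptens assms)
qed

section \<open>Koszul signs\<close>

lemma ksign_mult: "ksign m * ksign n = ksign (m + n)"
  by (auto simp: ksign_def)

lemma extendable_2:
  assumes "vector_space s" "module.subspace s A"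
    "\<And>b. b \<in> A \<Longrightarrow> lin_on A s tscale (\<lambda>a. B a b)" "\<And>a. a \<in> A \<Longrightarrow> lin_on A s tscale (\<lambda>b. B a b)"
  shows "extendable s (words A 2) (\<lambda>xs. B (xs ! 0) (xs ! 1))"
proof (rule extendable_words[OF assms(1,2)], unfold multilin_on_def, intro allI impI)
  fix xs ys assume *: "set xs \<subseteq> A" "set ys \<subseteq> A" "Suc (length xs + length ys) = 2"
  then consider b where "xs = []" "ys = [b]" | a where "xs = [a]" "ys = []"
    by (cases xs; cases ys) auto
  then show "lin_on A s tscale (\<lambda>a. B ((xs @ a # ys) ! 0) ((xs @ a # ys) ! 1))"
    by cases (use * assms(3,4) in auto)
qed

lemma extendable_3:
  assumes "vector_space s" "module.subspace s A"
    "\<And>b c. b \<in> A \<Longrightarrow> c \<in> A \<Longrightarrow> lin_on A s tscale (\<lambda>a. B a b c)"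
    "\<And>a c. a \<in> A \<Longrightarrow> c \<in> A \<Longrightarrow> lin_on A s tscale (\<lambda>b. B a b c)"
    "\<And>a b. a \<in> A \<Longrightarrow> b \<in> A \<Longrightarrow> lin_on A s tscale (\<lambda>c. B a b c)"
  shows "extendable s (words A 3) (\<lambda>xs. B (xs ! 0) (xs ! 1) (xs ! 2))"
proof (rule extendable_words[OF assms(1,2)], unfold multilin_on_def, intro allI impI)
  fix xs ys assume *: "set xs \<subseteq> A" "set ys \<subseteq> A" "Suc (length xs + length ys) = 3"
  then consider b c where "xs = []" "ys = [b, c]" | a c where "xs = [a]" "ys = [c]" | a b where "xs = [a, b]" "ys = []"
    by (cases xs; cases ys; cases "tl xs"; cases "tl ys") auto
  then show "lin_on A s tscale (\<lambda>a. B ((xs @ a # ys) ! 0) ((xs @ a # ys) ! 1) ((xs @ a # ys) ! 2))"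
    by cases (use * assms(3,4,5) in \<open>auto simp: numeral_2_eq_2\<close>)
qed

text \<open>
  The even part, the odd part and the sign operator \<open>a \<mapsto> (-1)\<^sup>|\<^sup>a\<^sup>| a\<close>. With them a signed permutation
  of pure tensors is bilinear: \<open>(-1)\<^sup>|\<^sup>a\<^sup>|\<^sup>|\<^sup>b\<^sup>| b \<otimes> a = b \<otimes> E a + \<sigma> b \<otimes> P a\<close>. In this form it extends to
  the whole type, which shows that it respects all linear relations.
\<close>

lemma parity_projections:
  assumes M: "graded_space M"
  shows "\<exists>E P \<sigma>. Vector_Spaces.linear (scl M) (scl M) E \<and> Vector_Spaces.linear (scl M) (scl M) P \<and>
    Vector_Spaces.linear (scl M) (scl M) \<sigma> \<and>
    (\<forall>i. \<forall>x\<in>gr M i. E x = (if even i then x else 0) \<and> P x = (if even i then 0 else x) \<and> \<sigma> x = scl M (ksign i) x)"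
proof -
  note vs = graded_space_vs[OF M]
  interpret vector_space "scl M" by fact
  have "\<exists>F. Vector_Spaces.linear (scl M) (scl M) F \<and> (\<forall>i. \<forall>x\<in>gr M i. F x = scl M (c i) x)" for c
    by (rule graded_extension[OF M vs]) (simp add: lin_on_def scale_right_distrib mult.commute)
  note ex = this
  obtain E where "Vector_Spaces.linear (scl M) (scl M) E" "\<forall>i. \<forall>x\<in>gr M i. E x = scl M (if even i then 1 else 0) x"
    using ex[of "\<lambda>i. if even i then 1 else 0"] by blast
  moreover obtain P where "Vector_Spaces.linear (scl M) (scl M) P" "\<forall>i. \<forall>x\<in>gr M i. P x = scl M (if even i then 0 else 1) x"
    using ex[of "\<lambda>i. if even i then 0 else 1"] by blast
  moreover obtain \<sigma> where "Vector_Spaces.linear (scl M) (scl M) \<sigma>" "\<forall>i. \<forall>x\<in>gr M i. \<sigma> x = scl M (ksign i) x"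
    using ex[of ksign] by blast
  ultimately show ?thesis by (intro exI[of _ E] exI[of _ P] exI[of _ \<sigma>] conjI) auto
qed

lemma ptens_tensor_power_3: "a \<in> A \<Longrightarrow> b \<in> A \<Longrightarrow> c \<in> A \<Longrightarrow> ptens s [a, b, c] \<in> tensor_power s A 3"
  unfolding tensor_power_def by (rule tens.span_base) (auto simp: words_3)

context
  fixes M :: "('k::field, 'a::ab_group_add, 'z) gspace_scheme"
  assumes M: "graded_space M"
begin

text \<open>
  The degree of \<open>0\<close> is arbitrary, but there the tensor vanishes.
\<close>

lemma deg_sign:
  assumes "a \<in> gr M i" "b \<in> gr M j" "a = 0 \<or> b = 0 \<Longrightarrow> t = 0"
  shows "tscale (ksign (deg M a * deg M b)) t = tscale (ksign (i * j)) t"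
  using assms deg_eq[OF M] by (cases "a = 0 \<or> b = 0") auto

lemma twist_extendable:
  "extendable (scl M) (words (homog M) 2)
     (\<lambda>xs. tscale (ksign (deg M (xs ! 0) * deg M (xs ! 1))) (ptens (scl M) [xs ! 1, xs ! 0]))"
proof -
  interpret vector_space "scl M" using M by (rule graded_space_vs)
  obtain E P \<sigma> where lin: "Vector_Spaces.linear (scl M) (scl M) E" "Vector_Spaces.linear (scl M) (scl M) P"
      "Vector_Spaces.linear (scl M) (scl M) \<sigma>"
    and v: "\<And>i x. x \<in> gr M i \<Longrightarrow> E x = (if even i then x else 0) \<and> P x = (if even i then 0 else x) \<and> \<sigma> x = scl M (ksign i) x"
    using parity_projections[OF M] by blast
  note lin' = lin[THEN linear_lin_on[where A = UNIV]]
  note ad = lin'[THEN lin_on_add, OF UNIV_I UNIV_I] lin'[THEN lin_on_scale, OF UNIV_I]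
  have "extendable (scl M) (words UNIV 2) (\<lambda>xs. ptens (scl M) [xs ! 1, E (xs ! 0)] + ptens (scl M) [\<sigma> (xs ! 1), P (xs ! 0)])"
    by (rule extendable_2[where B = "\<lambda>a b. ptens (scl M) [b, E a] + ptens (scl M) [\<sigma> b, P a]"])
      (auto simp: vector_space_axioms lin_on_def ad ptens_add2 tens.scale_right_distrib)
  then show ?thesis
  proof (rule extendable_subset)
    fix xs assume "xs \<in> words (homog M) 2"
    then obtain a b i j where xs: "xs = [a, b]" and ab: "a \<in> gr M i" "b \<in> gr M j"
      by (auto simp: words_2 homog_def)
    have "ptens (scl M) [b, E a] + ptens (scl M) [\<sigma> b, P a] = tscale (ksign (i * j)) (ptens (scl M) [b, a])"
      using v[OF ab(1)] v[OF ab(2)] by (auto simp: ptens_zero_entry ptens_add2 ksign_def)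
    also have "\<dots> = tscale (ksign (deg M a * deg M b)) (ptens (scl M) [b, a])"
      by (rule deg_sign[OF ab, symmetric]) (auto simp: ptens_zero_entry)
    finally show "ptens (scl M) [xs ! 1, E (xs ! 0)] + ptens (scl M) [\<sigma> (xs ! 1), P (xs ! 0)] =
      tscale (ksign (deg M (xs ! 0) * deg M (xs ! 1))) (ptens (scl M) [xs ! 1, xs ! 0])"
      by (simp only: xs nth_Cons_0 nth_Cons_Suc One_nat_def)
  qed (simp add: words_mono)
qed

lemma twist_ptens:
  assumes "a \<in> gr M i" "b \<in> gr M j"
  shows "twist M (ptens (scl M) [a, b]) = tscale (ksign (i * j)) (ptens (scl M) [b, a])"
proof -
  have "[a, b] \<in> words (homog M) 2" using assms by (auto simp: words_2 gr_homog)
  from tlift_ptens[OF twist_extendable this]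
  have "twist M (ptens (scl M) [a, b]) = tscale (ksign (deg M a * deg M b)) (ptens (scl M) [b, a])"
    by (simp only: twist_def nth_Cons_0 nth_Cons_Suc One_nat_def)
  also have "\<dots> = tscale (ksign (i * j)) (ptens (scl M) [b, a])"
    by (rule deg_sign[OF assms]) (auto simp: ptens_zero_entry)
  finally show ?thesis .
qed

lemma twist_lin: "lin_on (tensor_power (scl M) (carr M) 2) tscale tscale (twist M)"
  unfolding twist_def tensor_power_carr[OF M] unfolding tensor_power_def by (rule tlift_lin[OF twist_extendable])

lemma cycle_extendable:
  "extendable (scl M) (words (homog M) 3)
     (\<lambda>xs. tscale (ksign (deg M (xs ! 2) * (deg M (xs ! 0) + deg M (xs ! 1)))) (ptens (scl M) [xs ! 2, xs ! 0, xs ! 1]))"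
proof -
  interpret vector_space "scl M" using M by (rule graded_space_vs)
  obtain E P \<sigma> where lin: "Vector_Spaces.linear (scl M) (scl M) E" "Vector_Spaces.linear (scl M) (scl M) P"
      "Vector_Spaces.linear (scl M) (scl M) \<sigma>"
    and v: "\<And>i x. x \<in> gr M i \<Longrightarrow> E x = (if even i then x else 0) \<and> P x = (if even i then 0 else x) \<and> \<sigma> x = scl M (ksign i) x"
    using parity_projections[OF M] by blast
  note lin' = lin[THEN linear_lin_on[where A = UNIV]]
  note ad = lin'[THEN lin_on_add, OF UNIV_I UNIV_I] lin'[THEN lin_on_scale, OF UNIV_I]
  have "extendable (scl M) (words UNIV 3) (\<lambda>xs. ptens (scl M) [E (xs ! 2), xs ! 0, xs ! 1] + ptens (scl M) [P (xs ! 2), \<sigma> (xs ! 0), \<sigma> (xs ! 1)])"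
    by (rule extendable_3[where B = "\<lambda>a b c. ptens (scl M) [E c, a, b] + ptens (scl M) [P c, \<sigma> a, \<sigma> b]"])
      (auto simp: vector_space_axioms lin_on_def ad ptens_add3 tens.scale_right_distrib)
  then show ?thesis
  proof (rule extendable_subset)
    fix xs assume "xs \<in> words (homog M) 3"
    then obtain a b c i j k where xs: "xs = [a, b, c]" and ab: "a \<in> gr M i" "b \<in> gr M j" "c \<in> gr M k"
      by (auto simp: words_3 homog_def)
    have "ptens (scl M) [E c, a, b] + ptens (scl M) [P c, \<sigma> a, \<sigma> b] =
      tscale (ksign (k * (i + j))) (ptens (scl M) [c, a, b])"
      using v[OF ab(1)] v[OF ab(2)] v[OF ab(3)] by (auto simp: ptens_zero_entry ptens_add3 ksign_def)
    also have "\<dots> = tscale (ksign (deg M c * (deg M a + deg M b))) (ptens (scl M) [c, a, b])"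
      using ab deg_eq[OF M] by (cases "a = 0 \<or> b = 0 \<or> c = 0") (auto simp: ptens_zero_entry)
    finally show "ptens (scl M) [E (xs ! 2), xs ! 0, xs ! 1] + ptens (scl M) [P (xs ! 2), \<sigma> (xs ! 0), \<sigma> (xs ! 1)] =
      tscale (ksign (deg M (xs ! 2) * (deg M (xs ! 0) + deg M (xs ! 1)))) (ptens (scl M) [xs ! 2, xs ! 0, xs ! 1])"
      by (simp only: xs nth_Cons_0 nth_Cons_Suc One_nat_def numeral_2_eq_2)
  qed (simp add: words_mono)
qed

lemma cycle_ptens:
  assumes "a \<in> gr M i" "b \<in> gr M j" "c \<in> gr M k"
  shows "cycle M (ptens (scl M) [a, b, c]) = tscale (ksign (k * (i + j))) (ptens (scl M) [c, a, b])"
proof -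
  have "[a, b, c] \<in> words (homog M) 3" using assms by (auto simp: words_3 gr_homog)
  from tlift_ptens[OF cycle_extendable this]
  have "cycle M (ptens (scl M) [a, b, c]) = tscale (ksign (deg M c * (deg M a + deg M b))) (ptens (scl M) [c, a, b])"
    by (simp only: cycle_def nth_Cons_0 nth_Cons_Suc One_nat_def numeral_2_eq_2)
  also have "\<dots> = tscale (ksign (k * (i + j))) (ptens (scl M) [c, a, b])"
    using assms deg_eq[OF M] by (cases "a = 0 \<or> b = 0 \<or> c = 0") (auto simp: ptens_zero_entry)
  finally show ?thesis .
qed

lemma cycle_lin: "lin_on (tensor_power (scl M) (carr M) 3) tscale tscale (cycle M)"
  unfolding cycle_def tensor_power_carr[OF M] unfolding tensor_power_def by (rule tlift_lin[OF cycle_extendable])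

text \<open>
  The action of \<open>\<tau>\<^sub>(\<^sub>1\<^sub>2\<^sub>)\<close> on three factors. Together with \<open>cycle M\<close> it generates the action of the
  symmetric group in which the co-Jacobi identity is verified.
\<close>

definition twist12 where "twist12 = tlift (scl M) (words (homog M) 3)
     (\<lambda>xs. tscale (ksign (deg M (xs ! 0) * deg M (xs ! 1))) (ptens (scl M) [xs ! 1, xs ! 0, xs ! 2]))"

lemma twist12_extendable:
  "extendable (scl M) (words (homog M) 3)
     (\<lambda>xs. tscale (ksign (deg M (xs ! 0) * deg M (xs ! 1))) (ptens (scl M) [xs ! 1, xs ! 0, xs ! 2]))"
proof -
  interpret vector_space "scl M" using M by (rule graded_space_vs)
  obtain E P \<sigma> where lin: "Vector_Spaces.linear (scl M) (scl M) E" "Vector_Spaces.linear (scl M) (scl M) P"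
      "Vector_Spaces.linear (scl M) (scl M) \<sigma>"
    and v: "\<And>i x. x \<in> gr M i \<Longrightarrow> E x = (if even i then x else 0) \<and> P x = (if even i then 0 else x) \<and> \<sigma> x = scl M (ksign i) x"
    using parity_projections[OF M] by blast
  note lin' = lin[THEN linear_lin_on[where A = UNIV]]
  note ad = lin'[THEN lin_on_add, OF UNIV_I UNIV_I] lin'[THEN lin_on_scale, OF UNIV_I]
  have "extendable (scl M) (words UNIV 3) (\<lambda>xs. ptens (scl M) [xs ! 1, E (xs ! 0), xs ! 2] + ptens (scl M) [\<sigma> (xs ! 1), P (xs ! 0), xs ! 2])"
    by (rule extendable_3[where B = "\<lambda>a b c. ptens (scl M) [b, E a, c] + ptens (scl M) [\<sigma> b, P a, c]"])
      (auto simp: vector_space_axioms lin_on_def ad ptens_add3 tens.scale_right_distrib)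
  then show ?thesis
  proof (rule extendable_subset)
    fix xs assume "xs \<in> words (homog M) 3"
    then obtain a b c i j k where xs: "xs = [a, b, c]" and ab: "a \<in> gr M i" "b \<in> gr M j" "c \<in> gr M k"
      by (auto simp: words_3 homog_def)
    have "ptens (scl M) [b, E a, c] + ptens (scl M) [\<sigma> b, P a, c] = tscale (ksign (i * j)) (ptens (scl M) [b, a, c])"
      using v[OF ab(1)] v[OF ab(2)] by (auto simp: ptens_zero_entry ptens_add3 ksign_def)
    also have "\<dots> = tscale (ksign (deg M a * deg M b)) (ptens (scl M) [b, a, c])"
      by (rule deg_sign[OF ab(1,2), symmetric]) (auto simp: ptens_zero_entry)
    finally show "ptens (scl M) [xs ! 1, E (xs ! 0), xs ! 2] + ptens (scl M) [\<sigma> (xs ! 1), P (xs ! 0), xs ! 2] =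
      tscale (ksign (deg M (xs ! 0) * deg M (xs ! 1))) (ptens (scl M) [xs ! 1, xs ! 0, xs ! 2])"
      by (simp only: xs nth_Cons_0 nth_Cons_Suc One_nat_def numeral_2_eq_2)
  qed (simp add: words_mono)
qed

lemma twist12_ptens:
  assumes "a \<in> gr M i" "b \<in> gr M j" "c \<in> gr M k"
  shows "twist12 (ptens (scl M) [a, b, c]) = tscale (ksign (i * j)) (ptens (scl M) [b, a, c])"
proof -
  have "[a, b, c] \<in> words (homog M) 3" using assms by (auto simp: words_3 gr_homog)
  from tlift_ptens[OF twist12_extendable this]
  have "twist12 (ptens (scl M) [a, b, c]) = tscale (ksign (deg M a * deg M b)) (ptens (scl M) [b, a, c])"
    by (simp only: twist12_def nth_Cons_0 nth_Cons_Suc One_nat_def numeral_2_eq_2)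
  also have "\<dots> = tscale (ksign (i * j)) (ptens (scl M) [b, a, c])"
    by (rule deg_sign[OF assms(1,2)]) (auto simp: ptens_zero_entry)
  finally show ?thesis .
qed

lemma twist12_lin: "lin_on (tensor_power (scl M) (carr M) 3) tscale tscale twist12"
  unfolding twist12_def tensor_power_carr[OF M] unfolding tensor_power_def by (rule tlift_lin[OF twist12_extendable])

lemma cube_eqI:
  assumes "t \<in> tensor_power (scl M) (carr M) 3"
    "lin_on (tensor_power (scl M) (carr M) 3) tscale s' F" "lin_on (tensor_power (scl M) (carr M) 3) tscale s' G"
    "\<And>a b c i j k. a \<in> gr M i \<Longrightarrow> b \<in> gr M j \<Longrightarrow> c \<in> gr M k \<Longrightarrow>
      F (ptens (scl M) [a, b, c]) = G (ptens (scl M) [a, b, c])"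
  shows "F t = G t"
  using assms(1,2,3) unfolding tensor_power_carr[OF M]
  by (rule power_eqI) (auto simp: words_3 homog_def assms(4))

lemma cube_imageI:
  assumes "t \<in> tensor_power (scl M) (carr M) 3"
    "lin_on (tensor_power (scl M) (carr M) 3) tscale s' F" "vector_space s'" "module.subspace s' X"
    "\<And>a b c i j k. a \<in> gr M i \<Longrightarrow> b \<in> gr M j \<Longrightarrow> c \<in> gr M k \<Longrightarrow> F (ptens (scl M) [a, b, c]) \<in> X"
  shows "F t \<in> X"
  using assms(1,2,3,4) unfolding tensor_power_carr[OF M]
  by (rule power_imageI) (auto simp: words_3 homog_def assms(5))

lemmas ptens_carr_3 = ptens_tensor_power_3[OF gr_carr[OF M] gr_carr[OF M] gr_carr[OF M]]
lemmas ptens_carr_2 = ptens_tensor_power_2[OF gr_carr[OF M] gr_carr[OF M]]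
lemmas tensor_power_scale = tens.subspace_scale[OF tensor_power_subspace]

lemma twist_power: "t \<in> tensor_power (scl M) (carr M) 2 \<Longrightarrow> twist M t \<in> tensor_power (scl M) (carr M) 2"
  by (erule square_homog_imageI[OF M _ twist_lin tens_vector_space tensor_power_subspace])
    (auto simp: twist_ptens intro!: tensor_power_scale ptens_carr_2)

lemma twist_square_gr: "t \<in> square_gr M i \<Longrightarrow> twist M t \<in> square_gr M i"
  by (erule square_gr_imageI[OF M _ twist_lin tens_vector_space square_gr_subspace])
    (auto simp: twist_ptens intro!: tens.subspace_scale square_gr_subspace ptens_square_gr)

lemma twist_twist:
  assumes "t \<in> tensor_power (scl M) (carr M) 2" shows "twist M (twist M t) = t"
proof (rule square_homog_eqI[OF M assms lin_on_comp[OF twist_lin twist_power twist_lin] lin_on_id])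
  fix a b i j assume ab: "a \<in> gr M i" "b \<in> gr M j"
  show "twist M (twist M (ptens (scl M) [a, b])) = ptens (scl M) [a, b]"
    using ab by (simp add: twist_ptens[OF ab] lin_on_scale[OF twist_lin ptens_carr_2] twist_ptens[OF ab(2,1)] ksign_mult)
      (auto simp: ksign_def)
qed

lemma cycle_power: "t \<in> tensor_power (scl M) (carr M) 3 \<Longrightarrow> cycle M t \<in> tensor_power (scl M) (carr M) 3"
  by (erule cube_imageI[OF _ cycle_lin tens_vector_space tensor_power_subspace])
    (auto simp: cycle_ptens intro!: tensor_power_scale ptens_carr_3)

lemma twist12_power: "t \<in> tensor_power (scl M) (carr M) 3 \<Longrightarrow> twist12 t \<in> tensor_power (scl M) (carr M) 3"
  by (erule cube_imageI[OF _ twist12_lin tens_vector_space tensor_power_subspace])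
    (auto simp: twist12_ptens intro!: tensor_power_scale ptens_carr_3)

lemma cycle_cycle:
  assumes "a \<in> gr M i" "b \<in> gr M j" "c \<in> gr M k"
  shows "cycle M (cycle M (ptens (scl M) [a, b, c])) = tscale (ksign (i * (j + k))) (ptens (scl M) [b, c, a])"
  using assms
  by (simp add: cycle_ptens[OF assms] lin_on_scale[OF cycle_lin ptens_carr_3] cycle_ptens[OF assms(3,1,2)] ksign_mult)
    (auto simp: ksign_def)

lemma cycle_cubed:
  assumes "t \<in> tensor_power (scl M) (carr M) 3" shows "cycle M (cycle M (cycle M t)) = t"
proof (rule cube_eqI[OF assms _ lin_on_id])
  show "lin_on (tensor_power (scl M) (carr M) 3) tscale tscale (\<lambda>t. cycle M (cycle M (cycle M t)))"
    by (intro lin_on_comp[OF cycle_lin cycle_power] lin_on_comp[OF cycle_lin cycle_power cycle_lin]) auto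
  fix a b c i j k assume abc: "a \<in> gr M i" "b \<in> gr M j" "c \<in> gr M k"
  show "cycle M (cycle M (cycle M (ptens (scl M) [a, b, c]))) = ptens (scl M) [a, b, c]"
    using abc by (simp add: cycle_cycle[OF abc] lin_on_scale[OF cycle_lin ptens_carr_3] cycle_ptens[OF abc(2,3,1)] ksign_mult)
      (auto simp: ksign_def)
qed

text \<open>
  The relation \<open>\<tau> c\<^sup>2 = c \<tau>\<close> of the symmetric group on three letters.
\<close>

lemma twist12_cycle:
  assumes "t \<in> tensor_power (scl M) (carr M) 3" shows "twist12 (cycle M (cycle M t)) = cycle M (twist12 t)"
proof (rule cube_eqI[OF assms])
  show "lin_on (tensor_power (scl M) (carr M) 3) tscale tscale (\<lambda>t. twist12 (cycle M (cycle M t)))"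
    by (intro lin_on_comp[OF cycle_lin cycle_power] lin_on_comp[OF cycle_lin cycle_power twist12_lin]) auto
  show "lin_on (tensor_power (scl M) (carr M) 3) tscale tscale (\<lambda>t. cycle M (twist12 t))"
    by (intro lin_on_comp[OF twist12_lin twist12_power cycle_lin]) auto
  fix a b c i j k assume abc: "a \<in> gr M i" "b \<in> gr M j" "c \<in> gr M k"
  show "twist12 (cycle M (cycle M (ptens (scl M) [a, b, c]))) = cycle M (twist12 (ptens (scl M) [a, b, c]))"
    using abc by (simp add: cycle_cycle[OF abc] lin_on_scale[OF cycle_lin ptens_carr_3] lin_on_scale[OF twist12_lin ptens_carr_3]
        twist12_ptens[OF abc] twist12_ptens[OF abc(2,3,1)] cycle_ptens[OF abc(2,1,3)] ksign_mult)
      (auto simp: ksign_def)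
qed

end

section \<open>From coalgebras to Lie coalgebras\<close>

lemma scl_Liec [simp]: "scl (Liec D) = scl D" and gr_Liec [simp]: "gr (Liec D) = gr D"
  and cobr_Liec: "cobr (Liec D) x = comult D x - twist D (comult D x)"
  by (simp_all add: Liec_def)

lemma homog_Liec [simp]: "homog (Liec D) = homog D" by (simp add: homog_def)
lemma carr_Liec [simp]: "carr (Liec D) = carr D" by (simp add: carr_def)
lemma deg_Liec [simp]: "deg (Liec D) = deg D" by (simp add: deg_def fun_eq_iff)
lemma twist_Liec [simp]: "twist (Liec D) = twist D" by (simp add: twist_def)
lemma cycle_Liec [simp]: "cycle (Liec D) = cycle D" by (simp add: cycle_def)
lemma square_gr_Liec [simp]: "square_gr (Liec D) = square_gr D" by (simp add: square_gr_def fun_eq_iff)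
lemma graded_space_Liec [simp]: "graded_space (Liec D) \<longleftrightarrow> graded_space D" by (simp add: graded_space_def)

lemma carr_imageI:
  assumes "graded_space M" "lin_on (carr M) (scl M) s' F" "vector_space s'" "module.subspace s' X"
    "\<And>i x. x \<in> gr M i \<Longrightarrow> F x \<in> X" "x \<in> carr M"
  shows "F x \<in> X"
  by (rule lin_on_image_span[OF graded_space_vs[OF assms(1)] assms(2)[unfolded carr_def] assms(3,4) _ assms(6)[unfolded carr_def]])
    (auto simp: homog_def assms(5))

lemma carr_eqI:
  assumes "graded_space M" "lin_on (carr M) (scl M) s' F" "lin_on (carr M) (scl M) s' G"
    "\<And>i x. x \<in> gr M i \<Longrightarrow> F x = G x" "x \<in> carr M"
  shows "F x = G x"
  by (rule lin_on_eq_span[OF graded_space_vs[OF assms(1)] assms(2,3)[unfolded carr_def] _ assms(5)[unfolded carr_def]])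
    (auto simp: homog_def assms(4))

lemma tens_hom_carr:
  "graded_space M \<Longrightarrow> lin_on (carr M) (scl M) tscale f \<Longrightarrow> (\<And>a. a \<in> carr M \<Longrightarrow> f a \<in> tensor_algebra s') \<Longrightarrow>
    tens_hom (carr M) (scl M) s' f"
  by (simp add: tens_hom_def graded_space_vs carr_subspace)

lemma tens_hom_carr_ptens1:
  "graded_space M \<Longrightarrow> lin_on (carr M) (scl M) s' f \<Longrightarrow> tens_hom (carr M) (scl M) s' (\<lambda>a. ptens s' [f a])"
  by (intro tens_hom_ptens1 graded_space_vs carr_subspace)

lemma tens_hom_carr_id: "graded_space M \<Longrightarrow> tens_hom (carr M) (scl M) (scl M) (\<lambda>a. ptens (scl M) [a])"
  by (erule tens_hom_carr_ptens1[OF _ lin_on_id])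

lemma ptens1_power: "a \<in> A \<Longrightarrow> ptens s [a] \<in> tensor_power s A 1"
  unfolding tensor_power_def by (rule tens.span_base) (auto simp: words_def)

lemma tprod_power_3:
  assumes "z \<in> tensor_power s A 2" "b \<in> A"
  shows "tprod s z (ptens s [b]) \<in> tensor_power s A 3" "tprod s (ptens s [b]) z \<in> tensor_power s A 3"
  using tprod_tensor_power[OF assms(1) ptens1_power[OF assms(2)]] tprod_tensor_power[OF ptens1_power[OF assms(2)] assms(1)]
  by (simp_all add: numeral_3_eq_3)

text \<open>
  The common part of a coalgebra and a Lie coalgebra: a linear degree \<open>0\<close> map into the tensor
  square.
\<close>

definition gr_cop where
  "gr_cop M c \<longleftrightarrow> graded_space M \<and> lin_on (carr M) (scl M) tscale c \<and> (\<forall>i. c ` gr M i \<subseteq> square_gr M i)"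

lemma gr_copD:
  assumes "gr_cop M c"
  shows "graded_space M" "lin_on (carr M) (scl M) tscale c" "\<And>i x. x \<in> gr M i \<Longrightarrow> c x \<in> square_gr M i"
  using assms by (auto simp: gr_cop_def)

lemma gr_cop_power: assumes "gr_cop M c" "x \<in> carr M" shows "c x \<in> tensor_power (scl M) (carr M) 2"
  by (rule carr_imageI[OF gr_copD(1,2)[OF assms(1)] tens_vector_space tensor_power_subspace _ assms(2)])
    (rule square_gr_tensor_power[OF gr_copD(1)[OF assms(1)] gr_copD(3)[OF assms(1)]])

lemma gr_cop_hom: assumes "gr_cop M c" shows "tens_hom (carr M) (scl M) (scl M) c"
  by (rule tens_hom_carr[OF gr_copD(1,2)[OF assms]]) (rule tensor_power_T[OF gr_cop_power[OF assms]])

lemma gr_cop_left_power: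
  assumes "gr_cop M c" "t \<in> tensor_power (scl M) (carr M) 2"
  shows "tensor_fun (scl M) (carr M) (scl M) c (\<lambda>a. ptens (scl M) [a]) t \<in> tensor_power (scl M) (carr M) 3"
proof -
  note M = gr_copD(1)[OF assms(1)]
  note h = gr_cop_hom[OF assms(1)] tens_hom_carr_id[OF M]
  show ?thesis
  proof (rule square_imageI[OF assms(2) tensor_fun_lin[OF h] tens_vector_space tensor_power_subspace])
    fix a b assume "a \<in> carr M" "b \<in> carr M"
    then show "tensor_fun (scl M) (carr M) (scl M) c (\<lambda>a. ptens (scl M) [a]) (ptens (scl M) [a, b]) \<in> tensor_power (scl M) (carr M) 3"
      using tprod_power_3(1)[OF gr_cop_power[OF assms(1)]] by (simp add: tensor_fun_ptens[OF h])
  qed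
qed

lemma gr_cop_right_power:
  assumes "gr_cop M c" "t \<in> tensor_power (scl M) (carr M) 2"
  shows "tensor_fun (scl M) (carr M) (scl M) (\<lambda>a. ptens (scl M) [a]) c t \<in> tensor_power (scl M) (carr M) 3"
proof -
  note M = gr_copD(1)[OF assms(1)]
  note h = tens_hom_carr_id[OF M] gr_cop_hom[OF assms(1)]
  show ?thesis
  proof (rule square_imageI[OF assms(2) tensor_fun_lin[OF h] tens_vector_space tensor_power_subspace])
    fix a b assume "a \<in> carr M" "b \<in> carr M"
    then show "tensor_fun (scl M) (carr M) (scl M) (\<lambda>a. ptens (scl M) [a]) c (ptens (scl M) [a, b]) \<in> tensor_power (scl M) (carr M) 3"
      using tprod_power_3(2)[OF gr_cop_power[OF assms(1)]] by (simp add: tensor_fun_ptens[OF h])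
  qed
qed

lemma graded_coalgebra_cop: "graded_coalgebra D \<Longrightarrow> gr_cop D (comult D)"
  unfolding graded_coalgebra_def Let_def gr_cop_def linear_on_iff by blast

lemma lie_coalgebra_cop: "lie_coalgebra L \<Longrightarrow> gr_cop L (cobr L)"
  unfolding lie_coalgebra_def gr_cop_def linear_on_iff by blast

lemma gr_cop_Liec: assumes "gr_cop D (comult D)" shows "gr_cop (Liec D) (cobr (Liec D))"
proof -
  note D = gr_copD[OF assms]
  have "lin_on (carr D) (scl D) tscale (\<lambda>x. comult D x - twist D (comult D x))"
    by (rule lin_on_minus[OF tens_vector_space D(2) lin_on_comp[OF D(2) gr_cop_power[OF assms] twist_lin[OF D(1)]]])
  moreover have "comult D x - twist D (comult D x) \<in> square_gr D i" if "x \<in> gr D i" for i x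
    using D(3)[OF that] twist_square_gr[OF D(1)] square_gr_subspace by (intro tens.subspace_diff) auto
  ultimately show ?thesis using D(1) by (auto simp: gr_cop_def Liec_def carr_def homog_def square_gr_def graded_space_def)
qed

text \<open>
  Let \<open>X\<close> be the twofold coproduct of \<open>x\<close> in \<open>D \<otimes> D \<otimes> D\<close>, \<open>\<tau>\<close> the swap of the first two factors and \<open>c\<close> the
  cyclic permutation. By coassociativity, \<open>(]-[ \<otimes> id) ]x[ = X - \<tau>X - c\<^sup>2X + \<tau>c\<^sup>2X\<close>, where \<open>\<tau>c\<^sup>2 = c\<tau>\<close>.
  Applying \<open>1 + c + c\<^sup>2\<close> kills \<open>X - c\<^sup>2X\<close> as well as \<open>c\<tau>X - \<tau>X\<close>, because \<open>c\<^sup>3 = 1\<close>.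
\<close>

lemma lie_coalgebra_Liec:
  assumes "graded_coalgebra D"
  shows "lie_coalgebra (Liec D)"
proof -
  define s where "s = scl D"
  define \<iota> where "\<iota> = (\<lambda>a. ptens s [a])"
  define c where "c = cobr (Liec D)"
  define \<Delta> where "\<Delta> = comult D"
  define tf where "tf = tensor_fun s (carr D) s"
  note cop = graded_coalgebra_cop[OF assms]
  note D = gr_copD[OF cop]
  note P2 = gr_cop_power[OF cop]
  have c: "c x = \<Delta> x - twist D (\<Delta> x)" for x by (simp add: c_def cobr_Liec \<Delta>_def)
  note ccop = gr_cop_Liec[OF cop]
  have h\<Delta>: "tens_hom (carr D) s s \<Delta>" using gr_cop_hom[OF cop] by (simp add: s_def \<Delta>_def)
  have hc: "tens_hom (carr D) s s c" using gr_cop_hom[OF ccop] by (simp add: s_def c_def)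
  have h\<iota>: "tens_hom (carr D) s s \<iota>" unfolding s_def \<iota>_def by (rule tens_hom_carr_id[OF D(1)])
  let ?P2 = "tensor_power s (carr D) 2" and ?P3 = "tensor_power s (carr D) 3"
  have left3: "tf \<Delta> \<iota> y \<in> ?P3" and right3: "tf \<iota> \<Delta> y \<in> ?P3" if "y \<in> ?P2" for y
    using gr_cop_left_power[OF cop] gr_cop_right_power[OF cop] that by (simp_all add: tf_def s_def \<iota>_def \<Delta>_def)
  have pre3: "tprod s z (\<iota> b) \<in> ?P3" "tprod s (\<iota> b) z \<in> ?P3" if "z \<in> ?P2" "b \<in> carr D" for z b
    using tprod_power_3[OF that] by (simp_all add: \<iota>_def)
  note C = cycle_lin[OF D(1), folded s_def] and G = twist12_lin[OF D(1), folded s_def]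
    and T = twist_lin[OF D(1), folded s_def]
  note C3 = cycle_power[OF D(1), folded s_def] and G3 = twist12_power[OF D(1), folded s_def]
    and T2 = twist_power[OF D(1), folded s_def]
  let ?C = "cycle D" and ?G = "twist12 D"
  have CC: "lin_on ?P3 tscale tscale (\<lambda>t. ?C (?C t))" by (rule lin_on_comp[OF C C3 C])
  have gr2: "square_gr D i \<subseteq> ?P2" for i using square_gr_tensor_power[OF D(1), folded s_def] by blast
  have lin_il: "lin_on ?P2 tscale tscale (\<lambda>z. tprod s z (\<iota> b))" for b by (rule tprod_lin_left)
  have lin_ir: "lin_on ?P2 tscale tscale (\<lambda>z. tprod s (\<iota> b) z)" for b
    by (rule lin_on_subset[OF tprod_lin_right]) (auto simp: \<iota>_def tensor_power_T)
  note ptens_s = twist_ptens[OF D(1), folded s_def] twist12_ptens[OF D(1), folded s_def] cycle_cycle[OF D(1), folded s_def]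

  have twist_left: "tprod s (twist D z) (\<iota> b) = ?G (tprod s z (\<iota> b))" if z: "z \<in> ?P2" and b: "b \<in> gr D j" for z b j
  proof (rule square_homog_eqI[OF D(1), folded s_def, OF z])
    show "lin_on ?P2 tscale tscale (\<lambda>z. tprod s (twist D z) (\<iota> b))" by (rule lin_on_comp[OF T T2 lin_il])
    show "lin_on ?P2 tscale tscale (\<lambda>z. ?G (tprod s z (\<iota> b)))"
      by (rule lin_on_comp[OF lin_il pre3(1) G]) (use gr_carr[OF D(1) b] in auto)
    fix x y i k assume "x \<in> gr D i" "y \<in> gr D k"
    then show "tprod s (twist D (ptens s [x, y])) (\<iota> b) = ?G (tprod s (ptens s [x, y]) (\<iota> b))"
      using b by (simp add: ptens_s \<iota>_def tprod_scale_left tprod_ptens)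
  qed
  have move: "tscale (ksign (i * j)) (tprod s z (\<iota> a)) = ?C (?C (tprod s (\<iota> a) z))"
    if a: "a \<in> gr D i" and z: "z \<in> square_gr D j" for a i z j
  proof (rule square_gr_eqI[OF D(1) z, folded s_def])
    show "lin_on ?P2 tscale tscale (\<lambda>z. tscale (ksign (i * j)) (tprod s z (\<iota> a)))"
      by (rule lin_on_scaled[OF tens_vector_space lin_il])
    show "lin_on ?P2 tscale tscale (\<lambda>z. ?C (?C (tprod s (\<iota> a) z)))"
      by (rule lin_on_comp[OF lin_ir pre3(2) CC]) (use gr_carr[OF D(1) a] in auto)
    fix x y k l assume xy: "x \<in> gr D k" "y \<in> gr D l" "k + l = j"
    then show "tscale (ksign (i * j)) (tprod s (ptens s [x, y]) (\<iota> a)) = ?C (?C (tprod s (\<iota> a) (ptens s [x, y])))"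
      using a by (simp add: ptens_s \<iota>_def tprod_ptens)
  qed
  \<comment> \<open>\<open>(]-[ \<otimes> id) = (1 - \<tau>)(\<Delta> \<otimes> id)\<close>, and moving \<open>\<Delta>\<close> past the twist costs \<open>c\<^sup>2\<close>\<close>
  have claim1: "tf c \<iota> y = tf \<Delta> \<iota> y - ?G (tf \<Delta> \<iota> y)" if y: "y \<in> ?P2" for y
  proof (rule square_homog_eqI[OF D(1), folded s_def, OF y])
    show "lin_on ?P2 tscale tscale (tf c \<iota>)" unfolding tf_def by (rule tensor_fun_lin[OF hc h\<iota>])
    have 1: "lin_on ?P2 tscale tscale (tf \<Delta> \<iota>)" unfolding tf_def by (rule tensor_fun_lin[OF h\<Delta> h\<iota>])
    show "lin_on ?P2 tscale tscale (\<lambda>y. tf \<Delta> \<iota> y - ?G (tf \<Delta> \<iota> y))"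
      by (rule lin_on_minus[OF tens_vector_space 1 lin_on_comp[OF 1 left3 G]])
    fix a b i j assume ab: "a \<in> gr D i" "b \<in> gr D j"
    note abc = ab[THEN gr_carr[OF D(1)]]
    have "tprod s (\<Delta> a - twist D (\<Delta> a)) (\<iota> b) = tprod s (\<Delta> a) (\<iota> b) - tprod s (twist D (\<Delta> a)) (\<iota> b)"
      by (rule lin_on_diff[OF tens_vector_space tens.subspace_UNIV tprod_lin_left UNIV_I UNIV_I])
    then show "tf c \<iota> (ptens s [a, b]) = tf \<Delta> \<iota> (ptens s [a, b]) - ?G (tf \<Delta> \<iota> (ptens s [a, b]))"
      using twist_left[OF P2[OF abc(1), folded s_def \<Delta>_def] ab(2)]
      by (simp add: tf_def tensor_fun_ptens[OF hc h\<iota> abc] tensor_fun_ptens[OF h\<Delta> h\<iota> abc] c)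
  qed
  have claim2: "tf \<Delta> \<iota> (twist D y) = ?C (?C (tf \<iota> \<Delta> y))" if y: "y \<in> ?P2" for y
  proof (rule square_homog_eqI[OF D(1), folded s_def, OF y])
    have 1: "lin_on ?P2 tscale tscale (tf \<Delta> \<iota>)" unfolding tf_def by (rule tensor_fun_lin[OF h\<Delta> h\<iota>])
    have 2: "lin_on ?P2 tscale tscale (tf \<iota> \<Delta>)" unfolding tf_def by (rule tensor_fun_lin[OF h\<iota> h\<Delta>])
    show "lin_on ?P2 tscale tscale (\<lambda>y. tf \<Delta> \<iota> (twist D y))" by (rule lin_on_comp[OF T T2 1])
    show "lin_on ?P2 tscale tscale (\<lambda>y. ?C (?C (tf \<iota> \<Delta> y)))" by (rule lin_on_comp[OF 2 right3 CC])
    fix a b i j assume ab: "a \<in> gr D i" "b \<in> gr D j"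
    note abc = ab[THEN gr_carr[OF D(1)]]
    have "ptens s [b, a] \<in> ?P2" using abc by (simp add: ptens_tensor_power_2)
    then show "tf \<Delta> \<iota> (twist D (ptens s [a, b])) = ?C (?C (tf \<iota> \<Delta> (ptens s [a, b])))"
      using move[OF ab(1) D(3)[OF ab(2), folded \<Delta>_def]] lin_on_scale[OF 1]
      by (simp add: ptens_s(1)[OF ab] tensor_fun_ptens[OF h\<Delta> h\<iota> abc(2,1)] tensor_fun_ptens[OF h\<iota> h\<Delta> abc] tf_def)
  qed
  have jacobi: "tf c \<iota> (c x) + ?C (tf c \<iota> (c x)) + ?C (?C (tf c \<iota> (c x))) = 0" if x: "x \<in> carr D" for x
  proof -
    define X where "X = tf \<Delta> \<iota> (\<Delta> x)"
    have \<Delta>x: "\<Delta> x \<in> ?P2" using P2[OF x] by (simp add: s_def \<Delta>_def)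
    then have X3: "X \<in> ?P3" by (simp add: X_def left3)
    have X': "X = tf \<iota> \<Delta> (\<Delta> x)"
      using assms x unfolding graded_coalgebra_def Let_def X_def tf_def \<iota>_def \<Delta>_def s_def by blast
    have sub: "tens.subspace ?P3" by (rule tensor_power_subspace)
    have "tf c \<iota> (c x) = tf c \<iota> (\<Delta> x) - tf c \<iota> (twist D (\<Delta> x))"
      unfolding c[of x] tf_def
      by (rule lin_on_diff[OF tens_vector_space tensor_power_subspace tensor_fun_lin[OF hc h\<iota>] \<Delta>x T2[OF \<Delta>x]])
    also have "\<dots> = X - ?G X - (?C (?C X) - ?G (?C (?C X)))"
      by (simp only: claim1[OF \<Delta>x] claim1[OF T2[OF \<Delta>x]] claim2[OF \<Delta>x] X_def[symmetric] X'[symmetric])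
    finally have t: "tf c \<iota> (c x) = X - ?G X - (?C (?C X) - ?C (?G X))"
      by (simp only: twist12_cycle[OF D(1) X3[unfolded s_def]])
    note m = X3 G3[OF X3] C3[OF X3] C3[OF C3[OF X3]] C3[OF G3[OF X3]] C3[OF C3[OF G3[OF X3]]]
    note Cd = lin_on_diff[OF tens_vector_space sub C]
    have C1: "?C (X - ?G X - (?C (?C X) - ?C (?G X))) = ?C X - ?C (?G X) - (X - ?C (?C (?G X)))"
      using m by (simp add: Cd tens.subspace_diff[OF sub] cycle_cubed[OF D(1), folded s_def])
    have C2: "?C (?C X - ?C (?G X) - (X - ?C (?C (?G X)))) = ?C (?C X) - ?C (?C (?G X)) - (?C X - ?G X)"
      using m by (simp add: Cd tens.subspace_diff[OF sub] cycle_cubed[OF D(1), folded s_def])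
    show ?thesis unfolding t C1 C2 by simp
  qed
  have anti: "twist D (c x) = - c x" if x: "x \<in> carr D" for x
  proof -
    have \<Delta>x: "\<Delta> x \<in> ?P2" using P2[OF x] by (simp add: s_def \<Delta>_def)
    show ?thesis unfolding c
      by (subst lin_on_diff[OF tens_vector_space tensor_power_subspace T \<Delta>x T2[OF \<Delta>x]])
        (simp add: twist_twist[OF D(1), folded s_def, OF \<Delta>x])
  qed
  show ?thesis
    unfolding lie_coalgebra_def linear_on_iff Let_def
    using gr_copD[OF ccop] jacobi anti by (auto simp: c_def tf_def \<iota>_def s_def)
qed

section \<open>Morphisms\<close>

text \<open>
  \<open>f \<otimes> f\<close> on the tensor square of \<open>A\<close>.
\<close>

abbreviation sq_map where
  "sq_map s A s' f \<equiv> tensor_fun s A s' (\<lambda>a. ptens s' [f a]) (\<lambda>a. ptens s' [f a])"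

lemma tensor_map_extendable:
  assumes "Vector_Spaces.linear s s' \<phi>"
  shows "extendable s UNIV (\<lambda>xs. ptens s' (map \<phi> xs))"
proof (rule extendable_UNIV)
  fix \<mu> show "multilinear s (\<lambda>xs. ptens s' (map \<phi> xs) \<mu>)"
    using multilinear_map[OF _ assms] multilinear_zero by (cases "multilinear s' \<mu>") (simp_all add: ptens_def)
qed

lemma tensor_map_ptens: "Vector_Spaces.linear s s' \<phi> \<Longrightarrow> tensor_map s s' \<phi> (ptens s xs) = ptens s' (map \<phi> xs)"
  unfolding tensor_map_def by (rule tlift_ptens[OF tensor_map_extendable]) simp_all

lemma tensor_map_lin: "Vector_Spaces.linear s s' \<phi> \<Longrightarrow> lin_on (tensor_algebra s) tscale tscale (tensor_map s s' \<phi>)"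
  unfolding tensor_map_def tensor_algebra_def by (rule tlift_lin[OF tensor_map_extendable])

lemma T_eqI:
  assumes "t \<in> tensor_algebra s" "lin_on (tensor_algebra s) tscale s' F" "lin_on (tensor_algebra s) tscale s' G"
    "\<And>xs. F (ptens s xs) = G (ptens s xs)"
  shows "F t = G t"
  by (rule lin_on_eq_span[OF tens_vector_space assms(2,3)[unfolded tensor_algebra_def] _ assms(1)[unfolded tensor_algebra_def]])
    (auto simp: assms(4))

lemma T_imageI:
  assumes "t \<in> tensor_algebra s" "lin_on (tensor_algebra s) tscale s' F" "vector_space s'" "module.subspace s' X"
    "\<And>xs. F (ptens s xs) \<in> X"
  shows "F t \<in> X"
  by (rule lin_on_image_span[OF tens_vector_space assms(2)[unfolded tensor_algebra_def] assms(3,4) _ assms(1)[unfolded tensor_algebra_def]])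
    (auto simp: assms(5))

lemma tensor_map_T: "Vector_Spaces.linear s s' \<phi> \<Longrightarrow> t \<in> tensor_algebra s \<Longrightarrow> tensor_map s s' \<phi> t \<in> tensor_algebra s'"
  by (erule T_imageI[OF _ tensor_map_lin tens_vector_space T_subspace]) (simp_all add: tensor_map_ptens)

lemma tensor_map_tprod:
  assumes \<phi>: "Vector_Spaces.linear s s' \<phi>" and t: "t \<in> tensor_algebra s" and u: "u \<in> tensor_algebra s"
  shows "tensor_map s s' \<phi> (tprod s t u) = tprod s' (tensor_map s s' \<phi> t) (tensor_map s s' \<phi> u)"
proof (rule T_eqI[OF t])
  show "lin_on (tensor_algebra s) tscale tscale (\<lambda>t. tensor_map s s' \<phi> (tprod s t u))"
    by (rule lin_on_comp[OF tprod_lin_left tprod_T[OF _ u] tensor_map_lin[OF \<phi>]])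
  show "lin_on (tensor_algebra s) tscale tscale (\<lambda>t. tprod s' (tensor_map s s' \<phi> t) (tensor_map s s' \<phi> u))"
    by (rule lin_on_comp[OF tensor_map_lin[OF \<phi>] UNIV_I tprod_lin_left])
  fix xs
  show "tensor_map s s' \<phi> (tprod s (ptens s xs) u) = tprod s' (tensor_map s s' \<phi> (ptens s xs)) (tensor_map s s' \<phi> u)"
  proof (rule T_eqI[OF u])
    show "lin_on (tensor_algebra s) tscale tscale (\<lambda>u. tensor_map s s' \<phi> (tprod s (ptens s xs) u))"
      by (rule lin_on_comp[OF tprod_lin_right tprod_T tensor_map_lin[OF \<phi>]]) auto
    show "lin_on (tensor_algebra s) tscale tscale (\<lambda>u. tprod s' (tensor_map s s' \<phi> (ptens s xs)) (tensor_map s s' \<phi> u))"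
      by (rule lin_on_comp[OF tensor_map_lin[OF \<phi>] tensor_map_T[OF \<phi>] tprod_lin_right]) (auto intro: tensor_map_T[OF \<phi>])
  qed (simp add: tprod_ptens tensor_map_ptens[OF \<phi>])
qed

lemma sq_map_ptens:
  assumes "vector_space s" "module.subspace s A" "lin_on A s s' f" "a \<in> A" "b \<in> A"
  shows "sq_map s A s' f (ptens s [a, b]) = ptens s' [f a, f b]"
  using tensor_fun_ptens[OF tens_hom_ptens1[OF assms(1-3)] tens_hom_ptens1[OF assms(1-3)] assms(4,5)]
  by (simp add: tprod_ptens)

lemma sq_map_lin:
  assumes "vector_space s" "module.subspace s A" "lin_on A s s' f"
  shows "lin_on (tensor_power s A 2) tscale tscale (sq_map s A s' f)"
  using tensor_fun_lin[OF tens_hom_ptens1[OF assms(1-3)] tens_hom_ptens1[OF assms(1-3)]] .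

lemma sq_map_tensor_map:
  assumes "vector_space s" "module.subspace s A" "Vector_Spaces.linear s s' f" "t \<in> tensor_power s A 2"
  shows "sq_map s A s' f t = tensor_map s s' f t"
proof (rule square_eqI[OF assms(4) sq_map_lin[OF assms(1,2) linear_lin_on[OF assms(3)]]])
  show "lin_on (tensor_power s A 2) tscale tscale (tensor_map s s' f)"
    by (rule lin_on_subset[OF tensor_map_lin[OF assms(3)]]) (auto simp: tensor_power_T)
  show "sq_map s A s' f (ptens s [a, b]) = tensor_map s s' f (ptens s [a, b])" if "a \<in> A" "b \<in> A" for a b
    using that by (simp add: sq_map_ptens[OF assms(1,2) linear_lin_on[OF assms(3)]] tensor_map_ptens[OF assms(3)])
qed

lemma graded_mapD:
  assumes "graded_map M N f"
  shows "lin_on (carr M) (scl M) (scl N) f" "\<And>i x. x \<in> gr M i \<Longrightarrow> f x \<in> gr N i"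
  using assms by (auto simp: graded_map_def linear_on_iff)

lemma graded_map_carr:
  assumes "graded_map M N f" "graded_space M" "graded_space N" "x \<in> carr M"
  shows "f x \<in> carr N"
  by (rule carr_imageI[OF assms(2) graded_mapD(1)[OF assms(1)] graded_space_vs carr_subspace _ assms(4)])
    (use assms(3) gr_carr[OF assms(3) graded_mapD(2)[OF assms(1)]] in auto)

lemma graded_map_comp:
  assumes "graded_map M N f" "graded_map N P g" "graded_space M" "graded_space N"
  shows "graded_map M P (\<lambda>x. g (f x))"
  using lin_on_comp[OF graded_mapD(1)[OF assms(1)] graded_map_carr[OF assms(1,3,4)] graded_mapD(1)[OF assms(2)]]
    graded_mapD(2)[OF assms(1)] graded_mapD(2)[OF assms(2)]
  by (auto simp: graded_map_def linear_on_iff)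

lemma sq_map_square_gr:
  assumes "graded_map M N f" "graded_space M" "t \<in> square_gr M i"
  shows "sq_map (scl M) (carr M) (scl N) f t \<in> square_gr N i"
proof (rule square_gr_imageI[OF assms(2,3) sq_map_lin[OF graded_space_vs carr_subspace] tens_vector_space square_gr_subspace])
  note f = graded_mapD[OF assms(1)]
  show "lin_on (carr M) (scl M) (scl N) f" by (rule f)
  fix a b i' j assume ab: "a \<in> gr M i'" "b \<in> gr M j" "i' + j = i"
  show "sq_map (scl M) (carr M) (scl N) f (ptens (scl M) [a, b]) \<in> square_gr N i"
    using ptens_square_gr[OF f(2)[OF ab(1)] f(2)[OF ab(2)] ab(3)] gr_carr[OF assms(2)] ab
    by (simp add: sq_map_ptens[OF graded_space_vs[OF assms(2)] carr_subspace[OF assms(2)] f(1)])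
qed fact+

lemma sq_map_power:
  assumes "vector_space s" "module.subspace s A" "lin_on A s s' f" "\<And>a. a \<in> A \<Longrightarrow> f a \<in> B" "t \<in> tensor_power s A 2"
  shows "sq_map s A s' f t \<in> tensor_power s' B 2"
  by (rule tensor_fun_map_power[OF assms(1,2,3,3,4,4,5)])

text \<open>
  Degree preserving maps do not change Koszul signs.
\<close>

lemma sq_map_twist:
  assumes "graded_map M N f" "graded_space M" "graded_space N" "t \<in> tensor_power (scl M) (carr M) 2"
  shows "sq_map (scl M) (carr M) (scl N) f (twist M t) = twist N (sq_map (scl M) (carr M) (scl N) f t)"
proof (rule square_homog_eqI[OF assms(2,4)])
  note f = graded_mapD[OF assms(1)]
  note vs = graded_space_vs[OF assms(2)] carr_subspace[OF assms(2)]
  note q = sq_map_lin[OF vs f(1)]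
  have q2: "sq_map (scl M) (carr M) (scl N) f t \<in> tensor_power (scl N) (carr N) 2" if "t \<in> tensor_power (scl M) (carr M) 2" for t
    using sq_map_power[OF vs f(1) graded_map_carr[OF assms(1,2,3)] that] by blast
  show "lin_on (tensor_power (scl M) (carr M) 2) tscale tscale (\<lambda>t. sq_map (scl M) (carr M) (scl N) f (twist M t))"
    by (rule lin_on_comp[OF twist_lin[OF assms(2)] twist_power[OF assms(2)] q])
  show "lin_on (tensor_power (scl M) (carr M) 2) tscale tscale (\<lambda>t. twist N (sq_map (scl M) (carr M) (scl N) f t))"
    by (rule lin_on_comp[OF q q2 twist_lin[OF assms(3)]])
  fix a b i j assume ab: "a \<in> gr M i" "b \<in> gr M j"
  note abc = ab[THEN gr_carr[OF assms(2)]]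
  show "sq_map (scl M) (carr M) (scl N) f (twist M (ptens (scl M) [a, b])) = twist N (sq_map (scl M) (carr M) (scl N) f (ptens (scl M) [a, b]))"
    using ab abc by (simp add: twist_ptens[OF assms(2) ab] twist_ptens[OF assms(3) f(2)[OF ab(1)] f(2)[OF ab(2)]]
        lin_on_scale[OF q] ptens_tensor_power_2 sq_map_ptens[OF vs f(1)])
qed

lemma lie_morphismD:
  assumes "lie_morphism L M f"
  shows "graded_map L M f" "\<And>x. x \<in> carr L \<Longrightarrow> sq_map (scl L) (carr L) (scl M) f (cobr L x) = cobr M (f x)"
  using assms by (auto simp: lie_morphism_def)

lemma coalg_morphismD:
  assumes "coalg_morphism D E f"
  shows "graded_map D E f" "\<And>x. x \<in> carr D \<Longrightarrow> sq_map (scl D) (carr D) (scl E) f (comult D x) = comult E (f x)"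
    "\<And>x. x \<in> carr D \<Longrightarrow> counit E (f x) = counit D x"
  using assms by (auto simp: coalg_morphism_def)

lemma sq_map_comp:
  assumes f: "graded_map M N f" and M: "graded_space M" and N: "graded_space N"
    and g: "lin_on (carr N) (scl N) s'' g" and t: "t \<in> tensor_power (scl M) (carr M) 2"
  shows "sq_map (scl M) (carr M) s'' (\<lambda>x. g (f x)) t = sq_map (scl N) (carr N) s'' g (sq_map (scl M) (carr M) (scl N) f t)"
  using tensor_fun_comp[OF graded_space_vs[OF M] carr_subspace[OF M] graded_mapD(1)[OF f] graded_mapD(1)[OF f]
      graded_map_carr[OF f M N] graded_map_carr[OF f M N] t tens_hom_carr_ptens1[OF N g] tens_hom_carr_ptens1[OF N g]] by simp

lemma lie_morphism_comp:
  assumes "lie_morphism M N f" "lie_morphism N P g" "gr_cop M (cobr M)" "graded_space N"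
  shows "lie_morphism M P (\<lambda>x. g (f x))"
proof -
  note f = lie_morphismD[OF assms(1)] and g = lie_morphismD[OF assms(2)] and M = gr_copD(1)[OF assms(3)]
  show ?thesis unfolding lie_morphism_def
    using graded_map_comp[OF f(1) g(1) M assms(4)]
      sq_map_comp[OF f(1) M assms(4) graded_mapD(1)[OF g(1)] gr_cop_power[OF assms(3)]]
      f(2) g(2) graded_map_carr[OF f(1) M assms(4)] by auto
qed

lemma coalg_morphism_comp:
  assumes "coalg_morphism M N f" "coalg_morphism N P g" "gr_cop M (comult M)" "graded_space N"
  shows "coalg_morphism M P (\<lambda>x. g (f x))"
proof -
  note f = coalg_morphismD[OF assms(1)] and g = coalg_morphismD[OF assms(2)] and M = gr_copD(1)[OF assms(3)]
  show ?thesis unfolding coalg_morphism_def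
    using graded_map_comp[OF f(1) g(1) M assms(4)]
      sq_map_comp[OF f(1) M assms(4) graded_mapD(1)[OF g(1)] gr_cop_power[OF assms(3)]]
      f(2,3) g(2,3) graded_map_carr[OF f(1) M assms(4)] by auto
qed

lemma sq_map_id:
  assumes "vector_space s" "module.subspace s A" "t \<in> tensor_power s A 2"
  shows "sq_map s A s (\<lambda>x. x) t = t"
  by (rule square_eqI[OF assms(3) sq_map_lin[OF assms(1,2) lin_on_id] lin_on_id])
    (simp add: sq_map_ptens[OF assms(1,2) lin_on_id])

lemma lie_morphism_id: assumes "gr_cop M (cobr M)" shows "lie_morphism M M (\<lambda>x. x)"
  unfolding lie_morphism_def graded_map_def linear_on_iff
  using sq_map_id[OF graded_space_vs carr_subspace gr_cop_power[OF assms]] gr_copD(1)[OF assms] lin_on_id by auto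

lemma coalg_morphism_id: assumes "gr_cop M (comult M)" shows "coalg_morphism M M (\<lambda>x. x)"
  unfolding coalg_morphism_def graded_map_def linear_on_iff
  using sq_map_id[OF graded_space_vs carr_subspace gr_cop_power[OF assms]] gr_copD(1)[OF assms] lin_on_id by auto

lemma graded_map_Liec [simp]: "graded_map (Liec D) (Liec E) f \<longleftrightarrow> graded_map D E f"
  by (simp add: graded_map_def linear_on_def)

text \<open>
  \<open>Liec\<close> is a functor.
\<close>

lemma Liec_morphism:
  assumes "coalg_morphism D E f" "gr_cop D (comult D)" "graded_space E"
  shows "lie_morphism (Liec D) (Liec E) f"
proof -
  note f = coalg_morphismD[OF assms(1)] and D = gr_copD[OF assms(2)]
  note vs = graded_space_vs[OF D(1)] carr_subspace[OF D(1)]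
  have "sq_map (scl D) (carr D) (scl E) f (comult D x - twist D (comult D x)) = comult E (f x) - twist E (comult E (f x))"
    if x: "x \<in> carr D" for x
  proof -
    note c = gr_cop_power[OF assms(2) x]
    show ?thesis
      by (simp only: lin_on_diff[OF tens_vector_space tensor_power_subspace sq_map_lin[OF vs graded_mapD(1)[OF f(1)]] c
            twist_power[OF D(1) c]] sq_map_twist[OF f(1) D(1) assms(3) c] f(2)[OF x])
  qed
  then show ?thesis using f(1) by (simp add: lie_morphism_def cobr_Liec)
qed

section \<open>Quotients and truncation of Lie coalgebras\<close>

lemma tensor_map_cycle:
  assumes f: "graded_map M N \<pi>" and lin: "Vector_Spaces.linear (scl M) (scl N) \<pi>"
    and M: "graded_space M" and N: "graded_space N" and t: "t \<in> tensor_power (scl M) (carr M) 3"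
  shows "tensor_map (scl M) (scl N) \<pi> (cycle M t) = cycle N (tensor_map (scl M) (scl N) \<pi> t)"
    and "tensor_map (scl M) (scl N) \<pi> t \<in> tensor_power (scl N) (carr N) 3"
proof -
  let ?T = "tensor_map (scl M) (scl N) \<pi>" and ?P = "tensor_power (scl M) (carr M) 3"
  have T: "lin_on ?P tscale tscale ?T"
    by (rule lin_on_subset[OF tensor_map_lin[OF lin]]) (auto simp: tensor_power_T)
  have P: "?T t \<in> tensor_power (scl N) (carr N) 3" if "t \<in> ?P" for t
    by (rule cube_imageI[OF M that T tens_vector_space tensor_power_subspace])
      (use graded_mapD(2)[OF f] gr_carr[OF N] in \<open>auto simp: tensor_map_ptens[OF lin] intro!: ptens_tensor_power_3\<close>)
  then show "?T t \<in> tensor_power (scl N) (carr N) 3" using t .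
  show "?T (cycle M t) = cycle N (?T t)"
  proof (rule cube_eqI[OF M t])
    show "lin_on ?P tscale tscale (\<lambda>t. ?T (cycle M t))"
      by (rule lin_on_comp[OF cycle_lin[OF M] cycle_power[OF M] T])
    show "lin_on ?P tscale tscale (\<lambda>t. cycle N (?T t))"
      by (rule lin_on_comp[OF T P cycle_lin[OF N]])
    fix a b c i j k assume abc: "a \<in> gr M i" "b \<in> gr M j" "c \<in> gr M k"
    show "?T (cycle M (ptens (scl M) [a, b, c])) = cycle N (?T (ptens (scl M) [a, b, c]))"
      using graded_mapD(2)[OF f] abc
      by (simp add: cycle_ptens[OF M abc] tensor_map_ptens[OF lin] lin_on_scale[OF tensor_map_lin[OF lin]]
          cycle_ptens[OF N, of _ i _ j _ k])
  qed
qed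

text \<open>
  The identities of a Lie coalgebra are transported along a surjective map that commutes with the
  cobrackets, since the induced maps on tensor powers commute with signed permutations.
\<close>

lemma lie_coalgebra_quotient:
  assumes L: "lie_coalgebra N" and M: "graded_space M" and c: "lin_on (carr M) (scl M) tscale (cobr M)"
    and f: "graded_map N M \<pi>" and lin: "Vector_Spaces.linear (scl N) (scl M) \<pi>"
    and surj: "\<And>i. gr M i \<subseteq> \<pi> ` gr N i"
    and comm: "\<And>x. x \<in> carr N \<Longrightarrow> tensor_map (scl N) (scl M) \<pi> (cobr N x) = cobr M (\<pi> x)"
  shows "lie_coalgebra M" "lie_morphism N M \<pi>"
proof -
  note cop = lie_coalgebra_cop[OF L] 
  note N = gr_copD[OF cop]
  note vs = graded_space_vs[OF N(1)] carr_subspace[OF N(1)]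
  let ?T = "tensor_map (scl N) (scl M) \<pi>"
  have sq: "sq_map (scl N) (carr N) (scl M) \<pi> t = ?T t" if "t \<in> tensor_power (scl N) (carr N) 2" for t
    by (rule sq_map_tensor_map[OF vs lin that])
  show mor: "lie_morphism N M \<pi>"
    unfolding lie_morphism_def using f comm sq[OF gr_cop_power[OF cop]] by simp
  have surj': "\<exists>x\<in>carr N. y = \<pi> x" if "y \<in> carr M" for y
  proof -
    have "module.subspace (scl M) (\<pi> ` carr N)"
      by (rule lin_on_image_subspace[OF vs linear_lin_on[OF lin] graded_space_vs[OF M]])
    then have "y \<in> \<pi> ` carr N"
      by (rule carr_imageI[OF M lin_on_id graded_space_vs[OF M] _ _ that])
        (use surj gr_carr[OF N(1)] in blast)
    then show ?thesis by blast
  qed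
  have gr: "cobr M y \<in> square_gr M i" if y: "y \<in> gr M i" for y i
  proof -
    obtain x where x: "x \<in> gr N i" "y = \<pi> x" using y surj by blast
    then show ?thesis
      using sq_map_square_gr[OF f N(1) N(3)[OF x(1)]] lie_morphismD(2)[OF mor gr_carr[OF N(1) x(1)]] by simp
  qed
  then have copM: "gr_cop M (cobr M)" using M c by (auto simp: gr_cop_def)
  have anti: "twist M (cobr M y) = - cobr M y" if y: "y \<in> carr M" for y
  proof -
    obtain x where x: "x \<in> carr N" "y = \<pi> x" using surj'[OF y] by blast
    note cx = gr_cop_power[OF cop x(1)]
    have "twist N (cobr N x) = - cobr N x" using L x(1) by (simp add: lie_coalgebra_def)
    moreover have "sq_map (scl N) (carr N) (scl M) \<pi> (- cobr N x) = - sq_map (scl N) (carr N) (scl M) \<pi> (cobr N x)"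
      using lin_on_diff[OF tens_vector_space tensor_power_subspace sq_map_lin[OF vs graded_mapD(1)[OF f]] tens.subspace_0[OF tensor_power_subspace] cx]
        lin_on_zero[OF sq_map_lin[OF vs graded_mapD(1)[OF f]] tens.subspace_0[OF tensor_power_subspace]] by simp
    ultimately show ?thesis
      using sq_map_twist[OF f N(1) M cx] lie_morphismD(2)[OF mor x(1)] x(2) by simp
  qed
  have jac: "(let t = tensor_fun (scl M) (carr M) (scl M) (cobr M) (\<lambda>a. ptens (scl M) [a]) (cobr M y)
        in t + cycle M t + cycle M (cycle M t) = 0)" if y: "y \<in> carr M" for y
  proof -
    obtain x where x: "x \<in> carr N" "y = \<pi> x" using surj'[OF y] by blast
    note cx = gr_cop_power[OF cop x(1)]
    define t where "t = tensor_fun (scl N) (carr N) (scl N) (cobr N) (\<lambda>a. ptens (scl N) [a]) (cobr N x)"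
    have t0: "t + cycle N t + cycle N (cycle N t) = 0"
      using L x(1) by (simp add: lie_coalgebra_def t_def Let_def)
    have t3: "t \<in> tensor_power (scl N) (carr N) 3" unfolding t_def by (rule gr_cop_left_power[OF cop cx])
    have "tensor_fun (scl M) (carr M) (scl M) (cobr M) (\<lambda>a. ptens (scl M) [a]) (cobr M y) =
      tensor_fun (scl M) (carr M) (scl M) (cobr M) (\<lambda>a. ptens (scl M) [a]) (sq_map (scl N) (carr N) (scl M) \<pi> (cobr N x))"
      using lie_morphismD(2)[OF mor x(1)] x(2) by simp
    also have "\<dots> = tensor_fun (scl N) (carr N) (scl M) (\<lambda>a. cobr M (\<pi> a)) (\<lambda>a. ptens (scl M) [\<pi> a]) (cobr N x)"
      by (rule tensor_fun_comp[OF vs graded_mapD(1)[OF f] graded_mapD(1)[OF f] _ _ cx gr_cop_hom[OF copM] tens_hom_carr_id[OF M]])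
        (rule graded_map_carr[OF f N(1) M], assumption)+
    also have "\<dots> = ?T t"
      unfolding t_def
    proof (rule square_eqI[OF cx])
      note h1 = tens_hom_comp[OF vs graded_mapD(1)[OF f] graded_map_carr[OF f N(1) M] gr_cop_hom[OF copM]]
      note h2 = tens_hom_carr_ptens1[OF N(1) graded_mapD(1)[OF f]]
      show "lin_on (tensor_power (scl N) (carr N) 2) tscale tscale (tensor_fun (scl N) (carr N) (scl M) (\<lambda>a. cobr M (\<pi> a)) (\<lambda>a. ptens (scl M) [\<pi> a]))"
        by (rule tensor_fun_lin[OF h1 h2])
      note h3 = gr_cop_hom[OF cop] and h4 = tens_hom_carr_id[OF N(1)]
      show "lin_on (tensor_power (scl N) (carr N) 2) tscale tscale
          (\<lambda>z. ?T (tensor_fun (scl N) (carr N) (scl N) (cobr N) (\<lambda>a. ptens (scl N) [a]) z))"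
        by (rule lin_on_comp[OF tensor_fun_lin[OF h3 h4] tensor_fun_T[OF h3 h4] tensor_map_lin[OF lin]])
      fix a b assume ab: "a \<in> carr N" "b \<in> carr N"
      show "tensor_fun (scl N) (carr N) (scl M) (\<lambda>a. cobr M (\<pi> a)) (\<lambda>a. ptens (scl M) [\<pi> a]) (ptens (scl N) [a, b]) =
        ?T (tensor_fun (scl N) (carr N) (scl N) (cobr N) (\<lambda>a. ptens (scl N) [a]) (ptens (scl N) [a, b]))"
        by (simp add: tensor_fun_ptens[OF h1 h2 ab] tensor_fun_ptens[OF h3 h4 ab] comm[OF ab(1)]
            tensor_map_tprod[OF lin tensor_power_T[OF gr_cop_power[OF cop ab(1)]]] tensor_map_ptens[OF lin])
    qed
    finally have eq: "tensor_fun (scl M) (carr M) (scl M) (cobr M) (\<lambda>a. ptens (scl M) [a]) (cobr M y) = ?T t" .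
    note Tc = tensor_map_cycle(1)[OF f lin N(1) M]
    have "?T t + cycle M (?T t) + cycle M (cycle M (?T t)) = ?T (t + cycle N t + cycle N (cycle N t))"
      using t3 cycle_power[OF N(1) t3] cycle_power[OF N(1) cycle_power[OF N(1) t3]]
      by (simp add: Tc[symmetric] lin_on_add[OF tensor_map_lin[OF lin]] tensor_power_T T_closed)
    also have "\<dots> = 0" unfolding t0 by (rule lin_on_zero[OF tensor_map_lin[OF lin] T_zero])
    finally show ?thesis unfolding Let_def eq .
  qed
  show "lie_coalgebra M"
    unfolding lie_coalgebra_def linear_on_iff using M c gr anti jac by blast
qed

text \<open>
  The quotient of \<open>N\<close> by its part in degrees \<open>\<le> 0\<close>, realised on the part in positive degrees; \<open>\<pi>\<close> stands
  for the projection.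
\<close>

definition trunc :: "('k::field, 'a::ab_group_add) lie_coalg \<Rightarrow> ('a \<Rightarrow> 'a) \<Rightarrow> ('k, 'a) lie_coalg" where
  "trunc N \<pi> = \<lparr>scl = scl N, gr = (\<lambda>i. if 1 \<le> i then gr N i else {0}),
     cobr = (\<lambda>x. tensor_map (scl N) (scl N) \<pi> (cobr N x))\<rparr>"

text \<open>
  The part of \<open>N\<close> in degrees \<open>\<le> 0\<close> is a coideal: two degrees with a sum \<open>\<le> 0\<close> cannot both be positive.
  Hence the cobracket descends to the quotient.
\<close>

lemma lie_coalgebra_truncation:
  assumes L: "lie_coalgebra N"
  shows "\<exists>\<pi>. lie_coalgebra (trunc N \<pi>) \<and> lie_morphism N (trunc N \<pi>) \<pi> \<and>
    (\<forall>i. \<forall>x\<in>gr N i. \<pi> x = (if 1 \<le> i then x else 0))"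
proof -
  note cop = lie_coalgebra_cop[OF L]
  note N = gr_copD[OF cop]
  note vs = graded_space_vs[OF N(1)] carr_subspace[OF N(1)]
  interpret vector_space "scl N" by (rule vs)
  have "\<exists>\<pi>. Vector_Spaces.linear (scl N) (scl N) \<pi> \<and> (\<forall>i. \<forall>x\<in>gr N i. \<pi> x = (if 1 \<le> i then x else 0))"
    by (rule graded_extension[OF N(1) vs(1)]) (simp add: lin_on_def)
  then obtain \<pi> where lin: "Vector_Spaces.linear (scl N) (scl N) \<pi>"
    and \<pi>: "\<And>i x. x \<in> gr N i \<Longrightarrow> \<pi> x = (if 1 \<le> i then x else 0)" by blast
  define M where "M = trunc N \<pi>"
  have M_simps [simp]: "scl M = scl N" "gr M i = (if 1 \<le> i then gr N i else {0})"
    "cobr M x = tensor_map (scl N) (scl N) \<pi> (cobr N x)" for i x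
    by (simp_all add: M_def trunc_def)
  have sub: "gr M i \<subseteq> gr N i" for i using subspace_0[OF gr_subspace[OF N(1)]] by auto
  have M: "graded_space M"
    by (rule graded_space_sub[OF N(1) _ sub]) (simp_all add: gr_subspace[OF N(1)] subspace_single_0)
  have "homog M \<subseteq> homog N" unfolding homog_def using sub by blast
  then have carr: "carr M \<subseteq> carr N" unfolding carr_def M_simps by (rule span_mono)
  note Tl = tensor_map_lin[OF lin]
  have Tc: "lin_on (carr N) (scl N) tscale (\<lambda>x. tensor_map (scl N) (scl N) \<pi> (cobr N x))"
    by (rule lin_on_comp[OF N(2) tensor_power_T[OF gr_cop_power[OF cop]] Tl])
  have c: "lin_on (carr M) (scl M) tscale (cobr M)"
    using lin_on_subset[OF Tc carr] by (simp add: lin_on_def)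
  have f: "graded_map N M \<pi>"
    unfolding graded_map_def linear_on_iff using linear_lin_on[OF lin] \<pi> by auto
  have surj: "gr M i \<subseteq> \<pi> ` gr N i" for i
  proof
    fix x assume x: "x \<in> gr M i"
    have x': "x \<in> gr N i" by (rule subsetD[OF sub x])
    have "\<pi> x = x" using x \<pi>[OF x'] by (auto split: if_splits)
    with x' show "x \<in> \<pi> ` gr N i" by force
  qed
  have low: "tensor_map (scl N) (scl N) \<pi> (cobr N x) = 0" if x: "x \<in> gr N i" and i: "\<not> 1 \<le> i" for x i
  proof (rule square_gr_eqI[OF N(1) N(3)[OF x] lin_on_subset[OF Tl] lin_on_const_zero[OF tens_vector_space]])
    show "tensor_power (scl N) (carr N) 2 \<subseteq> tensor_algebra (scl N)" by (auto simp: tensor_power_T)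
    fix a b j k assume ab: "a \<in> gr N j" "b \<in> gr N k" "j + k = i"
    with i have "\<not> 1 \<le> j \<or> \<not> 1 \<le> k" by linarith
    then have "\<pi> a = 0 \<or> \<pi> b = 0" using \<pi>[OF ab(1)] \<pi>[OF ab(2)] by auto
    then show "tensor_map (scl N) (scl N) \<pi> (ptens (scl N) [a, b]) = 0"
      by (auto simp: tensor_map_ptens[OF lin] ptens_zero_entry)
  qed
  have comm: "tensor_map (scl N) (scl M) \<pi> (cobr N x) = cobr M (\<pi> x)" if x: "x \<in> carr N" for x
    unfolding M_simps
  proof (rule carr_eqI[OF N(1) Tc _ _ x])
    have "\<pi> x \<in> carr N" if "x \<in> carr N" for x
      using graded_map_carr[OF f N(1) M that] carr by blast
    then show "lin_on (carr N) (scl N) tscale (\<lambda>x. tensor_map (scl N) (scl N) \<pi> (cobr N (\<pi> x)))"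
      by (rule lin_on_comp[OF linear_lin_on[OF lin] _ Tc])
    fix i x assume x: "x \<in> gr N i"
    have "tensor_map (scl N) (scl N) \<pi> (cobr N 0) = 0"
      by (rule lin_on_zero[OF Tc subspace_0[OF vs(2)]])
    then show "tensor_map (scl N) (scl N) \<pi> (cobr N x) = tensor_map (scl N) (scl N) \<pi> (cobr N (\<pi> x))"
      using \<pi>[OF x] low[OF x] by auto
  qed
  have "Vector_Spaces.linear (scl N) (scl M) \<pi>" using lin by simp
  from lie_coalgebra_quotient[OF L M c f this surj comm] \<pi>
  show ?thesis unfolding M_def by blast
qed

section \<open>Conilpotency and the cofree Lie coalgebra\<close>

text \<open>
  Shows that the linear extension in the definition of \<open>iter_cobr\<close> is legitimate.
\<close>

lemma iter_cobr_extendable: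
  assumes "gr_cop M (cobr M)"
  shows "extendable (scl M) (words (carr M) (Suc n)) (\<lambda>xs. tprod (scl M) (cobr M (hd xs)) (ptens (scl M) (tl xs)))"
proof (rule extendable_words[OF graded_space_vs carr_subspace], goal_cases)
  case 3
  note M = gr_copD[OF assms]
  show ?case unfolding multilin_on_def
  proof (intro allI impI)
    fix xs ys assume *: "set xs \<subseteq> carr M" "set ys \<subseteq> carr M"
    show "lin_on (carr M) (scl M) tscale
      (\<lambda>a. tprod (scl M) (cobr M (hd (xs @ a # ys))) (ptens (scl M) (tl (xs @ a # ys))))"
    proof (cases xs)
      case Nil
      then show ?thesis using lin_on_comp[OF M(2) UNIV_I tprod_lin_left] by simp
    next
      case (Cons b zs)
      then have "cobr M b \<in> tensor_algebra (scl M)" using * tensor_power_T[OF gr_cop_power[OF assms]] by simp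
      note tl = tprod_lin_right[OF this]
      show ?thesis
        by (rule lin_onI) (simp_all add: Cons ptens_add ptens_scale lin_on_add[OF tl] lin_on_scale[OF tl])
    qed
  qed
qed (use gr_copD[OF assms] in auto)

lemma iter_cobr_Suc_words:
  assumes "gr_cop M (cobr M)" "xs \<in> words (carr M) (Suc n)"
  shows "tprod (scl M) (cobr M (hd xs)) (ptens (scl M) (tl xs)) \<in> tensor_power (scl M) (carr M) (Suc (Suc n))"
proof -
  obtain a as where xs: "xs = a # as" "a \<in> carr M" "as \<in> words (carr M) n"
    using assms(2) by (auto simp: words_def length_Suc_conv)
  have "ptens (scl M) as \<in> tensor_power (scl M) (carr M) n"
    unfolding tensor_power_def using xs(3) by (intro tens.span_base) simp
  from tprod_tensor_power[OF gr_cop_power[OF assms(1) xs(2)] this] show ?thesis by (simp add: xs(1))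
qed

lemma iter_cobr_lin:
  assumes "gr_cop M (cobr M)"
  shows "lin_on (carr M) (scl M) tscale (iter_cobr M n) \<and> (\<forall>x\<in>carr M. iter_cobr M n x \<in> tensor_power (scl M) (carr M) (Suc n))"
proof (induction n)
  case 0
  show ?case using ptens1_power[of _ "carr M" "scl M"] by (simp add: lin_on_ptens1)
next
  case (Suc n)
  note tl = tlift_lin[OF iter_cobr_extendable[OF assms], of n, folded tensor_power_def]
  have eq: "iter_cobr M (Suc n) = (\<lambda>x. tlift (scl M) (words (carr M) (Suc n))
      (\<lambda>xs. tprod (scl M) (cobr M (hd xs)) (ptens (scl M) (tl xs))) (iter_cobr M n x))"
    by (rule ext) simp
  have "lin_on (carr M) (scl M) tscale (iter_cobr M (Suc n))"
    unfolding eq using lin_on_comp[OF conjunct1[OF Suc] _ tl] Suc by blast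
  moreover have "iter_cobr M (Suc n) x \<in> tensor_power (scl M) (carr M) (Suc (Suc n))" if "x \<in> carr M" for x
    unfolding iter_cobr.simps
    by (rule power_imageI[OF bspec[OF conjunct2[OF Suc] that] tl tens_vector_space tensor_power_subspace])
      (simp add: tlift_ptens[OF iter_cobr_extendable[OF assms]] iter_cobr_Suc_words[OF assms])
  ultimately show ?case by blast
qed

definition graded_words :: "('k, 'a, 'z) gspace_scheme \<Rightarrow> nat \<Rightarrow> int \<Rightarrow> 'a list set" where
  "graded_words M n d = {xs. length xs = n \<and> (\<exists>ds. list_all2 (\<lambda>a i. a \<in> gr M i) xs ds \<and> sum_list ds = d)}"

lemma iter_cobr_graded:
  assumes cop: "gr_cop M (cobr M)" and x: "x \<in> gr M d"
  shows "iter_cobr M n x \<in> tens.span (ptens (scl M) ` graded_words M (Suc n) d)"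
proof (induction n)
  case 0
  have "[x] \<in> graded_words M (Suc 0) d" using x by (auto simp: graded_words_def list_all2_Cons1 intro!: exI[of _ "[d]"])
  then show ?case by (simp add: tens.span_base)
next
  case (Suc n)
  note M = gr_copD[OF cop]
  have sub: "graded_words M (Suc n) d \<subseteq> words (carr M) (Suc n)"
    using gr_carr[OF M(1)] by (fastforce simp: graded_words_def words_def list_all2_conv_all_nth in_set_conv_nth)
  note tl = tlift_lin[OF iter_cobr_extendable[OF cop], of n]
  show ?case unfolding iter_cobr.simps
  proof (rule lin_on_image_span[OF tens_vector_space lin_on_subset[OF tl] tens_vector_space tens.subspace_span _ Suc])
    show "tens.span (ptens (scl M) ` graded_words M (Suc n) d) \<subseteq> tens.span (ptens (scl M) ` words (carr M) (Suc n))"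
      by (rule tens.span_mono[OF image_mono[OF sub]])
    fix t assume "t \<in> ptens (scl M) ` graded_words M (Suc n) d"
    then obtain xs where t: "t = ptens (scl M) xs" and xs: "xs \<in> graded_words M (Suc n) d" by blast
    from xs obtain a as i ds where xs': "xs = a # as" "a \<in> gr M i" "list_all2 (\<lambda>a i. a \<in> gr M i) as ds"
        "i + sum_list ds = d" "length as = n"
      by (auto simp: graded_words_def length_Suc_conv list_all2_Cons1)
    have "tprod (scl M) (cobr M a) (ptens (scl M) as) \<in> tens.span (ptens (scl M) ` graded_words M (Suc (Suc n)) d)"
    proof (rule square_gr_imageI[OF M(1) M(3)[OF xs'(2)] tprod_lin_left tens_vector_space tens.subspace_span])
      fix b c j k assume bc: "b \<in> gr M j" "c \<in> gr M k" "j + k = i"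
      have "b # c # as \<in> graded_words M (Suc (Suc n)) d"
        using bc xs' by (auto simp: graded_words_def intro!: exI[of _ "j # k # ds"])
      then show "tprod (scl M) (ptens (scl M) [b, c]) (ptens (scl M) as) \<in> tens.span (ptens (scl M) ` graded_words M (Suc (Suc n)) d)"
        by (simp add: tprod_ptens tens.span_base)
    qed
    then show "tlift (scl M) (words (carr M) (Suc n)) (\<lambda>xs. tprod (scl M) (cobr M (hd xs)) (ptens (scl M) (tl xs))) t
       \<in> tens.span (ptens (scl M) ` graded_words M (Suc (Suc n)) d)"
      using xs sub by (simp add: t tlift_ptens[OF iter_cobr_extendable[OF cop]] subset_iff xs'(1))
  qed
qed

text \<open>
  The \<open>n\<close>-th iterated cobracket of an element of degree \<open>d\<close> is spanned by words of \<open>n + 1\<close> homogeneous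
  elements with total degree \<open>d\<close>, and there are no such words of length \<open>> d\<close> in positive degrees.
\<close>

lemma positive_conilpotent:
  assumes "gr_cop M (cobr M)" and pos: "\<And>i. i \<le> 0 \<Longrightarrow> gr M i \<subseteq> {0}"
  shows "conilpotent M"
proof -
  note cop = assms(1)
  note M = gr_copD[OF cop]
  note il = iter_cobr_lin[OF cop, THEN conjunct1]
  interpret vector_space "scl M" using M(1) by (rule graded_space_vs)
  have hom: "iter_cobr M n x = 0" if x: "x \<in> gr M d" and n: "d \<le> int n" for x d n
  proof -
    \<comment> \<open>\<open>n + 1\<close> positive integers cannot add up to \<open>d \<le> n\<close>, so one of the entries vanishes\<close>
    have "ptens (scl M) ` graded_words M (Suc n) d \<subseteq> {0}"
    proof clarify
      fix xs assume "xs \<in> graded_words M (Suc n) d"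
      then obtain ds where xs: "length xs = Suc n" "list_all2 (\<lambda>a i. a \<in> gr M i) xs ds" "sum_list ds = d"
        by (auto simp: graded_words_def)
      have "\<exists>i\<in>set ds. i \<le> 0"
      proof (rule ccontr)
        assume "\<not> (\<exists>i\<in>set ds. i \<le> 0)"
        then have "\<forall>i\<in>set ds. 1 \<le> i" by force
        then have "int (length ds) \<le> sum_list ds" by (induction ds) auto
        then show False using xs n list_all2_lengthD[OF xs(2)] by simp
      qed
      then obtain j where j: "j < length ds" "ds ! j \<le> 0" by (metis in_set_conv_nth)
      then have "xs ! j \<in> gr M (ds ! j)" using xs(2) by (auto simp: list_all2_conv_all_nth)
      then have "xs ! j = 0" using pos[OF j(2)] by blast
      then have "0 \<in> set xs" using j list_all2_lengthD[OF xs(2)] by (metis nth_mem)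
      then show "ptens (scl M) xs = 0" by (rule ptens_zero_entry)
    qed
    then have "tens.span (ptens (scl M) ` graded_words M (Suc n) d) \<subseteq> {0}"
      by (intro tens.span_minimal) (auto simp: tens.subspace_single_0)
    then show ?thesis using iter_cobr_graded[OF cop x, of n] by blast
  qed
  define Z where "Z = {x \<in> carr M. \<exists>n. \<forall>m\<ge>n. iter_cobr M m x = 0}"
  have "subspace Z"
  proof (rule subspaceI)
    show "0 \<in> Z" using lin_on_zero[OF il] subspace_0[OF carr_subspace[OF M(1)]] by (auto simp: Z_def)
    fix x y assume "x \<in> Z" "y \<in> Z"
    then obtain n n' where "\<forall>m\<ge>n. iter_cobr M m x = 0" "\<forall>m\<ge>n'. iter_cobr M m y = 0" "x \<in> carr M" "y \<in> carr M"
      by (auto simp: Z_def)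
    then show "x + y \<in> Z"
      using subspace_add[OF carr_subspace[OF M(1)]] by (auto simp: Z_def lin_on_add[OF il] intro!: exI[of _ "max n n'"])
  next
    fix c x assume "x \<in> Z"
    then show "scl M c x \<in> Z"
      using subspace_scale[OF carr_subspace[OF M(1)]] by (auto simp: Z_def lin_on_scale[OF il])
  qed
  moreover have "x \<in> Z" if "x \<in> gr M d" for x d
    unfolding Z_def using that hom gr_carr[OF M(1)] by (auto intro!: exI[of _ "nat d"])
  ultimately have "x \<in> Z" if "x \<in> carr M" for x
    using carr_imageI[OF M(1) lin_on_id graded_space_vs[OF M(1)], of Z] that by blast
  then show ?thesis unfolding conilpotent_def Z_def by blast
qed

lemma scl_trunc: "scl (trunc N \<pi>) = scl N" by (simp add: trunc_def)

lemma carr_trunc_subset: "graded_space N \<Longrightarrow> carr (trunc N \<pi>) \<subseteq> carr N"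
proof -
  assume N: "graded_space N"
  interpret vector_space "scl N" using N by (rule graded_space_vs)
  have "homog (trunc N \<pi>) \<subseteq> homog N"
    using subspace_0[OF gr_subspace[OF N]] by (auto simp: homog_def trunc_def split: if_splits)
  then show ?thesis unfolding carr_def by (simp add: trunc_def span_mono)
qed

lemma trunc_conilpotent: "lie_coalgebra (trunc N \<pi>) \<Longrightarrow> conilpotent (trunc N \<pi>)"
  by (rule positive_conilpotent[OF lie_coalgebra_cop]) (simp_all add: trunc_def)

lemma map_to_sV_trunc:
  assumes "graded_space N" "map_to_sV s N g"
  shows "map_to_sV s (trunc N \<pi>) g"
proof -
  have "lin_on (carr (trunc N \<pi>)) (scl N) s g"
    using assms lin_on_subset carr_trunc_subset[OF assms(1)] unfolding map_to_sV_def linear_on_iff by blast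
  moreover have "g x = 0" if "x \<in> gr (trunc N \<pi>) i" "i \<noteq> 1" for i x
  proof -
    interpret vector_space "scl N" using assms(1) by (rule graded_space_vs)
    have "x \<in> gr N i" using that subspace_0[OF gr_subspace[OF assms(1)]] by (auto simp: trunc_def split: if_splits)
    then show ?thesis using assms(2) that(2) by (simp add: map_to_sV_def)
  qed
  ultimately show ?thesis by (auto simp: map_to_sV_def linear_on_iff scl_trunc)
qed

text \<open>
  The truncation of \<open>N\<close> is conilpotent, so the existence half of the universal property applies to
  it; the resulting morphism on \<open>N\<close> sends degrees \<open>\<le> 0\<close> to zero. It is applied to \<open>L\<close> itself and to
  \<open>Liec ((qA\<^sup>+)\<^sup>\<exclamdown>)\<close>.
\<close>

lemma cofree_lift:
  fixes N :: "('k::field, 'n::ab_group_add) lie_coalg"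
  assumes cofree: "cofree_among TYPE('n) s L pr" and L: "lie_coalgebra L" and N: "lie_coalgebra N" and g: "map_to_sV s N g"
    and pr: "map_to_sV s L pr"
  shows "\<exists>h. lie_morphism N L h \<and> (\<forall>x\<in>carr N. pr (h x) = g x) \<and> (\<forall>i\<le>0. \<forall>x\<in>gr N i. h x = 0)"
proof -
  obtain \<pi> where M: "lie_coalgebra (trunc N \<pi>)" and \<pi>: "lie_morphism N (trunc N \<pi>) \<pi>"
    and v: "\<And>i x. x \<in> gr N i \<Longrightarrow> \<pi> x = (if 1 \<le> i then x else 0)"
    using lie_coalgebra_truncation[OF N] by blast
  note copN = lie_coalgebra_cop[OF N] and copM = lie_coalgebra_cop[OF M] and copL = lie_coalgebra_cop[OF L]
  have "map_to_sV s (trunc N \<pi>) g" by (rule map_to_sV_trunc[OF gr_copD(1)[OF copN] g])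
  with cofree M trunc_conilpotent[OF M]
  obtain h where h: "lie_morphism (trunc N \<pi>) L h" "\<forall>x\<in>carr (trunc N \<pi>). pr (h x) = g x"
    unfolding cofree_among_def by blast
  \<comment> \<open>the lift is the composite of the projection to the truncation and the lift of the latter\<close>
  have comp: "lie_morphism N L (\<lambda>x. h (\<pi> x))"
    by (rule lie_morphism_comp[OF \<pi> h(1) copN gr_copD(1)[OF copM]])
  interpret T: vector_space "scl (trunc N \<pi>)" by (rule graded_space_vs[OF gr_copD(1)[OF copM]])
  have h0: "h 0 = 0"
    by (rule lin_on_zero[OF graded_mapD(1)[OF lie_morphismD(1)[OF h(1)]] T.subspace_0[OF carr_subspace[OF gr_copD(1)[OF copM]]]])
  have "h (\<pi> x) = 0" if "x \<in> gr N i" "i \<le> 0" for x i using v[OF that(1)] that(2) h0 by simp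
  moreover have "pr (h (\<pi> x)) = g x" if "x \<in> carr N" for x
  proof (rule carr_eqI[OF gr_copD(1)[OF copN] _ _ _ that])
    show "lin_on (carr N) (scl N) s g" using g by (simp add: map_to_sV_def linear_on_iff)
    have prl: "lin_on (carr L) (scl L) s pr" using pr by (simp add: map_to_sV_def linear_on_iff)
    show "lin_on (carr N) (scl N) s (\<lambda>x. pr (h (\<pi> x)))"
      by (rule lin_on_comp[OF graded_mapD(1)[OF lie_morphismD(1)[OF comp]] graded_map_carr[OF lie_morphismD(1)[OF comp] gr_copD(1)[OF copN] gr_copD(1)[OF copL]] prl])
    fix i x assume x: "x \<in> gr N i"
    have pc: "\<pi> x \<in> carr (trunc N \<pi>)"
      by (rule graded_map_carr[OF lie_morphismD(1)[OF \<pi>] gr_copD(1)[OF copN] gr_copD(1)[OF copM] gr_carr[OF gr_copD(1)[OF copN] x]])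
    interpret N: vector_space "scl N" by (rule graded_space_vs[OF gr_copD(1)[OF copN]])
    have g0: "g 0 = 0" using g N.subspace_0[OF carr_subspace[OF gr_copD(1)[OF copN]]] lin_on_zero
      unfolding map_to_sV_def linear_on_iff by blast
    have "pr (h (\<pi> x)) = g (\<pi> x)" using h(2) pc by blast
    also have "\<dots> = g x"
    proof (cases "1 \<le> i")
      case False
      then have "i \<noteq> 1" by simp
      then have "g x = 0" using g x unfolding map_to_sV_def by blast
      then show ?thesis using v[OF x] g0 False by simp
    qed (simp add: v[OF x])
    finally show "pr (h (\<pi> x)) = g x" .
  qed
  ultimately show ?thesis using comp by blast
qed

context
  fixes s :: "'k::field \<Rightarrow> 'v::ab_group_add \<Rightarrow> 'v" and L :: "('k, 'l::ab_group_add) lie_coalg" and pr :: "'l \<Rightarrow> 'v"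
  assumes cofree: "cofree_conilpotent_lie s L pr" and vs: "vector_space s"
begin

lemma cofree_facts: "lie_coalgebra L" "conilpotent L" "map_to_sV s L pr" "cofree_among TYPE('l) s L pr"
    "cofree_among TYPE(('k, 'v) tens) s L pr"
  using cofree by (auto simp: cofree_conilpotent_lie_def)

lemma cofree_cop: "gr_cop L (cobr L)" by (rule lie_coalgebra_cop[OF cofree_facts(1)])

lemmas cofree_graded = gr_copD[OF cofree_cop]

lemma cofree_pr_lin: "lin_on (carr L) (scl L) s pr" using cofree_facts(3) by (simp add: map_to_sV_def linear_on_iff)

lemma lie_morphism_id_unique:
  assumes "lie_morphism L L h" "\<And>x. x \<in> carr L \<Longrightarrow> pr (h x) = pr x" "x \<in> carr L"
  shows "h x = x"
proof -
  obtain h0 where h0: "\<And>h'. lie_morphism L L h' \<Longrightarrow> \<forall>x\<in>carr L. pr (h' x) = pr x \<Longrightarrow> \<forall>x\<in>carr L. h' x = h0 x"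
    using cofree_facts unfolding cofree_among_def by metis
  have "h x = h0 x" using h0[OF assms(1)] assms(2,3) by blast
  moreover have "x = h0 x" using h0[OF lie_morphism_id[OF cofree_cop]] assms(3) by blast
  ultimately show ?thesis by simp
qed

text \<open>
  The lift of \<open>pr\<close> through the truncation of \<open>L\<close> is the identity by uniqueness, yet it kills the
  degrees \<open>\<le> 0\<close>.
\<close>

lemma cofree_positive_degree: assumes "x \<in> gr L i" "i \<le> 0" shows "x = 0"
proof -
  obtain h where h: "lie_morphism L L h" "\<forall>x\<in>carr L. pr (h x) = pr x" "\<forall>i\<le>0. \<forall>x\<in>gr L i. h x = 0"
    using cofree_lift[OF cofree_facts(4,1,1,3,3)] by blast
  show ?thesis
    using lie_morphism_id_unique[OF h(1)] h(2,3) gr_carr[OF cofree_graded(1) assms(1)] assms by metis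
qed

text \<open>
  The line spanned by such an element is a Lie coalgebra with zero cobracket. Its inclusion into \<open>L\<close>
  and the zero map are Lie morphisms with the same composite with \<open>pr\<close>.
\<close>

lemma cofree_primitive:
  assumes x: "x \<in> gr L i" "cobr L x = 0" "pr x = 0"
  shows "x = 0"
proof -
  interpret L: vector_space "scl L" using cofree_graded(1) by (rule graded_space_vs)
  define M where "M = \<lparr>scl = scl L, gr = (\<lambda>j. if j = i then L.span {x} else {0}), cobr = (\<lambda>_::'l. 0 :: ('k, 'l) tens)\<rparr>"
  have M_simps [simp]: "scl M = scl L" "gr M j = (if j = i then L.span {x} else {0})" "cobr M y = 0" for j y
    by (simp_all add: M_def)
  have "homog M \<subseteq> L.span {x}" unfolding homog_def using L.span_zero[of "{x}"] by auto
  then have carr: "carr M \<subseteq> L.span {x}" unfolding carr_def M_simps by (rule L.span_minimal) simp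
  have sub: "L.span {x} \<subseteq> gr L i" using x(1) gr_subspace[OF cofree_graded(1)] by (intro L.span_minimal) auto
  have gsub: "gr M j \<subseteq> gr L j" for j using sub L.subspace_0[OF gr_subspace[OF cofree_graded(1)]] by auto
  have M: "graded_space M"
    by (rule graded_space_sub[OF cofree_graded(1) _ gsub]) (simp_all add: L.subspace_single_0)
  have c: "cobr M = (\<lambda>_. 0)" by (simp add: M_def)
  have cop: "gr_cop M (cobr M)"
    using M tens.subspace_0[OF square_gr_subspace] lin_on_const_zero[OF tens_vector_space]
    unfolding gr_cop_def c by auto
  have "twist M 0 = 0" by (rule lin_on_zero[OF twist_lin[OF M] tens.subspace_0[OF tensor_power_subspace]])
  moreover have "tensor_fun (scl M) (carr M) (scl M) (cobr M) (\<lambda>a. ptens (scl M) [a]) 0 = 0"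
    by (rule lin_on_zero[OF tensor_fun_lin[OF gr_cop_hom[OF cop] tens_hom_carr_id[OF M]] tens.subspace_0[OF tensor_power_subspace]])
  moreover have "cycle M 0 = 0" by (rule lin_on_zero[OF cycle_lin[OF M] tens.subspace_0[OF tensor_power_subspace]])
  ultimately have lie: "lie_coalgebra M"
    unfolding lie_coalgebra_def linear_on_iff Let_def using gr_copD[OF cop] M by (auto simp: c)
  have "iter_cobr M (Suc 0) y = 0" if "y \<in> carr M" for y
    using that tlift_ptens[OF iter_cobr_extendable[OF cop], of "[y]" 0] by (simp add: words_def c)
  then have conil: "conilpotent M" unfolding conilpotent_def by blast
  interpret V: vector_space s by (rule vs)
  have g: "map_to_sV s M (\<lambda>_. 0)" by (simp add: map_to_sV_def linear_on_iff lin_on_def)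
  from cofree_facts(4) lie conil g obtain h0 where
    h0: "\<And>h'. lie_morphism M L h' \<Longrightarrow> \<forall>y\<in>carr M. pr (h' y) = 0 \<Longrightarrow> \<forall>y\<in>carr M. h' y = h0 y"
    unfolding cofree_among_def by metis
  have xM: "x \<in> carr M" using gr_carr[OF M, of x i] by (simp add: L.span_base)
  have ann: "cobr L y = 0 \<and> pr y = 0" if y: "y \<in> carr M" for y
  proof -
    obtain k where "y = scl L k x" using y carr by (auto simp: L.span_singleton)
    then show ?thesis
      using lin_on_scale[OF cofree_graded(2) gr_carr[OF cofree_graded(1) x(1)]] lin_on_scale[OF cofree_pr_lin gr_carr[OF cofree_graded(1) x(1)]] x(2,3)
      by simp
  qed
  have sq0: "sq_map (scl M) (carr M) (scl L) h 0 = 0" if "lin_on (carr M) (scl M) (scl L) h" for h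
    by (rule lin_on_zero[OF sq_map_lin[OF graded_space_vs[OF M] carr_subspace[OF M] that] tens.subspace_0[OF tensor_power_subspace]])
  have "lie_morphism M L (\<lambda>y. y)"
    unfolding lie_morphism_def graded_map_def linear_on_iff
    using sq0[of "\<lambda>y. y"] ann gsub by (auto simp: c lin_on_def)
  from h0[OF this] ann xM have "x = h0 x" by blast
  moreover have "lie_morphism M L (\<lambda>y. 0)"
    unfolding lie_morphism_def graded_map_def linear_on_iff
    using sq0[of "\<lambda>y. 0"] L.subspace_0[OF gr_subspace[OF cofree_graded(1)]] lin_on_zero[OF cofree_graded(2) L.subspace_0[OF carr_subspace[OF cofree_graded(1)]]]
    by (auto simp: c lin_on_def)
  from h0[OF this] lin_on_zero[OF cofree_pr_lin L.subspace_0[OF carr_subspace[OF cofree_graded(1)]]] xM have "0 = h0 x" by blast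
  ultimately show ?thesis by simp
qed

text \<open>
  Induction on the degree. In \<open>]x[\<close> only factors of positive degree survive in \<open>L\<close>; their degrees are
  smaller than that of \<open>x\<close>, so \<open>f\<close> and \<open>g\<close> agree on them. Hence \<open>f x - g x\<close> has zero cobracket and is
  annihilated by \<open>pr\<close>. In this way the grading carries uniqueness over from conilpotent sources,
  which the universal property of \<open>L\<close> speaks of, to all Lie coalgebras \<open>Liec D\<close>.
\<close>

theorem lie_morphism_to_cofree_unique:
  assumes N: "gr_cop N (cobr N)" and f: "lie_morphism N L f" and g: "lie_morphism N L g"
    and pr: "\<And>x. x \<in> carr N \<Longrightarrow> pr (f x) = pr (g x)" and x: "x \<in> carr N"
  shows "f x = g x"
proof -
  note N' = gr_copD[OF N] and f' = graded_mapD[OF lie_morphismD(1)[OF f]] and g' = graded_mapD[OF lie_morphismD(1)[OF g]]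
  note vs = graded_space_vs[OF N'(1)] carr_subspace[OF N'(1)]
  have hom: "f x = g x" if "x \<in> gr N d" "d \<le> int n" for x d n
    using that
  proof (induction n arbitrary: x d rule: less_induct)
    case (less n)
    have small: "f a = g a" if a: "a \<in> gr N i" and i: "i < d \<or> i \<le> 0" for a i
    proof (cases "i \<le> 0")
      case True
      then show ?thesis using cofree_positive_degree[OF f'(2)[OF a] True] cofree_positive_degree[OF g'(2)[OF a] True] by simp
    next
      case False
      then have "nat i < n" "i \<le> int (nat i)" using i less.prems(2) by auto
      then show ?thesis using less.IH[of "nat i" a i] a by blast
    qed
    have "sq_map (scl N) (carr N) (scl L) f (cobr N x) = sq_map (scl N) (carr N) (scl L) g (cobr N x)"
    proof (rule square_gr_eqI[OF N'(1) N'(3)[OF less.prems(1)] sq_map_lin[OF vs f'(1)] sq_map_lin[OF vs g'(1)]])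
      fix a b i j assume ab: "a \<in> gr N i" "b \<in> gr N j" "i + j = d"
      note q = sq_map_ptens[OF vs f'(1) gr_carr[OF N'(1) ab(1)] gr_carr[OF N'(1) ab(2)]]
        sq_map_ptens[OF vs g'(1) gr_carr[OF N'(1) ab(1)] gr_carr[OF N'(1) ab(2)]]
      consider "i \<le> 0" | "j \<le> 0" | "i < d" "j < d" using ab(3) by linarith
      then show "sq_map (scl N) (carr N) (scl L) f (ptens (scl N) [a, b]) = sq_map (scl N) (carr N) (scl L) g (ptens (scl N) [a, b])"
      proof cases
        case 1
        then have "f a = 0" "g a = 0" using cofree_positive_degree f'(2)[OF ab(1)] g'(2)[OF ab(1)] by blast+
        then show ?thesis by (simp add: q ptens_zero_entry)
      next
        case 2
        then have "f b = 0" "g b = 0" using cofree_positive_degree f'(2)[OF ab(2)] g'(2)[OF ab(2)] by blast+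
        then show ?thesis by (simp add: q ptens_zero_entry)
      next
        case 3
        then show ?thesis using small ab by (simp add: q)
      qed
    qed
    then have "cobr L (f x) = cobr L (g x)"
      using lie_morphismD(2)[OF f] lie_morphismD(2)[OF g] gr_carr[OF N'(1) less.prems(1)] by simp
    interpret L: vector_space "scl L" using cofree_graded(1) by (rule graded_space_vs)
    note fx = f'(2)[OF less.prems(1)] and gx = g'(2)[OF less.prems(1)]
    note c = L.vector_space_axioms carr_subspace[OF cofree_graded(1)]
    have "f x - g x = 0"
    proof (rule cofree_primitive)
      show "f x - g x \<in> gr L d" by (rule L.subspace_diff[OF gr_subspace[OF cofree_graded(1)] fx gx])
      show "cobr L (f x - g x) = 0"
        using lin_on_diff[OF c cofree_graded(2) gr_carr[OF cofree_graded(1) fx] gr_carr[OF cofree_graded(1) gx]] \<open>cobr L (f x) = cobr L (g x)\<close> by simp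
      show "pr (f x - g x) = 0"
        using lin_on_diff[OF c cofree_pr_lin gr_carr[OF cofree_graded(1) fx] gr_carr[OF cofree_graded(1) gx]] pr[OF gr_carr[OF N'(1) less.prems(1)]] by simp
    qed
    then show ?case by simp
  qed
  show ?thesis
    by (rule carr_eqI[OF N'(1) f'(1) g'(1) _ x]) (rule hom[where n = "nat d" and d = d for d], auto)
qed

end

section \<open>The tensor coalgebra\<close>

text \<open>
  The component of the deconcatenation whose left factor has length \<open>p\<close>.
\<close>

definition split_at :: "('k::field \<Rightarrow> 'v::ab_group_add \<Rightarrow> 'v) \<Rightarrow> nat \<Rightarrow> ('k, 'v) tens \<Rightarrow> ('k, ('k, 'v) tens) tens" where
  "split_at s p = tlift s UNIV (\<lambda>xs. ptens tscale [ptens s (take p xs), ptens s (drop p xs)])"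

lemma split_multilinear: "multilinear s (\<lambda>xs. ptens tscale [ptens s (take p xs), ptens s (drop p xs)] \<mu>)"
proof (cases "multilinear tscale \<mu>")
  case True
  note m = multilinear_add[OF True, of "[]" _ _ "[z]" for z, simplified] multilinear_add[OF True, of "[z]" _ _ "[]" for z, simplified]
    multilinear_scale[OF True, of "[]" _ _ "[z]" for z, simplified] multilinear_scale[OF True, of "[z]" _ _ "[]" for z, simplified]
  have P: "ptens tscale xs \<mu> = \<mu> xs" for xs using True by (simp add: ptens_def)
  show ?thesis
  proof (rule multilinearI)
    fix xs ys a b c
    show "ptens tscale [ptens s (take p (xs @ (a + b) # ys)), ptens s (drop p (xs @ (a + b) # ys))] \<mu> =
      ptens tscale [ptens s (take p (xs @ a # ys)), ptens s (drop p (xs @ a # ys))] \<mu> +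
      ptens tscale [ptens s (take p (xs @ b # ys)), ptens s (drop p (xs @ b # ys))] \<mu>"
      by (cases "p - length xs") (simp_all add: P ptens_add m)
    show "ptens tscale [ptens s (take p (xs @ s c a # ys)), ptens s (drop p (xs @ s c a # ys))] \<mu> =
      c * ptens tscale [ptens s (take p (xs @ a # ys)), ptens s (drop p (xs @ a # ys))] \<mu>"
      by (cases "p - length xs") (simp_all add: P ptens_scale m)
  qed
qed (simp add: ptens_def multilinear_zero)

lemma split_at_ptens: "split_at s p (ptens s xs) = ptens tscale [ptens s (take p xs), ptens s (drop p xs)]"
  unfolding split_at_def by (rule tlift_ptens[OF extendable_UNIV[OF split_multilinear]]) simp

lemma split_at_lin: "lin_on (tensor_algebra s) tscale tscale (split_at s p)"
  unfolding split_at_def tensor_algebra_def by (rule tlift_lin[OF extendable_UNIV[OF split_multilinear]])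

lemma sum_apply: "(\<Sum>i\<in>I. t i) \<mu> = (\<Sum>i\<in>I. t i \<mu>)" for t :: "'i \<Rightarrow> 'b \<Rightarrow> 'k::comm_monoid_add"
  by (induction I rule: infinite_finite_induct) auto

lemma deconcat_extendable:
  "extendable s UNIV (\<lambda>xs. \<Sum>i\<le>length xs. ptens tscale [ptens s (take i xs), ptens s (drop i xs)])"
proof (rule extendable_UNIV)
  fix \<mu>
  show "multilinear s (\<lambda>xs. (\<Sum>i\<le>length xs. ptens tscale [ptens s (take i xs), ptens s (drop i xs)]) \<mu>)"
    unfolding sum_apply
    by (rule multilinearI)
      (simp_all only: length_append length_Cons multilinear_add[OF split_multilinear] multilinear_scale[OF split_multilinear]
        sum.distrib sum_distrib_left)
qed

lemma deconcat_ptens: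
  "deconcat s (ptens s xs) = (\<Sum>i\<le>length xs. ptens tscale [ptens s (take i xs), ptens s (drop i xs)])"
  unfolding deconcat_def by (rule tlift_ptens[OF deconcat_extendable]) simp

lemma deconcat_lin: "lin_on (tensor_algebra s) tscale tscale (deconcat s)"
  unfolding deconcat_def tensor_algebra_def by (rule tlift_lin[OF deconcat_extendable])

lemma tensor_power_lin: "lin_on (tensor_algebra s) tscale s' F \<Longrightarrow> lin_on (tensor_power s A n) tscale s' F"
  by (erule lin_on_subset) (auto simp: tensor_power_T)

lemma deconcat_split:
  assumes "t \<in> tensor_power s A n"
  shows "deconcat s t = (\<Sum>p\<le>n. split_at s p t)"
  by (rule power_eqI[OF assms tensor_power_lin[OF deconcat_lin] lin_on_sum_fun[OF tens_vector_space tensor_power_lin[OF split_at_lin]]])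
    (simp add: deconcat_ptens split_at_ptens words_def)

lemma tensor_proj_extendable: "extendable s UNIV (\<lambda>xs. if length xs = n then ptens s xs else 0)"
proof (rule extendable_UNIV)
  fix \<mu> show "multilinear s (\<lambda>xs. (if length xs = n then ptens s xs else 0) \<mu>)"
    by (rule multilinearI) (simp_all add: ptens_add ptens_scale tscale_def)
qed

lemma tensor_proj_ptens: "tensor_proj s n (ptens s xs) = (if length xs = n then ptens s xs else 0)"
  unfolding tensor_proj_def by (rule tlift_ptens[OF tensor_proj_extendable]) simp

lemma tensor_proj_lin: "lin_on (tensor_algebra s) tscale tscale (tensor_proj s n)"
  unfolding tensor_proj_def tensor_algebra_def by (rule tlift_lin[OF tensor_proj_extendable])

lemma ptens_tensor_power: "length xs = n \<Longrightarrow> ptens s xs \<in> tensor_power s UNIV n"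
  unfolding tensor_power_def by (rule tens.span_base) (auto simp: words_def)

lemma tensor_proj_power: "t \<in> tensor_algebra s \<Longrightarrow> tensor_proj s n t \<in> tensor_power s UNIV n"
  by (erule T_imageI[OF _ tensor_proj_lin tens_vector_space tensor_power_subspace])
    (simp add: tensor_proj_ptens ptens_tensor_power tens.subspace_0[OF tensor_power_subspace])

lemma tensor_proj_T: "t \<in> tensor_algebra s \<Longrightarrow> tensor_proj s n t \<in> tensor_algebra s"
  by (rule tensor_power_T[OF tensor_proj_power])

lemma tensor_proj_hom: "tens_hom (tensor_algebra s) tscale s (tensor_proj s n)"
  by (simp add: tens_hom_def tens_vector_space T_subspace tensor_proj_lin tensor_proj_T)

lemma tensor_proj_eq:
  assumes "t \<in> tensor_power s A n" shows "tensor_proj s m t = (if m = n then t else 0)"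
proof (rule power_eqI[OF assms tensor_power_lin[OF tensor_proj_lin]])
  show "lin_on (tensor_power s A n) tscale tscale (\<lambda>t. if m = n then t else 0)"
    using lin_on_id lin_on_const_zero[OF tens_vector_space] by (cases "m = n") auto
qed (auto simp: tensor_proj_ptens words_def)

lemma tensor_proj_sum:
  assumes "t \<in> tensor_algebra s"
  shows "\<exists>N. \<forall>m\<ge>N. t = (\<Sum>n<m. tensor_proj s n t)"
proof -
  define P where "P t \<longleftrightarrow> t \<in> tensor_algebra s \<and> (\<exists>N. \<forall>m\<ge>N. t = (\<Sum>n<m. tensor_proj s n t))" for t
  note tl = tensor_proj_lin[of s]
  have P0: "P 0" unfolding P_def using T_zero lin_on_zero[OF tl T_zero] by auto
  have "P t" using assms
  proof (induction rule: T_induct)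
    case zero
    show ?case by (rule P0)
  next
    case (add t u)
    then obtain N N' where "\<forall>m\<ge>N. t = (\<Sum>n<m. tensor_proj s n t)" "\<forall>m\<ge>N'. u = (\<Sum>n<m. tensor_proj s n u)"
        "t \<in> tensor_algebra s" "u \<in> tensor_algebra s" by (auto simp: P_def)
    then have "\<forall>m\<ge>max N N'. t + u = (\<Sum>n<m. tensor_proj s n (t + u))"
      by (simp add: lin_on_add[OF tl] sum.distrib)
    moreover have "t + u \<in> tensor_algebra s" using add unfolding P_def by (blast intro: T_closed)
    ultimately show ?case unfolding P_def by blast
  next
    case (scale c t)
    then obtain N where N: "\<forall>m\<ge>N. t = (\<Sum>n<m. tensor_proj s n t)" "t \<in> tensor_algebra s" by (auto simp: P_def)
    then have "\<forall>m\<ge>N. tscale c t = (\<Sum>n<m. tensor_proj s n (tscale c t))"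
      by (simp add: lin_on_scale[OF tl] tens.scale_sum_right[symmetric])
    then show ?case unfolding P_def using N(2) T_closed by blast
  next
    case (ptens xs)
    have "\<forall>m\<ge>Suc (length xs). ptens s xs = (\<Sum>n<m. tensor_proj s n (ptens s xs))"
      by (auto simp: tensor_proj_ptens)
    then show ?case unfolding P_def using ptens_in_T by blast
  qed
  then show ?thesis unfolding P_def by blast
qed

text \<open>
  A tensor has finitely many components and is their sum, so it is determined by them.
\<close>

lemma tensor_proj_eqI:
  assumes "t \<in> tensor_algebra s" "u \<in> tensor_algebra s" "\<And>n. tensor_proj s n t = tensor_proj s n u"
  shows "t = u"
proof -
  obtain N N' where "\<forall>m\<ge>N. t = (\<Sum>n<m. tensor_proj s n t)" "\<forall>m\<ge>N'. u = (\<Sum>n<m. tensor_proj s n u)"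
    using tensor_proj_sum assms(1,2) by metis
  then have "t = (\<Sum>n<max N N'. tensor_proj s n t)" "u = (\<Sum>n<max N N'. tensor_proj s n u)" by simp_all
  then show ?thesis using assms(3) by simp
qed

lemma tensor_coalg_simps [simp]:
  "scl (tensor_coalg s) = tscale" "comult (tensor_coalg s) = deconcat s"
  "gr (tensor_coalg s) i = (if i < 0 then {0} else tensor_power s UNIV (nat i))"
  "counit (tensor_coalg s) t = t (\<lambda>xs. if xs = [] then 1 else 0)"
  by (simp_all add: tensor_coalg_def)

lemma tensor_coalg_graded: "graded_space (tensor_coalg s)"
  unfolding graded_space_def
proof (intro conjI allI impI ballI)
  fix I and x :: "int \<Rightarrow> _" and j
  assume *: "finite I \<and> (\<forall>i\<in>I. x i \<in> gr (tensor_coalg s) i) \<and> sum x I = 0" and j: "j \<in> I"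
  have pow: "x i \<in> tensor_power s UNIV (nat i)" if "i \<in> I" for i
    using * that tens.subspace_0[OF tensor_power_subspace] by (cases "i < 0") fastforce+
  show "x j = 0"
  proof (cases "j < 0")
    case False
    have "0 = tensor_proj s (nat j) (sum x I)" using * lin_on_zero[OF tensor_proj_lin T_zero] by simp
    also have "\<dots> = (\<Sum>i\<in>I. tensor_proj s (nat j) (x i))"
      by (rule lin_on_sum[OF tens_vector_space T_subspace tensor_proj_lin]) (use * tensor_power_T[OF pow] in auto)
    also have "\<dots> = (\<Sum>i\<in>I. if i = j then x j else 0)"
    proof (rule sum.cong[OF refl])
      fix i assume i: "i \<in> I"
      have "i < 0 \<Longrightarrow> x i = 0" using * i by auto
      then show "tensor_proj s (nat j) (x i) = (if i = j then x j else 0)"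
        using tensor_proj_eq[OF pow[OF i], of "nat j"] False lin_on_zero[OF tensor_proj_lin T_zero]
        by (cases "i < 0") auto
    qed
    also have "\<dots> = x j" using * j by simp
    finally show ?thesis by simp
  qed (use * j in auto)
qed (simp_all add: tens_vector_space tensor_power_subspace tens.subspace_single_0)

text \<open>
  \<open>T(V) \<otimes> T(V)\<close>, tensors over the vector space of tensors.
\<close>

abbreviation T2 where "T2 s \<equiv> tensor_power tscale (tensor_algebra s) 2"

lemma split_at_T2: "t \<in> tensor_algebra s \<Longrightarrow> split_at s p t \<in> T2 s"
  by (erule T_imageI[OF _ split_at_lin tens_vector_space tensor_power_subspace])
    (simp add: split_at_ptens ptens_tensor_power_2)

lemma deconcat_T2: "t \<in> tensor_algebra s \<Longrightarrow> deconcat s t \<in> T2 s"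
  by (erule T_imageI[OF _ deconcat_lin tens_vector_space tensor_power_subspace])
    (simp add: deconcat_ptens ptens_tensor_power_2 tens.subspace_sum[OF tensor_power_subspace])

lemma T_tens_hom_ptens1: "lin_on (tensor_algebra s) tscale s' f \<Longrightarrow> tens_hom (tensor_algebra s) tscale s' (\<lambda>a. ptens s' [f a])"
  by (rule tens_hom_ptens1[OF tens_vector_space T_subspace])

lemma tensor_fun_deconcat_ptens:
  assumes "tens_hom (tensor_algebra s) tscale s' f" "tens_hom (tensor_algebra s) tscale s' g"
  shows "tensor_fun tscale (tensor_algebra s) s' f g (deconcat s (ptens s xs)) =
    (\<Sum>i\<le>length xs. tprod s' (f (ptens s (take i xs))) (g (ptens s (drop i xs))))"
  unfolding deconcat_ptens
  by (subst lin_on_sum[OF tens_vector_space tensor_power_subspace tensor_fun_lin[OF assms]])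
    (simp_all add: ptens_tensor_power_2 tensor_fun_ptens[OF assms])

lemma tensor_fun_deconcat_lin:
  assumes "tens_hom (tensor_algebra s) tscale s' f" "tens_hom (tensor_algebra s) tscale s' g"
  shows "lin_on (tensor_algebra s) tscale tscale (\<lambda>t. tensor_fun tscale (tensor_algebra s) s' f g (deconcat s t))"
  by (rule lin_on_comp[OF deconcat_lin deconcat_T2 tensor_fun_lin[OF assms]])

text \<open>
  Cutting a word after \<open>p\<close> letters and gluing it again.
\<close>

lemma proj_conv:
  assumes "t \<in> tensor_algebra s"
  shows "tensor_fun tscale (tensor_algebra s) s (tensor_proj s p) (tensor_proj s q) (deconcat s t) = tensor_proj s (p + q) t"
proof (rule T_eqI[OF assms tensor_fun_deconcat_lin[OF tensor_proj_hom tensor_proj_hom] tensor_proj_lin])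
  fix xs :: "'a list"
  have "tprod s (tensor_proj s p (ptens s (take i xs))) (tensor_proj s q (ptens s (drop i xs))) =
     (if i = p then (if length xs = p + q then ptens s xs else 0) else 0)" if "i \<le> length xs" for i
    using that by (auto simp: tensor_proj_ptens tprod_ptens tprod_zero_right)
  then have "(\<Sum>i\<le>length xs. tprod s (tensor_proj s p (ptens s (take i xs))) (tensor_proj s q (ptens s (drop i xs)))) =
    (\<Sum>i\<le>length xs. if i = p then (if length xs = p + q then ptens s xs else 0) else 0)" by (intro sum.cong) auto
  then show "tensor_fun tscale (tensor_algebra s) s (tensor_proj s p) (tensor_proj s q) (deconcat s (ptens s xs)) =
    tensor_proj s (p + q) (ptens s xs)"
    by (auto simp: tensor_fun_deconcat_ptens[OF tensor_proj_hom tensor_proj_hom] tensor_proj_ptens)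
qed

lemma deconcat_coassoc:
  assumes "t \<in> tensor_algebra s"
  shows "tensor_fun tscale (tensor_algebra s) tscale (deconcat s) (\<lambda>a. ptens tscale [a]) (deconcat s t) =
    tensor_fun tscale (tensor_algebra s) tscale (\<lambda>a. ptens tscale [a]) (deconcat s) (deconcat s t)"
proof -
  have h: "tens_hom (tensor_algebra s) tscale tscale (deconcat s)"
    by (simp add: tens_hom_def tens_vector_space T_subspace deconcat_lin tensor_power_T[OF deconcat_T2])
  have i: "tens_hom (tensor_algebra s) tscale tscale (\<lambda>a. ptens tscale [a])"
    by (rule T_tens_hom_ptens1[OF lin_on_id])
  show ?thesis
  proof (rule T_eqI[OF assms tensor_fun_deconcat_lin[OF h i] tensor_fun_deconcat_lin[OF i h]])
    fix xs :: "'a list"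
    let ?f = "\<lambda>i j. ptens tscale [ptens s (take i xs), ptens s (take j (drop i xs)), ptens s (drop (i + j) xs)]"
    have sumT: "(\<Sum>j\<in>J. F j) \<in> tensor_algebra tscale" if "\<And>j. F j \<in> tensor_algebra tscale" for J :: "nat set" and F :: "nat \<Rightarrow> ('b, ('b, 'a) tens) tens"
      using that by (intro tens.subspace_sum[OF T_subspace])
    have "tensor_fun tscale (tensor_algebra s) tscale (deconcat s) (\<lambda>a. ptens tscale [a]) (deconcat s (ptens s xs)) =
      (\<Sum>n\<le>length xs. \<Sum>i\<le>n. ?f i (n - i))"
      unfolding tensor_fun_deconcat_ptens[OF h i]
    proof (rule sum.cong[OF refl])
      fix n assume "n \<in> {..length xs}"
      then have "tprod tscale (deconcat s (ptens s (take n xs))) (ptens tscale [ptens s (drop n xs)]) =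
        (\<Sum>i\<le>n. tprod tscale (ptens tscale [ptens s (take i (take n xs)), ptens s (drop i (take n xs))]) (ptens tscale [ptens s (drop n xs)]))"
        by (subst deconcat_ptens, subst lin_on_sum[OF tens_vector_space tens.subspace_UNIV tprod_lin_left]) (auto simp: min_def)
      also have "\<dots> = (\<Sum>i\<le>n. ?f i (n - i))"
        by (rule sum.cong) (simp_all add: tprod_ptens min_def drop_take)
      finally show "tprod tscale (deconcat s (ptens s (take n xs))) (ptens tscale [ptens s (drop n xs)]) = (\<Sum>i\<le>n. ?f i (n - i))" .
    qed
    also have "\<dots> = (\<Sum>i\<le>length xs. \<Sum>j\<le>length xs - i. ?f i j)"
      by (subst sum.triangle_reindex_eq[symmetric], subst sum.Sigma) (auto intro!: sum.cong)
    also have "\<dots> = tensor_fun tscale (tensor_algebra s) tscale (\<lambda>a. ptens tscale [a]) (deconcat s) (deconcat s (ptens s xs))"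
      unfolding tensor_fun_deconcat_ptens[OF i h]
    proof (rule sum.cong[OF refl])
      fix i
      have "tprod tscale (ptens tscale [ptens s (take i xs)]) (deconcat s (ptens s (drop i xs))) =
        (\<Sum>j\<le>length xs - i. tprod tscale (ptens tscale [ptens s (take i xs)]) (ptens tscale [ptens s (take j (drop i xs)), ptens s (drop j (drop i xs))]))"
        by (subst deconcat_ptens, subst lin_on_sum[OF tens_vector_space T_subspace tprod_lin_right]) auto
      then show "(\<Sum>j\<le>length xs - i. ?f i j) = tprod tscale (ptens tscale [ptens s (take i xs)]) (deconcat s (ptens s (drop i xs)))"
        by (simp add: tprod_ptens add.commute)
    qed
    finally show "tensor_fun tscale (tensor_algebra s) tscale (deconcat s) (\<lambda>a. ptens tscale [a]) (deconcat s (ptens s xs)) =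
      tensor_fun tscale (tensor_algebra s) tscale (\<lambda>a. ptens tscale [a]) (deconcat s) (deconcat s (ptens s xs))" .
  qed
qed

text \<open>
  The unit \<open>\<eta>\<epsilon>\<close> of convolution: the counit followed by the unit of the tensor algebra.
\<close>

abbreviation eps where "eps D s x \<equiv> tscale (counit D x) (ptens s [])"

lemma counit_form: "multilinear s (\<lambda>xs. if xs = [] then 1 else 0)"
  by (rule multilinearI) simp_all

lemma counit_ptens: "ptens s xs (\<lambda>xs. if xs = [] then 1 else 0) = (if xs = [] then 1 else 0)"
  by (simp add: ptens_def counit_form)

lemma counit_lin: "lin_on A tscale (*) (counit (tensor_coalg s))"
  by (auto simp: lin_on_def tscale_def)

lemma eps_hom: "tens_hom (tensor_algebra s) tscale s' (\<lambda>a. eps (tensor_coalg s) s' a)"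
  unfolding tens_hom_def
  by (auto simp: tens_vector_space T_subspace T_closed lin_on_def tens.scale_left_distrib tscale_apply)

lemma deconcat_counit:
  assumes "t \<in> tensor_algebra s"
  shows "tensor_fun tscale (tensor_algebra s) tscale (\<lambda>a. eps (tensor_coalg s) tscale a) (\<lambda>a. ptens tscale [a]) (deconcat s t) = ptens tscale [t]"
    "tensor_fun tscale (tensor_algebra s) tscale (\<lambda>a. ptens tscale [a]) (\<lambda>a. eps (tensor_coalg s) tscale a) (deconcat s t) = ptens tscale [t]"
proof -
  have i: "tens_hom (tensor_algebra s) tscale tscale (\<lambda>a. ptens tscale [a])"
    by (rule T_tens_hom_ptens1[OF lin_on_id])
  show "tensor_fun tscale (tensor_algebra s) tscale (\<lambda>a. eps (tensor_coalg s) tscale a) (\<lambda>a. ptens tscale [a]) (deconcat s t) = ptens tscale [t]"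
  proof (rule T_eqI[OF assms tensor_fun_deconcat_lin[OF eps_hom i] lin_on_ptens1])
    fix xs :: "'a list"
    have "(\<Sum>n\<le>length xs. tprod tscale (eps (tensor_coalg s) tscale (ptens s (take n xs))) (ptens tscale [ptens s (drop n xs)])) =
      (\<Sum>n\<le>length xs. if n = 0 then ptens tscale [ptens s xs] else 0)"
      by (rule sum.cong) (auto simp: counit_ptens tprod_ptens)
    then show "tensor_fun tscale (tensor_algebra s) tscale (\<lambda>a. eps (tensor_coalg s) tscale a) (\<lambda>a. ptens tscale [a]) (deconcat s (ptens s xs)) = ptens tscale [ptens s xs]"
      unfolding tensor_fun_deconcat_ptens[OF eps_hom i] by simp
  qed
  show "tensor_fun tscale (tensor_algebra s) tscale (\<lambda>a. ptens tscale [a]) (\<lambda>a. eps (tensor_coalg s) tscale a) (deconcat s t) = ptens tscale [t]"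
  proof (rule T_eqI[OF assms tensor_fun_deconcat_lin[OF i eps_hom] lin_on_ptens1])
    fix xs :: "'a list"
    have "(\<Sum>n\<le>length xs. tprod tscale (ptens tscale [ptens s (take n xs)]) (eps (tensor_coalg s) tscale (ptens s (drop n xs)))) =
      (\<Sum>n\<le>length xs. if n = length xs then ptens tscale [ptens s xs] else 0)"
      by (rule sum.cong) (auto simp: counit_ptens tprod_ptens tprod_zero_right)
    then show "tensor_fun tscale (tensor_algebra s) tscale (\<lambda>a. ptens tscale [a]) (\<lambda>a. eps (tensor_coalg s) tscale a) (deconcat s (ptens s xs)) = ptens tscale [ptens s xs]"
      unfolding tensor_fun_deconcat_ptens[OF i eps_hom] by simp
  qed
qed

section \<open>The Koszul dual coalgebra is a coalgebra\<close>

text \<open>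
  The contraction \<open>id \<otimes> \<beta>\<close> with a linear functional, and \<open>\<beta> \<otimes> id\<close> below. The scalar \<open>\<beta> b\<close> is read as an
  element of \<open>V\<^sup>\<otimes>\<^sup>0\<close>, which makes these maps instances of \<open>tensor_fun\<close>.
\<close>

definition slice_right where
  "slice_right s \<beta> = tensor_fun tscale (tensor_algebra s) s (\<lambda>a. a) (\<lambda>b. tscale (\<beta> b) (ptens s []))"

definition slice_left where
  "slice_left s \<beta> = tensor_fun tscale (tensor_algebra s) s (\<lambda>a. tscale (\<beta> a) (ptens s [])) (\<lambda>b. b)"

lemma slice_homs:
  assumes "lin_on UNIV tscale (*) \<beta>"
  shows "tens_hom (tensor_algebra s) tscale s (\<lambda>b. tscale (\<beta> b) (ptens s []))" "tens_hom (tensor_algebra s) tscale s (\<lambda>a. a)"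
  using assms by (auto simp: tens_hom_def tens_vector_space T_subspace T_closed lin_on_def tens.scale_left_distrib)

lemma slice_ptens:
  assumes "lin_on UNIV tscale (*) \<beta>" "a \<in> tensor_algebra s" "b \<in> tensor_algebra s"
  shows "slice_right s \<beta> (ptens tscale [a, b]) = tscale (\<beta> b) a" "slice_left s \<beta> (ptens tscale [a, b]) = tscale (\<beta> a) b"
  using assms(2,3) unfolding slice_right_def slice_left_def
  by (simp_all add: tensor_fun_ptens[OF slice_homs(1,2)[OF assms(1)]] tensor_fun_ptens[OF slice_homs(2,1)[OF assms(1)]]
      tprod_scale_left tprod_scale_right tprod_one_left tprod_one_right)

lemma slice_lin:
  assumes "lin_on UNIV tscale (*) \<beta>"
  shows "lin_on (T2 s) tscale tscale (slice_right s \<beta>)" "lin_on (T2 s) tscale tscale (slice_left s \<beta>)"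
  unfolding slice_right_def slice_left_def
  by (rule tensor_fun_lin[OF slice_homs(2,1)[OF assms]], rule tensor_fun_lin[OF slice_homs[OF assms]])

text \<open>
  A tensor involves finitely many vectors. If \<open>B\<close> is a basis of their span and \<open>\<beta>\<close> are the coordinate
  functionals, the tensor is the sum of its slices along \<open>\<beta>\<close>, tensored with the basis vectors.
\<close>

lemma slice_expansion:
  fixes w :: "('k::field, ('k, 'v::ab_group_add) tens) tens"
  assumes w: "w \<in> T2 s"
  shows "\<exists>B \<beta>. finite B \<and> B \<subseteq> tensor_algebra s \<and> (\<forall>b. lin_on UNIV tscale (*) (\<beta> b)) \<and>
    w = (\<Sum>b\<in>B. ptens tscale [slice_right s (\<beta> b) w, b]) \<and> w = (\<Sum>b\<in>B. ptens tscale [b, slice_left s (\<beta> b) w])"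
proof -
  have "\<exists>F. finite F \<and> F \<subseteq> tensor_algebra s \<and> w \<in> tensor_power tscale F 2"
    using w unfolding tensor_power_def
  proof (induction rule: tens.span_induct_alt)
    case base
    show ?case by (intro exI[of _ "{}"] conjI tens.span_zero) simp_all
  next
    case (step c x y)
    then obtain F where F: "finite F" "F \<subseteq> tensor_algebra s" "y \<in> tens.span (ptens tscale ` words F 2)" by blast
    from step obtain a b where x: "x = ptens tscale [a, b]" "a \<in> tensor_algebra s" "b \<in> tensor_algebra s"
      by (auto simp: words_2)
    have "x \<in> tens.span (ptens tscale ` words (insert a (insert b F)) 2)"
      unfolding x by (rule tens.span_base) (auto simp: words_2)
    moreover have "y \<in> tens.span (ptens tscale ` words (insert a (insert b F)) 2)"
      by (rule subsetD[OF tens.span_mono[OF image_mono[OF words_mono]] F(3)]) auto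
    ultimately show ?case using F x by (intro exI[of _ "insert a (insert b F)"] conjI tens.span_add tens.span_scale) auto
  qed
  then obtain F where F: "finite F" "F \<subseteq> tensor_algebra s" "w \<in> tensor_power tscale F 2" by blast
  obtain B where B: "B \<subseteq> F" "tens.independent B" "F \<subseteq> tens.span B" using tens.maximal_independent_subset by blast
  have finB: "finite B" using B(1) F(1) finite_subset by blast
  \<comment> \<open>coordinates with respect to a basis of the whole space are functionals on the whole
    space\<close>
  define E where "E = tens.extend_basis B"
  have E: "tens.independent E" "tens.span E = UNIV" "B \<subseteq> E"
    unfolding E_def by (simp_all add: tens.independent_extend_basis[OF B(2)] tens.span_extend_basis[OF B(2)] tens.extend_basis_superset[OF B(2)])
  define \<beta> where "\<beta> b v = tens.representation E v b" for b v
  have \<beta>: "lin_on UNIV tscale (*) (\<beta> b)" for b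
    by (rule lin_onI) (simp_all add: \<beta>_def tens.representation_add tens.representation_scale E)
  have exp: "(\<Sum>b\<in>B. tscale (\<beta> b v) b) = v" if "v \<in> F" for v
  proof -
    have v: "v \<in> tens.span B" using that B(3) by blast
    show ?thesis
      unfolding \<beta>_def tens.representation_extend[OF E(1) v E(3)]
      by (rule tens.sum_representation_eq[OF B(2) v finB]) simp
  qed
  have BT: "B \<subseteq> tensor_algebra s" using B(1) F(2) by blast
  have sub: "tensor_power tscale F 2 \<subseteq> T2 s" by (rule tensor_power_mono[OF F(2)])
  note sl = slice_lin(1)[OF \<beta>, THEN lin_on_subset[OF _ sub]] slice_lin(2)[OF \<beta>, THEN lin_on_subset[OF _ sub]]
  have l1: "lin_on A tscale tscale (\<lambda>a. ptens tscale [a, b])" "lin_on A tscale tscale (\<lambda>a. ptens tscale [b, a])"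
    for A and b :: "('k, 'v) tens" by (simp_all add: lin_on_def ptens_add2)
  have sum2: "(\<Sum>b\<in>B. ptens tscale [a, tscale (\<beta> b c) b]) = ptens tscale [a, c]"
     "(\<Sum>b\<in>B. ptens tscale [tscale (\<beta> b c) b, a]) = ptens tscale [c, a]" if "c \<in> F" for a c
    using lin_on_sum[OF tens_vector_space tens.subspace_UNIV l1(2)[of UNIV a] finB UNIV_I, of "\<lambda>b. tscale (\<beta> b c) b"]
      lin_on_sum[OF tens_vector_space tens.subspace_UNIV l1(1)[of UNIV a] finB UNIV_I, of "\<lambda>b. tscale (\<beta> b c) b"] exp[OF that] by simp_all
  have "w = (\<Sum>b\<in>B. ptens tscale [slice_right s (\<beta> b) w, b])"
    by (rule square_eqI[OF F(3) lin_on_id lin_on_sum_fun[OF tens_vector_space lin_on_comp[OF sl(1) UNIV_I l1(1)]]])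
      (use F(2) sum2 in \<open>auto simp: slice_ptens[OF \<beta>] ptens_add2 subset_iff\<close>)
  moreover have "w = (\<Sum>b\<in>B. ptens tscale [b, slice_left s (\<beta> b) w])"
    by (rule square_eqI[OF F(3) lin_on_id lin_on_sum_fun[OF tens_vector_space lin_on_comp[OF sl(2) UNIV_I l1(2)]]])
      (use F(2) sum2 in \<open>auto simp: slice_ptens[OF \<beta>] ptens_add2 subset_iff\<close>)
  ultimately show ?thesis using finB BT \<beta> by blast
qed

text \<open>
  This is \<open>(C \<otimes> T) \<inter> (T \<otimes> C') = C \<otimes> C'\<close>, with membership of \<open>w\<close> in either side tested on slices. The
  test by slices is compatible with intersections of subspaces, which is what the definition of
  \<open>(qA\<^sup>+)\<^sup>\<exclamdown>\<close> calls for.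
\<close>

lemma slice_criterion:
  fixes w :: "('k::field, ('k, 'v::ab_group_add) tens) tens"
  assumes w: "w \<in> T2 s" and C: "tens.subspace C" "C \<subseteq> tensor_algebra s" and C': "tens.subspace C'" "C' \<subseteq> tensor_algebra s"
    and right: "\<And>\<beta>. lin_on UNIV tscale (*) \<beta> \<Longrightarrow> slice_right s \<beta> w \<in> C"
    and left: "\<And>\<beta>. lin_on UNIV tscale (*) \<beta> \<Longrightarrow> slice_left s \<beta> w \<in> C'"
  shows "w \<in> tens.span {ptens tscale [a, b] | a b. a \<in> C \<and> b \<in> C'}" (is "w \<in> ?S")
proof -
  obtain B \<beta> where B: "B \<subseteq> tensor_algebra s" "\<And>b. lin_on UNIV tscale (*) (\<beta> b)"
    "w = (\<Sum>b\<in>B. ptens tscale [slice_right s (\<beta> b) w, b])" "w = (\<Sum>b\<in>B. ptens tscale [b, slice_left s (\<beta> b) w])"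
    using slice_expansion[OF w] by blast
  obtain P where P: "Vector_Spaces.linear tscale tscale P" "\<And>x. P x \<in> C" "\<And>x. x \<in> C \<Longrightarrow> P x = x"
    using subspace_projection[OF tens_vector_space C(1)] by blast
  obtain P' where P': "Vector_Spaces.linear tscale tscale P'" "\<And>x. P' x \<in> C'" "\<And>x. x \<in> C' \<Longrightarrow> P' x = x"
    using subspace_projection[OF tens_vector_space C'(1)] by blast
  let ?\<iota> = "\<lambda>f a. ptens tscale [f a]" and ?tf = "tensor_fun tscale (tensor_algebra s) tscale"
  have h: "tens_hom (tensor_algebra s) tscale tscale (?\<iota> P)" "tens_hom (tensor_algebra s) tscale tscale (?\<iota> P')"
    "tens_hom (tensor_algebra s) tscale tscale (?\<iota> (\<lambda>x. x))"
    by (rule T_tens_hom_ptens1 linear_lin_on[OF P(1)] linear_lin_on[OF P'(1)] lin_on_id)+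
  have rC: "slice_right s (\<beta> b) w \<in> C" "slice_left s (\<beta> b) w \<in> C'" for b using right left B(2) by blast+
  have sum: "f w = (\<Sum>b\<in>B. f (ptens tscale [slice_right s (\<beta> b) w, b]))" "f w = (\<Sum>b\<in>B. f (ptens tscale [b, slice_left s (\<beta> b) w]))"
    if f: "lin_on (T2 s) tscale tscale f" for f :: "_ \<Rightarrow> ('k, ('k, 'v) tens) tens"
  proof -
    have fin: "f (\<Sum>b\<in>B. g b) = (\<Sum>b\<in>B. f (g b))" if "\<And>b. b \<in> B \<Longrightarrow> g b \<in> T2 s" for g
      by (cases "finite B") (use that lin_on_sum[OF tens_vector_space tensor_power_subspace f] lin_on_zero[OF f tens.subspace_0[OF tensor_power_subspace]] in auto)
    show "f w = (\<Sum>b\<in>B. f (ptens tscale [slice_right s (\<beta> b) w, b]))"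
      by (subst B(3), rule fin, rule ptens_tensor_power_2) (use B(1) rC C in blast)+
    show "f w = (\<Sum>b\<in>B. f (ptens tscale [b, slice_left s (\<beta> b) w]))"
      by (subst B(4), rule fin, rule ptens_tensor_power_2) (use B(1) rC C' in blast)+
  qed
  \<comment> \<open>\<open>P \<otimes> P'\<close> projects onto \<open>C \<otimes> C'\<close>; it fixes \<open>w\<close>, as each expansion of \<open>w\<close> into slices shows for
    one of the two factors\<close>
  have "?tf (?\<iota> P) (?\<iota> P') w = ?tf (?\<iota> (\<lambda>x. x)) (?\<iota> P') w"
    unfolding sum(1)[OF tensor_fun_lin[OF h(1,2)]] sum(1)[OF tensor_fun_lin[OF h(3,2)]]
  proof (rule sum.cong[OF refl])
    fix b assume "b \<in> B"
    then have "b \<in> tensor_algebra s" "slice_right s (\<beta> b) w \<in> tensor_algebra s" using B(1) rC C by blast+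
    then show "?tf (?\<iota> P) (?\<iota> P') (ptens tscale [slice_right s (\<beta> b) w, b]) =
      ?tf (?\<iota> (\<lambda>x. x)) (?\<iota> P') (ptens tscale [slice_right s (\<beta> b) w, b])"
      by (simp add: tensor_fun_ptens[OF h(1,2)] tensor_fun_ptens[OF h(3,2)] P(3)[OF rC(1)])
  qed
  also have "\<dots> = w"
  proof -
    have "?tf (?\<iota> (\<lambda>x. x)) (?\<iota> P') w = (\<Sum>b\<in>B. ptens tscale [b, slice_left s (\<beta> b) w])"
      unfolding sum(2)[OF tensor_fun_lin[OF h(3,2)]]
    proof (rule sum.cong[OF refl])
      fix b assume "b \<in> B"
      then have "b \<in> tensor_algebra s" "slice_left s (\<beta> b) w \<in> tensor_algebra s" using B(1) rC C' by blast+
      then show "?tf (?\<iota> (\<lambda>x. x)) (?\<iota> P') (ptens tscale [b, slice_left s (\<beta> b) w]) = ptens tscale [b, slice_left s (\<beta> b) w]"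
        by (simp add: tensor_fun_ptens[OF h(3,2)] P'(3)[OF rC(2)] tprod_ptens)
    qed
    then show ?thesis using B(4) by simp
  qed
  finally have eq: "?tf (?\<iota> P) (?\<iota> P') w = w" .
  have "?tf (?\<iota> P) (?\<iota> P') w \<in> ?S"
  proof (rule square_imageI[OF w tensor_fun_lin[OF h(1,2)] tens_vector_space tens.subspace_span])
    fix a b assume "a \<in> tensor_algebra s" "b \<in> tensor_algebra s"
    then show "?tf (?\<iota> P) (?\<iota> P') (ptens tscale [a, b]) \<in> ?S"
      using P(2) P'(2) by (auto simp: tensor_fun_ptens[OF h(1,2)] tprod_ptens intro!: tens.span_base)
  qed
  then show ?thesis by (simp add: eq)
qed

lemma slice_split_lin:
  assumes "lin_on UNIV tscale (*) \<beta>"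
  shows "lin_on (tensor_algebra s) tscale tscale (\<lambda>t. slice_right s \<beta> (split_at s p t))"
    "lin_on (tensor_algebra s) tscale tscale (\<lambda>t. slice_left s \<beta> (split_at s p t))"
  by (rule lin_on_comp[OF split_at_lin split_at_T2 slice_lin(1)[OF assms]], assumption)
    (rule lin_on_comp[OF split_at_lin split_at_T2 slice_lin(2)[OF assms]])

lemma slice_split_ptens:
  assumes "lin_on UNIV tscale (*) \<beta>"
  shows "slice_right s \<beta> (split_at s p (ptens s xs)) = tscale (\<beta> (ptens s (drop p xs))) (ptens s (take p xs))"
    "slice_left s \<beta> (split_at s p (ptens s xs)) = tscale (\<beta> (ptens s (take p xs))) (ptens s (drop p xs))"
  by (simp_all add: split_at_ptens slice_ptens[OF assms])

lemma slice_right_split_tprod: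
  assumes \<beta>: "lin_on UNIV tscale (*) \<beta>" and u: "u \<in> tensor_power s UNIV m"
  shows "slice_right s \<beta> (split_at s (m + j) (tprod s u (ptens s ys))) =
    tscale (\<beta> (ptens s (drop j ys))) (tprod s u (ptens s (take j ys)))"
proof (rule power_eqI[OF u])
  show "lin_on (tensor_power s UNIV m) tscale tscale (\<lambda>u. slice_right s \<beta> (split_at s (m + j) (tprod s u (ptens s ys))))"
    by (rule tensor_power_lin[OF lin_on_comp[OF tprod_lin_left _ slice_split_lin(1)[OF \<beta>]]]) (simp add: tprod_T)
  show "lin_on (tensor_power s UNIV m) tscale tscale (\<lambda>u. tscale (\<beta> (ptens s (drop j ys))) (tprod s u (ptens s (take j ys))))"
    by (rule lin_on_scaled[OF tens_vector_space tprod_lin_left])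
qed (simp add: tprod_ptens slice_split_ptens[OF \<beta>] words_def)

lemma slice_left_split_tprod:
  assumes \<beta>: "lin_on UNIV tscale (*) \<beta>" and u: "u \<in> tensor_algebra s" and p: "p \<le> length zs"
  shows "slice_left s \<beta> (split_at s p (tprod s (ptens s zs) u)) =
    tscale (\<beta> (ptens s (take p zs))) (tprod s (ptens s (drop p zs)) u)"
proof (rule T_eqI[OF u])
  show "lin_on (tensor_algebra s) tscale tscale (\<lambda>u. slice_left s \<beta> (split_at s p (tprod s (ptens s zs) u)))"
    by (rule lin_on_comp[OF tprod_lin_right _ slice_split_lin(2)[OF \<beta>]]) (simp_all add: tprod_T)
  show "lin_on (tensor_algebra s) tscale tscale (\<lambda>u. tscale (\<beta> (ptens s (take p zs))) (tprod s (ptens s (drop p zs)) u))"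
    by (rule lin_on_scaled[OF tens_vector_space tprod_lin_right]) simp
qed (use p in \<open>simp add: tprod_ptens slice_split_ptens[OF \<beta>]\<close>)

text \<open>
  \<open>V\<^sup>\<otimes>\<^sup>i \<otimes> R' \<otimes> V\<^sup>\<otimes>\<^sup>j\<close> inside \<open>V\<^sup>\<otimes>\<^sup>i\<^sup>+\<^sup>2\<^sup>+\<^sup>j\<close>.
\<close>

abbreviation rel_space where
  "rel_space s R i j \<equiv> tens.span {tprod s (tprod s x r) y | x r y.
       x \<in> tensor_power s UNIV i \<and> r \<in> R_assoc s R \<and> y \<in> tensor_power s UNIV j}"

lemma koszul_power: "t \<in> assoc_koszul_gr s R n \<Longrightarrow> t \<in> tensor_power s UNIV n"
  by (simp add: assoc_koszul_gr_def)

lemma koszul_rel: "t \<in> assoc_koszul_gr s R n \<Longrightarrow> i + 2 + j = n \<Longrightarrow> t \<in> rel_space s R i j"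
  by (simp add: assoc_koszul_gr_def)

lemma koszulI:
  "t \<in> tensor_power s UNIV n \<Longrightarrow> (\<And>i j. i + 2 + j = n \<Longrightarrow> t \<in> rel_space s R i j) \<Longrightarrow> t \<in> assoc_koszul_gr s R n"
  by (simp add: assoc_koszul_gr_def)

lemma koszul_subspace: "tens.subspace (assoc_koszul_gr s R n)"
  by (rule tens.subspaceI)
    (auto intro!: koszulI intro: tens.subspace_0[OF tensor_power_subspace] tens.span_zero
      tens.subspace_add[OF tensor_power_subspace] tens.span_add tens.subspace_scale[OF tensor_power_subspace] tens.span_scale
      dest: koszul_power koszul_rel)

lemma R_assoc_power: "r \<in> R_assoc s R \<Longrightarrow> r \<in> tensor_power s UNIV 2"
  by (simp add: R_assoc_def)

text \<open>
  Contracting the last \<open>q\<close> factors does not touch a relation that sits among the first \<open>p\<close> factors.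
\<close>

lemma koszul_slice_right:
  fixes s :: "'k::field \<Rightarrow> 'v::ab_group_add \<Rightarrow> 'v"
  assumes t: "t \<in> assoc_koszul_gr s R (p + q)" and \<beta>: "lin_on UNIV tscale (*) \<beta>"
  shows "slice_right s \<beta> (split_at s p t) \<in> assoc_koszul_gr s R p"
proof (rule koszulI)
  note lin = slice_split_lin(1)[OF \<beta>]
  show "slice_right s \<beta> (split_at s p t) \<in> tensor_power s UNIV p"
    by (rule power_imageI[OF koszul_power[OF t] tensor_power_lin[OF lin] tens_vector_space tensor_power_subspace])
      (auto simp: slice_split_ptens[OF \<beta>] words_def intro!: tens.subspace_scale[OF tensor_power_subspace] ptens_tensor_power)
  fix i j assume ij: "i + 2 + j = p"
  have rel: "t \<in> rel_space s R i (j + q)" by (rule koszul_rel[OF t]) (use ij in simp)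
  have gT: "tprod s (tprod s x r) y \<in> tensor_algebra s" if "x \<in> tensor_power s UNIV i" "r \<in> R_assoc s R" "y \<in> tensor_power s UNIV (j + q)" for x r y
    using that by (intro tprod_T) (auto intro: tensor_power_T R_assoc_power)
  have sub: "rel_space s R i (j + q) \<subseteq> tensor_algebra s" by (rule tens.span_minimal[OF _ T_subspace]) (use gT in auto)
  show "slice_right s \<beta> (split_at s p t) \<in> rel_space s R i j"
  proof (rule lin_on_image_span[OF tens_vector_space lin_on_subset[OF lin sub] tens_vector_space tens.subspace_span _ rel])
    fix z assume "z \<in> {tprod s (tprod s x r) y | x r y. x \<in> tensor_power s UNIV i \<and> r \<in> R_assoc s R \<and> y \<in> tensor_power s UNIV (j + q)}"
    then obtain x r y where z: "z = tprod s (tprod s x r) y" and xry: "x \<in> tensor_power s UNIV i" "r \<in> R_assoc s R" "y \<in> tensor_power s UNIV (j + q)"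
      by blast
    have u: "tprod s x r \<in> tensor_power s UNIV (i + 2)" by (rule tprod_tensor_power[OF xry(1) R_assoc_power[OF xry(2)]])
    show "slice_right s \<beta> (split_at s p z) \<in> rel_space s R i j"
      unfolding z
    proof (rule power_imageI[OF xry(3) _ tens_vector_space tens.subspace_span])
      show "lin_on (tensor_power s UNIV (j + q)) tscale tscale (\<lambda>y. slice_right s \<beta> (split_at s p (tprod s (tprod s x r) y)))"
        by (rule tensor_power_lin[OF lin_on_comp[OF tprod_lin_right _ lin]]) (auto intro: tprod_T tensor_power_T[OF u])
      fix ys :: "'v list" assume "ys \<in> words UNIV (j + q)"
      then have "ptens s (take j ys) \<in> tensor_power s UNIV j" by (intro ptens_tensor_power) (auto simp: words_def)
      then have "tprod s (tprod s x r) (ptens s (take j ys)) \<in> rel_space s R i j" using xry by (intro tens.span_base) blast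
      then show "slice_right s \<beta> (split_at s p (tprod s (tprod s x r) (ptens s ys))) \<in> rel_space s R i j"
        unfolding slice_right_split_tprod[OF \<beta> u, of j, unfolded ij] by (rule tens.span_scale)
    qed
  qed
qed

lemma koszul_slice_left:
  fixes s :: "'k::field \<Rightarrow> 'v::ab_group_add \<Rightarrow> 'v"
  assumes t: "t \<in> assoc_koszul_gr s R (p + q)" and \<beta>: "lin_on UNIV tscale (*) \<beta>"
  shows "slice_left s \<beta> (split_at s p t) \<in> assoc_koszul_gr s R q"
proof (rule koszulI)
  note lin = slice_split_lin(2)[OF \<beta>]
  show "slice_left s \<beta> (split_at s p t) \<in> tensor_power s UNIV q"
    by (rule power_imageI[OF koszul_power[OF t] tensor_power_lin[OF lin] tens_vector_space tensor_power_subspace])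
      (auto simp: slice_split_ptens[OF \<beta>] words_def intro!: tens.subspace_scale[OF tensor_power_subspace] ptens_tensor_power)
  fix i j assume ij: "i + 2 + j = q"
  have rel: "t \<in> rel_space s R (p + i) j" by (rule koszul_rel[OF t]) (use ij in simp)
  have gT: "tprod s (tprod s x r) y \<in> tensor_algebra s" if "x \<in> tensor_power s UNIV (p + i)" "r \<in> R_assoc s R" "y \<in> tensor_power s UNIV j" for x r y
    using that by (intro tprod_T) (auto intro: tensor_power_T R_assoc_power)
  have sub: "rel_space s R (p + i) j \<subseteq> tensor_algebra s" by (rule tens.span_minimal[OF _ T_subspace]) (use gT in auto)
  show "slice_left s \<beta> (split_at s p t) \<in> rel_space s R i j"
  proof (rule lin_on_image_span[OF tens_vector_space lin_on_subset[OF lin sub] tens_vector_space tens.subspace_span _ rel])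
    fix z assume "z \<in> {tprod s (tprod s x r) y | x r y. x \<in> tensor_power s UNIV (p + i) \<and> r \<in> R_assoc s R \<and> y \<in> tensor_power s UNIV j}"
    then obtain x r y where z: "z = tprod s (tprod s x r) y" and xry: "x \<in> tensor_power s UNIV (p + i)" "r \<in> R_assoc s R" "y \<in> tensor_power s UNIV j"
      by blast
    have yT: "y \<in> tensor_algebra s" "r \<in> tensor_algebra s" using xry(2,3) tensor_power_T R_assoc_power by blast+
    have u: "tprod s r y \<in> tensor_algebra s" using yT by (simp add: tprod_T)
    show "slice_left s \<beta> (split_at s p z) \<in> rel_space s R i j"
      unfolding z tprod_assoc[OF yT(1)]
    proof (rule power_imageI[OF xry(1) _ tens_vector_space tens.subspace_span])
      show "lin_on (tensor_power s UNIV (p + i)) tscale tscale (\<lambda>x. slice_left s \<beta> (split_at s p (tprod s x (tprod s r y))))"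
        by (rule tensor_power_lin[OF lin_on_comp[OF tprod_lin_left _ lin]]) (rule tprod_T[OF _ u])
      fix zs :: "'v list" assume "zs \<in> words UNIV (p + i)"
      then have zs: "p \<le> length zs" "ptens s (drop p zs) \<in> tensor_power s UNIV i"
        by (auto simp: words_def intro!: ptens_tensor_power)
      then have "tprod s (tprod s (ptens s (drop p zs)) r) y \<in> rel_space s R i j" using xry by (intro tens.span_base) blast
      then show "slice_left s \<beta> (split_at s p (tprod s (ptens s zs) (tprod s r y))) \<in> rel_space s R i j"
        unfolding slice_left_split_tprod[OF \<beta> u zs(1)] tprod_assoc[OF yT(1)] by (rule tens.span_scale)
    qed
  qed
qed

lemma koszul_simps [simp]:
  "scl (assoc_koszul_dual s R) = tscale" "comult (assoc_koszul_dual s R) = deconcat s"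
  "gr (assoc_koszul_dual s R) i = (if i < 0 then {0} else assoc_koszul_gr s R (nat i))"
  "counit (assoc_koszul_dual s R) = counit (tensor_coalg s)"
  by (simp_all add: assoc_koszul_dual_def tensor_coalg_def)

lemma koszul_graded: "graded_space (assoc_koszul_dual s R)"
  by (rule graded_space_sub[OF tensor_coalg_graded[of s]])
    (auto simp: koszul_power koszul_subspace tens.subspace_single_0)

lemma koszul_carr_T: "x \<in> carr (assoc_koszul_dual s R) \<Longrightarrow> x \<in> tensor_algebra s"
  by (rule carr_imageI[OF koszul_graded, where F = "\<lambda>x. x" and s' = tscale])
    (auto simp: lin_on_id tens_vector_space T_subspace T_zero tensor_power_T[OF koszul_power] split: if_splits)

text \<open>
  All slices of the component in \<open>V\<^sup>\<otimes>\<^sup>p \<otimes> V\<^sup>\<otimes>\<^sup>q\<close> satisfy the relations, so this component lies in the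
  tensor product of the Koszul duals.
\<close>

lemma koszul_deconcat:
  assumes t: "t \<in> assoc_koszul_gr s R n"
  shows "deconcat s t \<in> square_gr (assoc_koszul_dual s R) (int n)"
proof -
  have "split_at s p t \<in> square_gr (assoc_koszul_dual s R) (int n)" if p: "p \<le> n" for p
  proof -
    define q where "q = n - p"
    have n: "n = p + q" using p by (simp add: q_def)
    have "split_at s p t \<in> tens.span {ptens tscale [a, b] | a b. a \<in> assoc_koszul_gr s R p \<and> b \<in> assoc_koszul_gr s R q}"
    proof (rule slice_criterion)
      show "split_at s p t \<in> T2 s" by (rule split_at_T2[OF tensor_power_T[OF koszul_power[OF t]]])
      show "assoc_koszul_gr s R p \<subseteq> tensor_algebra s" "assoc_koszul_gr s R q \<subseteq> tensor_algebra s"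
        using tensor_power_T koszul_power by blast+
    qed (use koszul_slice_right koszul_slice_left t n koszul_subspace in blast)+
    moreover have "{ptens tscale [a, b] | a b. a \<in> assoc_koszul_gr s R p \<and> b \<in> assoc_koszul_gr s R q}
      \<subseteq> square_gr (assoc_koszul_dual s R) (int n)"
      using ptens_square_gr[of _ "assoc_koszul_dual s R" "int p" _ "int q" "int n"] n by auto
    ultimately show ?thesis using tens.span_minimal[OF _ square_gr_subspace] by blast
  qed
  then show ?thesis
    unfolding deconcat_split[OF koszul_power[OF t]] by (intro tens.subspace_sum[OF square_gr_subspace]) auto
qed

lemma koszul_cop: "gr_cop (assoc_koszul_dual s R) (comult (assoc_koszul_dual s R))"
proof -
  have "lin_on (carr (assoc_koszul_dual s R)) tscale tscale (deconcat s)"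
    by (rule lin_on_subset[OF deconcat_lin]) (auto simp: koszul_carr_T)
  moreover have "deconcat s 0 = 0" by (rule lin_on_zero[OF deconcat_lin T_zero])
  moreover have "deconcat s x \<in> square_gr (assoc_koszul_dual s R) i"
    if "\<not> i < 0" "x \<in> assoc_koszul_gr s R (nat i)" for x i
    using koszul_deconcat[OF that(2)] that(1) by simp
  ultimately show ?thesis
    using koszul_graded tens.subspace_0[OF square_gr_subspace] by (auto simp: gr_cop_def)
qed

lemma koszul_restrict:
  assumes "tens_hom (tensor_algebra s) tscale s' f" "tens_hom (tensor_algebra s) tscale s' g" "x \<in> carr (assoc_koszul_dual s R)"
  shows "tensor_fun tscale (carr (assoc_koszul_dual s R)) s' f g (deconcat s x) = tensor_fun tscale (tensor_algebra s) s' f g (deconcat s x)"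
  by (rule tensor_fun_restrict[OF assms(1,2)])
    (use carr_subspace[OF koszul_graded, of s R] koszul_carr_T gr_cop_power[OF koszul_cop assms(3)] in auto)

lemma koszul_coalgebra: "graded_coalgebra (assoc_koszul_dual s R)"
proof -
  have h: "tens_hom (tensor_algebra s) tscale tscale (deconcat s)"
    by (simp add: tens_hom_def tens_vector_space T_subspace deconcat_lin tensor_power_T[OF deconcat_T2])
  have i: "tens_hom (tensor_algebra s) tscale tscale (\<lambda>a. ptens tscale [a])"
    by (rule T_tens_hom_ptens1[OF lin_on_id])
  have eps0: "counit (tensor_coalg s) x = 0" if "x \<in> assoc_koszul_gr s R n" "n \<noteq> 0" for x n
    by (rule power_eqI[OF koszul_power[OF that(1)] counit_lin, of "\<lambda>_. 0"])
      (use that(2) in \<open>auto simp: counit_ptens words_def lin_on_def\<close>)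
  have ep: "tens_hom (tensor_algebra s) tscale tscale (\<lambda>a. eps (tensor_coalg s) tscale a)" by (rule eps_hom)
  note cop = koszul_cop[of s R]
  have 1: "linear_on (assoc_koszul_dual s R) tscale (comult (assoc_koszul_dual s R))"
    "\<forall>i. comult (assoc_koszul_dual s R) ` gr (assoc_koszul_dual s R) i \<subseteq> square_gr (assoc_koszul_dual s R) i"
    using cop unfolding gr_cop_def linear_on_iff by auto
  have 2: "linear_on (assoc_koszul_dual s R) (*) (counit (assoc_koszul_dual s R))"
    unfolding linear_on_iff using counit_lin by simp
  have 3: "counit (assoc_koszul_dual s R) x = 0" if "i \<noteq> 0" "x \<in> gr (assoc_koszul_dual s R) i" for i x
    using that eps0[of x "nat i"] by (cases "i < 0") (auto simp del: tensor_coalg_simps simp: lin_on_zero[OF counit_lin UNIV_I])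
  then have 3: "\<forall>i x. i \<noteq> 0 \<and> x \<in> gr (assoc_koszul_dual s R) i \<longrightarrow> counit (assoc_koszul_dual s R) x = 0" by blast
  have 4: "tensor_fun tscale (carr (assoc_koszul_dual s R)) tscale (deconcat s) (\<lambda>a. ptens tscale [a]) (deconcat s x) =
      tensor_fun tscale (carr (assoc_koszul_dual s R)) tscale (\<lambda>a. ptens tscale [a]) (deconcat s) (deconcat s x)"
    "tensor_fun tscale (carr (assoc_koszul_dual s R)) tscale (\<lambda>a. eps (tensor_coalg s) tscale a) (\<lambda>a. ptens tscale [a]) (deconcat s x) = ptens tscale [x]"
    "tensor_fun tscale (carr (assoc_koszul_dual s R)) tscale (\<lambda>a. ptens tscale [a]) (\<lambda>a. eps (tensor_coalg s) tscale a) (deconcat s x) = ptens tscale [x]"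
    if x: "x \<in> carr (assoc_koszul_dual s R)" for x
    using deconcat_coassoc[OF koszul_carr_T[OF x]] deconcat_counit[OF koszul_carr_T[OF x]]
    by (simp_all only: koszul_restrict[OF h i x] koszul_restrict[OF i h x] koszul_restrict[OF ep i x] koszul_restrict[OF i ep x])
  show ?thesis
    unfolding graded_coalgebra_def Let_def
    using koszul_graded[of s R] 1 2 3 4 by (simp del: tensor_coalg_simps koszul_simps(3))
qed

section \<open>Convolution and coalgebra maps into the tensor coalgebra\<close>

text \<open>
  The convolution product on linear maps \<open>D \<rightarrow> T(V)\<close>. It is associative and unital, and turns the
  statements about coalgebra maps into \<open>T\<^sup>c(sV)\<close> into algebra.
\<close>

definition conv :: "('k::field, 'd::ab_group_add) coalg \<Rightarrow> ('k \<Rightarrow> 'v::ab_group_add \<Rightarrow> 'v) \<Rightarrow>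
    ('d \<Rightarrow> ('k, 'v) tens) \<Rightarrow> ('d \<Rightarrow> ('k, 'v) tens) \<Rightarrow> 'd \<Rightarrow> ('k, 'v) tens" where
  "conv D s f g x = tensor_fun (scl D) (carr D) s f g (comult D x)"

fun conv_pow where
  "conv_pow D s g 0 = (\<lambda>x. eps D s x)"
| "conv_pow D s g (Suc n) = conv D s g (conv_pow D s g n)"

lemma conv_cong:
  "(\<And>a. a \<in> carr D \<Longrightarrow> f a = f' a) \<Longrightarrow> (\<And>a. a \<in> carr D \<Longrightarrow> g a = g' a) \<Longrightarrow> conv D s f g = conv D s f' g'"
  unfolding conv_def by (intro ext) (simp add: tensor_fun_cong[of "carr D" f f' g g'])

lemma conv_pow_cong:
  assumes "\<And>a. a \<in> carr D \<Longrightarrow> g a = g' a" shows "conv_pow D s g n = conv_pow D s g' n"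
  by (induction n) (simp_all add: conv_cong[OF assms])

context
  fixes D :: "('k::field, 'd::ab_group_add) coalg" and s :: "'k \<Rightarrow> 'v::ab_group_add \<Rightarrow> 'v"
  assumes D: "graded_coalgebra D"
begin

lemmas comult_cop = graded_coalgebra_cop[OF D]
lemmas comult_facts = gr_copD[OF comult_cop]

abbreviation (input) conv_arg where "conv_arg f \<equiv> tens_hom (carr D) (scl D) s f"

lemma counit_facts: "lin_on (carr D) (scl D) (*) (counit D)" "\<And>x i. x \<in> gr D i \<Longrightarrow> i \<noteq> 0 \<Longrightarrow> counit D x = 0"
  using D unfolding graded_coalgebra_def Let_def linear_on_iff by blast+

lemma eps_arg: "tens_hom (carr D) (scl D) s' (\<lambda>x. eps D s' x)"
  by (rule tens_hom_carr[OF comult_facts(1)])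
    (auto simp: T_closed lin_on_def lin_on_add[OF counit_facts(1)] lin_on_scale[OF counit_facts(1)] tens.scale_left_distrib)

lemma conv_hom: assumes "conv_arg f" "conv_arg g" shows "conv_arg (conv D s f g)"
  unfolding conv_def
  by (rule tens_hom_carr[OF comult_facts(1) lin_on_comp[OF comult_facts(2) gr_cop_power[OF comult_cop] tensor_fun_lin[OF assms]]
        tensor_fun_T[OF assms gr_cop_power[OF comult_cop]]])

lemma conv_pow_hom: "conv_arg g \<Longrightarrow> conv_arg (conv_pow D s g n)"
  by (induction n) (simp_all add: eps_arg conv_hom)

lemma conv_imageI:
  assumes "conv_arg f" "conv_arg g" "tens.subspace X" "x \<in> carr D"
    "\<And>a b. a \<in> carr D \<Longrightarrow> b \<in> carr D \<Longrightarrow> tprod s (f a) (g b) \<in> X"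
  shows "conv D s f g x \<in> X"
  unfolding conv_def
  by (rule square_imageI[OF gr_cop_power[OF comult_cop assms(4)] tensor_fun_lin[OF assms(1,2)] tens_vector_space assms(3)])
    (simp add: tensor_fun_ptens[OF assms(1,2)] assms(5))

text \<open>
  Both sides are the map \<open>a \<otimes> b \<otimes> c \<mapsto> f a \<otimes> g b \<otimes> h c\<close> applied to the two equal forms of the twofold
  coproduct.
\<close>

lemma conv_assoc:
  assumes f: "conv_arg f" and g: "conv_arg g" and h: "conv_arg h" and x: "x \<in> carr D"
  shows "conv D s (conv D s f g) h x = conv D s f (conv D s g h) x"
proof -
  note vs = graded_space_vs[OF comult_facts(1)] carr_subspace[OF comult_facts(1)]
  let ?P2 = "tensor_power (scl D) (carr D) 2" and ?P3 = "tensor_power (scl D) (carr D) 3"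
  let ?\<iota> = "\<lambda>a. ptens (scl D) [a]"
  have i: "tens_hom (carr D) (scl D) (scl D) ?\<iota>" by (rule tens_hom_carr_id[OF comult_facts(1)])
  note d = gr_cop_hom[OF comult_cop]
  note fg = conv_hom[OF f g] and gh = conv_hom[OF g h]
  define B where "B a b c = tprod s (tprod s (f a) (g b)) (h c)" for a b c
  have ext: "extendable (scl D) (words (carr D) 3) (\<lambda>xs. B (xs ! 0) (xs ! 1) (xs ! 2))"
  proof (rule extendable_3[OF vs])
    fix b c assume "b \<in> carr D" "c \<in> carr D"
    show "lin_on (carr D) (scl D) tscale (\<lambda>a. B a b c)"
      unfolding B_def by (rule lin_on_comp[OF tens_homD(3)[OF f] UNIV_I lin_on_comp[OF tprod_lin_left UNIV_I tprod_lin_left]])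
  next
    fix a c assume a: "a \<in> carr D" and c: "c \<in> carr D"
    show "lin_on (carr D) (scl D) tscale (\<lambda>b. B a b c)"
      unfolding B_def
      by (rule lin_on_comp[OF tens_homD(3)[OF g] tens_homD(4)[OF g] lin_on_comp[OF tprod_lin_right[OF tens_homD(4)[OF f a]] UNIV_I tprod_lin_left]])
  next
    fix a b assume a: "a \<in> carr D" and b: "b \<in> carr D"
    show "lin_on (carr D) (scl D) tscale (\<lambda>c. B a b c)"
      unfolding B_def
      by (rule lin_on_comp[OF tens_homD(3)[OF h] tens_homD(4)[OF h] tprod_lin_right[OF tprod_T[OF tens_homD(4)[OF f a] tens_homD(4)[OF g b]]]])
  qed
  define \<Phi> where "\<Phi> = tlift (scl D) (words (carr D) 3) (\<lambda>xs. B (xs ! 0) (xs ! 1) (xs ! 2))"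
  have \<Phi>: "lin_on ?P3 tscale tscale \<Phi>" unfolding \<Phi>_def tensor_power_def by (rule tlift_lin[OF ext])
  have \<Phi>p: "\<Phi> (ptens (scl D) [a, b, c]) = B a b c" if "a \<in> carr D" "b \<in> carr D" "c \<in> carr D" for a b c
    using tlift_ptens[OF ext, of "[a, b, c]"] that by (simp add: \<Phi>_def words_3 numeral_2_eq_2)
  have left: "\<Phi> (tprod (scl D) z (?\<iota> c)) = tprod s (tensor_fun (scl D) (carr D) s f g z) (h c)" if z: "z \<in> ?P2" and c: "c \<in> carr D" for z c
    by (rule square_eqI[OF z lin_on_comp[OF tprod_lin_left tprod_power_3(1)[OF _ c] \<Phi>]
          lin_on_comp[OF tensor_fun_lin[OF f g] UNIV_I tprod_lin_left]])
      (use c in \<open>simp_all add: tprod_ptens \<Phi>p tensor_fun_ptens[OF f g] B_def\<close>)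
  have right: "\<Phi> (tprod (scl D) (?\<iota> a) z) = tprod s (f a) (tensor_fun (scl D) (carr D) s g h z)" if z: "z \<in> ?P2" and a: "a \<in> carr D" for z a
  proof (rule square_eqI[OF z])
    have "lin_on ?P2 tscale tscale (tprod (scl D) (?\<iota> a))"
      by (rule lin_on_subset[OF tprod_lin_right]) (auto simp: tensor_power_T)
    then show "lin_on ?P2 tscale tscale (\<lambda>z. \<Phi> (tprod (scl D) (?\<iota> a) z))"
      by (rule lin_on_comp[OF _ tprod_power_3(2)[OF _ a] \<Phi>])
    show "lin_on ?P2 tscale tscale (\<lambda>z. tprod s (f a) (tensor_fun (scl D) (carr D) s g h z))"
      by (rule lin_on_comp[OF tensor_fun_lin[OF g h] tensor_fun_T[OF g h] tprod_lin_right[OF tens_homD(4)[OF f a]]])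
    fix b c assume "b \<in> carr D" "c \<in> carr D"
    then show "\<Phi> (tprod (scl D) (?\<iota> a) (ptens (scl D) [b, c])) = tprod s (f a) (tensor_fun (scl D) (carr D) s g h (ptens (scl D) [b, c]))"
      using a by (simp add: tprod_ptens \<Phi>p tensor_fun_ptens[OF g h] B_def tprod_assoc[OF tens_homD(4)[OF h]])
  qed
  have L: "\<Phi> (tensor_fun (scl D) (carr D) (scl D) (comult D) ?\<iota> y) = tensor_fun (scl D) (carr D) s (conv D s f g) h y" if "y \<in> ?P2" for y
    by (rule square_eqI[OF that lin_on_comp[OF tensor_fun_lin[OF d i] gr_cop_left_power[OF comult_cop] \<Phi>] tensor_fun_lin[OF fg h]])
      (simp_all add: tensor_fun_ptens[OF d i] tensor_fun_ptens[OF fg h] left gr_cop_power[OF comult_cop] conv_def)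
  have Rr: "\<Phi> (tensor_fun (scl D) (carr D) (scl D) ?\<iota> (comult D) y) = tensor_fun (scl D) (carr D) s f (conv D s g h) y" if "y \<in> ?P2" for y
    by (rule square_eqI[OF that lin_on_comp[OF tensor_fun_lin[OF i d] gr_cop_right_power[OF comult_cop] \<Phi>] tensor_fun_lin[OF f gh]])
      (simp_all add: tensor_fun_ptens[OF i d] tensor_fun_ptens[OF f gh] right gr_cop_power[OF comult_cop] conv_def)
  have "tensor_fun (scl D) (carr D) (scl D) (comult D) ?\<iota> (comult D x) = tensor_fun (scl D) (carr D) (scl D) ?\<iota> (comult D) (comult D x)"
    using D x unfolding graded_coalgebra_def Let_def by blast
  then show ?thesis using L[OF gr_cop_power[OF comult_cop x]] Rr[OF gr_cop_power[OF comult_cop x]] by (simp add: conv_def)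
qed

lemma conv_unit:
  assumes h: "conv_arg h" and x: "x \<in> carr D"
  shows "conv D s (\<lambda>x. eps D s x) h x = h x" "conv D s h (\<lambda>x. eps D s x) x = h x"
proof -
  note vs = graded_space_vs[OF comult_facts(1)] carr_subspace[OF comult_facts(1)]
  let ?\<iota> = "\<lambda>a. ptens (scl D) [a]" and ?\<epsilon> = "\<lambda>x. eps D (scl D) x"
  let ?P1 = "tensor_power (scl D) (carr D) 1"
  have i: "tens_hom (carr D) (scl D) (scl D) ?\<iota>" by (rule tens_hom_carr_id[OF comult_facts(1)])
  note e = eps_arg[of "scl D"] and e' = eps_arg[of s]
  have ext: "extendable (scl D) (words (carr D) 1) (\<lambda>xs. h (xs ! 0))"
    by (rule extendable_words[OF vs]) (simp add: multilin_on_def tens_homD(3)[OF h])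
  define \<Psi> where "\<Psi> = tlift (scl D) (words (carr D) 1) (\<lambda>xs. h (xs ! 0))"
  have \<Psi>: "lin_on ?P1 tscale tscale \<Psi>" unfolding \<Psi>_def tensor_power_def by (rule tlift_lin[OF ext])
  have \<Psi>p: "\<Psi> (ptens (scl D) [a]) = h a" if "a \<in> carr D" for a
    using tlift_ptens[OF ext, of "[a]"] that by (simp add: \<Psi>_def words_def)
  have p1: "tscale c (?\<iota> b) \<in> ?P1" if "b \<in> carr D" for b c
    by (rule tens.subspace_scale[OF tensor_power_subspace ptens1_power[OF that]])
  have P1: "tensor_fun (scl D) (carr D) (scl D) ?\<epsilon> ?\<iota> y \<in> ?P1" "tensor_fun (scl D) (carr D) (scl D) ?\<iota> ?\<epsilon> y \<in> ?P1"
    if "y \<in> tensor_power (scl D) (carr D) 2" for y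
    by (rule square_imageI[OF that tensor_fun_lin[OF e i] tens_vector_space tensor_power_subspace],
        use p1 in \<open>simp add: tensor_fun_ptens[OF e i] tprod_scale_left tprod_ptens\<close>)
      (rule square_imageI[OF that tensor_fun_lin[OF i e] tens_vector_space tensor_power_subspace],
        use p1 in \<open>simp add: tensor_fun_ptens[OF i e] tprod_scale_right tprod_ptens\<close>)
  have "\<Psi> (tensor_fun (scl D) (carr D) (scl D) ?\<epsilon> ?\<iota> y) = tensor_fun (scl D) (carr D) s (\<lambda>x. eps D s x) h y"
    "\<Psi> (tensor_fun (scl D) (carr D) (scl D) ?\<iota> ?\<epsilon> y) = tensor_fun (scl D) (carr D) s h (\<lambda>x. eps D s x) y"
    if y: "y \<in> tensor_power (scl D) (carr D) 2" for y
    by (rule square_eqI[OF y lin_on_comp[OF tensor_fun_lin[OF e i] P1(1) \<Psi>] tensor_fun_lin[OF e' h]],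
        assumption, simp add: tensor_fun_ptens[OF e i] tensor_fun_ptens[OF e' h] tprod_scale_left tprod_ptens
          lin_on_scale[OF \<Psi> ptens1_power] \<Psi>p tprod_one_left tens_homD(4)[OF h])
      (rule square_eqI[OF y lin_on_comp[OF tensor_fun_lin[OF i e] P1(2) \<Psi>] tensor_fun_lin[OF h e']],
        assumption, simp add: tensor_fun_ptens[OF i e] tensor_fun_ptens[OF h e'] tprod_scale_right tprod_ptens
          lin_on_scale[OF \<Psi> ptens1_power] \<Psi>p tprod_one_right tens_homD(4)[OF h])
  note eq = this[OF gr_cop_power[OF comult_cop x]]
  have "tensor_fun (scl D) (carr D) (scl D) ?\<epsilon> ?\<iota> (comult D x) = ?\<iota> x" "tensor_fun (scl D) (carr D) (scl D) ?\<iota> ?\<epsilon> (comult D x) = ?\<iota> x"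
    using D x unfolding graded_coalgebra_def Let_def by blast+
  then show "conv D s (\<lambda>x. eps D s x) h x = h x" "conv D s h (\<lambda>x. eps D s x) x = h x"
    using eq \<Psi>p[OF x] by (simp_all add: conv_def)
qed

lemma conv_pow_add:
  assumes g: "conv_arg g" and x: "x \<in> carr D"
  shows "conv_pow D s g (p + q) x = conv D s (conv_pow D s g p) (conv_pow D s g q) x"
  using x
proof (induction p arbitrary: x)
  case 0
  then show ?case by (simp add: conv_unit(1)[OF conv_pow_hom[OF g]])
next
  case (Suc p)
  have "conv_pow D s g (Suc p + q) x = conv D s g (conv D s (conv_pow D s g p) (conv_pow D s g q)) x"
    using conv_cong[of D g g "conv_pow D s g (p + q)"] Suc.IH by simp
  also have "\<dots> = conv D s (conv_pow D s g (Suc p)) (conv_pow D s g q) x"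
    using conv_assoc[OF g conv_pow_hom[OF g] conv_pow_hom[OF g] Suc.prems] by simp
  finally show ?case .
qed

lemma conv_pow_1: "conv_arg g \<Longrightarrow> x \<in> carr D \<Longrightarrow> conv_pow D s g 1 x = g x"
  by (simp add: conv_unit(2))

lemma conv_pow_2: "conv_arg g \<Longrightarrow> x \<in> carr D \<Longrightarrow> conv_pow D s g 2 x = conv D s g g x"
  using conv_cong[of D g g "conv_pow D s g 1" g] conv_pow_1 by (simp add: numeral_2_eq_2)

lemma tensor_proj_0: "t \<in> tensor_algebra s \<Longrightarrow> tensor_proj s 0 t = eps (tensor_coalg s) s t"
  by (rule T_eqI[OF _ tensor_proj_lin tens_homD(3)[OF eps_hom]]) (auto simp: tensor_proj_ptens counit_ptens)

text \<open>
  On the tensor coalgebra the projection to \<open>V\<^sup>\<otimes>\<^sup>1\<^sup>+\<^sup>n\<close> is the convolution of those to \<open>V\<close> and \<open>V\<^sup>\<otimes>\<^sup>n\<close>, and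
  composition with a coalgebra morphism preserves convolution.
\<close>

lemma coalg_morphism_proj:
  assumes F: "coalg_morphism D (assoc_koszul_dual s R) F" and x: "x \<in> carr D"
  shows "tensor_proj s n (F x) = conv_pow D s (\<lambda>a. tensor_proj s 1 (F a)) n x"
  using x
proof (induction n arbitrary: x)
  note F' = coalg_morphismD[OF F]
  note vs = graded_space_vs[OF comult_facts(1)] carr_subspace[OF comult_facts(1)]
  have FT: "F x \<in> tensor_algebra s" if "x \<in> carr D" for x
    by (rule koszul_carr_T[OF graded_map_carr[OF F'(1) comult_facts(1) koszul_graded that]])
  have Fl: "lin_on (carr D) (scl D) tscale F" using graded_mapD(1)[OF F'(1)] by simp
  {
    case 0
    then show ?case using F'(3)[OF 0] by (simp add: tensor_proj_0 FT)
  next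
    case (Suc n)
    have "tensor_proj s (Suc n) (F x) = tensor_fun tscale (tensor_algebra s) s (tensor_proj s 1) (tensor_proj s n) (deconcat s (F x))"
      using proj_conv[OF FT[OF Suc.prems], of 1 n] by simp
    also have "\<dots> = tensor_fun tscale (tensor_algebra s) s (tensor_proj s 1) (tensor_proj s n) (sq_map (scl D) (carr D) tscale F (comult D x))"
      using F'(2)[OF Suc.prems] by simp
    also have "\<dots> = conv D s (\<lambda>a. tensor_proj s 1 (F a)) (\<lambda>a. tensor_proj s n (F a)) x"
      unfolding conv_def
      by (rule tensor_fun_comp[OF vs Fl Fl FT FT gr_cop_power[OF comult_cop Suc.prems] tensor_proj_hom tensor_proj_hom])
    also have "\<dots> = conv D s (\<lambda>a. tensor_proj s 1 (F a)) (conv_pow D s (\<lambda>a. tensor_proj s 1 (F a)) n) x"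
      using conv_cong[of D "\<lambda>a. tensor_proj s 1 (F a)" "\<lambda>a. tensor_proj s 1 (F a)" "\<lambda>a. tensor_proj s n (F a)"] Suc.IH by simp
    finally show ?case by simp
  }
qed

theorem coalg_morphism_unique:
  assumes F: "coalg_morphism D (assoc_koszul_dual s R) F" and F': "coalg_morphism D (assoc_koszul_dual s R) F'"
    and eq: "\<And>x. x \<in> carr D \<Longrightarrow> tensor_proj s 1 (F x) = tensor_proj s 1 (F' x)" and x: "x \<in> carr D"
  shows "F x = F' x"
proof (rule tensor_proj_eqI)
  show "F x \<in> tensor_algebra s" "F' x \<in> tensor_algebra s"
    using koszul_carr_T graded_map_carr[OF coalg_morphismD(1)[OF F] comult_facts(1) koszul_graded x]
      graded_map_carr[OF coalg_morphismD(1)[OF F'] comult_facts(1) koszul_graded x] by blast+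
  show "tensor_proj s n (F x) = tensor_proj s n (F' x)" for n
    unfolding coalg_morphism_proj[OF F x] coalg_morphism_proj[OF F' x]
    using conv_pow_cong[of D "\<lambda>a. tensor_proj s 1 (F a)" "\<lambda>a. tensor_proj s 1 (F' a)"] eq by simp
qed

context
  fixes \<gamma> :: "'d \<Rightarrow> 'v"
  assumes \<gamma>: "map_to_sV s D \<gamma>" and vs: "vector_space s"
begin

abbreviation (input) power_map where "power_map \<equiv> conv_pow D s (\<lambda>x. ptens s [\<gamma> x])"

lemma degree_one_arg: "conv_arg (\<lambda>x. ptens s [\<gamma> x])"
  by (rule tens_hom_carr_ptens1[OF comult_facts(1)]) (use \<gamma> in \<open>simp add: map_to_sV_def linear_on_iff\<close>)

lemmas power_map_arg = conv_pow_hom[OF degree_one_arg]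

lemma power_map_tensor_power: "x \<in> carr D \<Longrightarrow> power_map n x \<in> tensor_power s UNIV n"
proof (induction n arbitrary: x)
  case 0
  show ?case by (simp add: tens.subspace_scale[OF tensor_power_subspace] ptens_tensor_power)
next
  case (Suc n)
  show ?case unfolding conv_pow.simps
    by (rule conv_imageI[OF degree_one_arg power_map_arg tensor_power_subspace Suc.prems])
      (use tprod_tensor_power[OF ptens_tensor_power[of _ 1] Suc.IH] in simp)
qed

text \<open>
  \<open>\<gamma>\<close> vanishes outside degree \<open>1\<close>, so its \<open>n\<close>-th power only sees products of \<open>n\<close> elements of degree \<open>1\<close>.
\<close>

lemma power_map_degree: "x \<in> gr D i \<Longrightarrow> i \<noteq> int n \<Longrightarrow> power_map n x = 0"
proof (induction n arbitrary: x i)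
  case 0
  then show ?case by (simp add: counit_facts(2))
next
  case (Suc n)
  show ?case unfolding conv_pow.simps conv_def
  proof (rule square_gr_eqI[OF comult_facts(1) comult_facts(3)[OF Suc.prems(1)] tensor_fun_lin[OF degree_one_arg power_map_arg] lin_on_const_zero[OF tens_vector_space]])
    fix a b j k assume ab: "a \<in> gr D j" "b \<in> gr D k" "j + k = i"
    have "tprod s (ptens s [\<gamma> a]) (power_map n b) = 0"
    proof (cases "j = 1")
      case True
      then have "k \<noteq> int n" using ab(3) Suc.prems(2) by simp
      with ab(2) have "power_map n b = 0" by (rule Suc.IH)
      then show ?thesis by (simp add: tprod_zero_right)
    next
      case False
      then have "\<gamma> a = 0" using \<gamma> ab(1) by (auto simp: map_to_sV_def)
      then show ?thesis by (simp add: ptens_zero_entry)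
    qed
    then show "tensor_fun (scl D) (carr D) s (\<lambda>x. ptens s [\<gamma> x]) (power_map n) (ptens (scl D) [a, b]) = 0"
      using ab gr_carr[OF comult_facts(1)] by (simp add: tensor_fun_ptens[OF degree_one_arg power_map_arg])
  qed
qed

text \<open>
  By associativity the power \<open>i + 2 + j\<close> is the convolution of the powers \<open>i\<close>, \<open>2\<close> and \<open>j\<close>, and the middle
  one has values in \<open>R'\<close>.
\<close>

lemma power_map_koszul:
  assumes quad: "\<And>x. x \<in> carr D \<Longrightarrow> power_map 2 x \<in> R_assoc s R" and x: "x \<in> carr D"
  shows "power_map n x \<in> assoc_koszul_gr s R n"
proof (rule koszulI[OF power_map_tensor_power[OF x]])
  fix i j assume ij: "i + 2 + j = n"
  note h2 = conv_hom[OF power_map_arg[of 2] power_map_arg[of j]]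
  have "power_map n x = conv D s (power_map i) (power_map (2 + j)) x"
    using conv_pow_add[OF degree_one_arg x, of i "2 + j"] ij by (simp only: add.assoc)
  also have "\<dots> = conv D s (power_map i) (conv D s (power_map 2) (power_map j)) x"
    using conv_cong[of D "power_map i" "power_map i" "power_map (2 + j)" "conv D s (power_map 2) (power_map j)"] conv_pow_add[OF degree_one_arg, of _ 2 j] by simp
  also have "\<dots> \<in> rel_space s R i j"
  proof (rule conv_imageI[OF power_map_arg h2 tens.subspace_span x])
    fix a b assume a: "a \<in> carr D" and b: "b \<in> carr D"
    let ?X = "{u \<in> tensor_algebra s. tprod s (power_map i a) u \<in> rel_space s R i j}"
    have Ga: "power_map i a \<in> tensor_algebra s" by (rule tens_homD(4)[OF power_map_arg a])
    have "tens.subspace ?X"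
      by (rule tens.subspaceI)
        (auto simp: tprod_zero_right[OF Ga] tprod_add_right[OF Ga] tprod_scale_right[OF Ga] T_zero T_closed
          intro: tens.span_zero tens.span_add tens.span_scale)
    then have "conv D s (power_map 2) (power_map j) b \<in> ?X"
    proof (rule conv_imageI[OF power_map_arg power_map_arg _ b])
      fix c d assume c: "c \<in> carr D" and d: "d \<in> carr D"
      note T = tens_homD(4)[OF power_map_arg c] tens_homD(4)[OF power_map_arg d]
      have "tprod s (tprod s (power_map i a) (power_map 2 c)) (power_map j d) \<in> rel_space s R i j"
        using power_map_tensor_power[OF a, of i] quad[OF c] power_map_tensor_power[OF d, of j] by (intro tens.span_base) blast
      then show "tprod s (power_map 2 c) (power_map j d) \<in> ?X" using T by (simp add: tprod_assoc tprod_T)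
    qed
    then show "tprod s (power_map i a) (conv D s (power_map 2) (power_map j) b) \<in> rel_space s R i j" by blast
  qed
  finally show "power_map n x \<in> rel_space s R i j" .
qed

text \<open>
  On degree \<open>n\<close> the morphism is the \<open>n\<close>-th convolution power of \<open>\<gamma>\<close>. It commutes with the coproducts
  since deconcatenation undoes the concatenation in \<open>\<gamma>\<^sup>p\<^sup>+\<^sup>q = \<gamma>\<^sup>p * \<gamma>\<^sup>q\<close>.
\<close>

theorem coalg_morphism_exists:
  assumes quad: "\<And>x. x \<in> carr D \<Longrightarrow> power_map 2 x \<in> R_assoc s R"
  shows "\<exists>F. coalg_morphism D (assoc_koszul_dual s R) F \<and> (\<forall>x\<in>carr D. tensor_proj s 1 (F x) = ptens s [\<gamma> x])"
proof -
  let ?K = "assoc_koszul_dual s R"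
  have "lin_on (gr D i) (scl D) tscale (\<lambda>x. if i < 0 then 0 else power_map (nat i) x)" for i
  proof (cases "i < 0")
    case False
    have "gr D i \<subseteq> carr D" using gr_carr[OF comult_facts(1)] by blast
    with lin_on_subset[OF tens_homD(3)[OF power_map_arg]] have "lin_on (gr D i) (scl D) tscale (power_map (nat i))" by blast
    then show ?thesis using False by simp
  qed (simp add: lin_on_const_zero[OF tens_vector_space])
  then obtain F where F: "Vector_Spaces.linear (scl D) tscale F" and Fv: "\<And>i x. x \<in> gr D i \<Longrightarrow> F x = (if i < 0 then 0 else power_map (nat i) x)"
    using graded_extension[OF comult_facts(1) tens_vector_space, of "\<lambda>i x. if i < 0 then 0 else power_map (nat i) x"] by blast
  note Fl = linear_lin_on[OF F]
  note vD = graded_space_vs[OF comult_facts(1)] carr_subspace[OF comult_facts(1)]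
  have Fgr: "F x \<in> gr ?K i" if "x \<in> gr D i" for x i
    using Fv[OF that] power_map_koszul[OF quad gr_carr[OF comult_facts(1) that]] by simp
  have gm: "graded_map D ?K F"
    unfolding graded_map_def linear_on_iff koszul_simps(1) using Fl Fgr by blast
  have FT: "F x \<in> tensor_algebra s" if "x \<in> carr D" for x
    by (rule koszul_carr_T[OF graded_map_carr[OF gm comult_facts(1) koszul_graded that]])
  have proj: "tensor_proj s 1 (F x) = ptens s [\<gamma> x]" if x: "x \<in> carr D" for x
  proof (rule carr_eqI[OF comult_facts(1) lin_on_comp[OF Fl FT tensor_proj_lin] tens_homD(3)[OF degree_one_arg] _ x])
    fix i x assume x: "x \<in> gr D i"
    note xc = gr_carr[OF comult_facts(1) x]
    show "tensor_proj s 1 (F x) = ptens s [\<gamma> x]"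
    proof (cases "i = 1")
      case True
      then have "F x = power_map 1 x" using Fv[OF x] by simp
      then show ?thesis using conv_pow_1[OF degree_one_arg xc] tensor_proj_eq[OF power_map_tensor_power[OF xc], of 1 1] by simp
    next
      case False
      then have "\<gamma> x = 0" using \<gamma> x by (auto simp: map_to_sV_def)
      moreover have "tensor_proj s 1 (F x) = 0"
        using Fv[OF x] tensor_proj_eq[OF power_map_tensor_power[OF xc], of 1 "nat i"] False lin_on_zero[OF tensor_proj_lin T_zero]
        by (auto simp: nat_eq_iff)
      ultimately show ?thesis by (simp add: ptens_zero_entry)
    qed
  qed
  have counit: "counit ?K (F x) = counit D x" if x: "x \<in> carr D" for x
    unfolding koszul_simps(4)
  proof (rule carr_eqI[OF comult_facts(1) lin_on_comp[OF Fl UNIV_I counit_lin] counit_facts(1) _ x])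
    fix i x assume x: "x \<in> gr D i"
    show "counit (tensor_coalg s) (F x) = counit D x"
    proof (cases "i = 0")
      case True
      then show ?thesis using Fv[OF x] by (simp add: tscale_apply counit_ptens)
    next
      case False
      have "counit ?K (F x) = 0" using koszul_coalgebra[of s R] Fgr[OF x] False unfolding graded_coalgebra_def Let_def by blast
      then show ?thesis using counit_facts(2)[OF x False] by simp
    qed
  qed
  have comult: "sq_map (scl D) (carr D) (scl ?K) F (comult D x) = comult ?K (F x)" if x: "x \<in> carr D" for x
    unfolding koszul_simps
  proof (rule carr_eqI[OF comult_facts(1) lin_on_comp[OF comult_facts(2) gr_cop_power[OF comult_cop] sq_map_lin[OF vD Fl]] lin_on_comp[OF Fl FT deconcat_lin] _ x])
    fix i x assume x: "x \<in> gr D i"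
    note xc = gr_carr[OF comult_facts(1) x]
    show "sq_map (scl D) (carr D) tscale F (comult D x) = deconcat s (F x)"
    proof (cases "i < 0")
      case True
      have "sq_map (scl D) (carr D) tscale F (comult D x) = 0"
      proof (rule square_gr_eqI[OF comult_facts(1) comult_facts(3)[OF x] sq_map_lin[OF vD Fl] lin_on_const_zero[OF tens_vector_space]])
        fix a b j k assume ab: "a \<in> gr D j" "b \<in> gr D k" "j + k = i"
        then have "F a = 0 \<or> F b = 0" using Fv[OF ab(1)] Fv[OF ab(2)] True by auto
        then show "sq_map (scl D) (carr D) tscale F (ptens (scl D) [a, b]) = 0"
          using ab gr_carr[OF comult_facts(1)] by (auto simp: sq_map_ptens[OF vD Fl] ptens_zero_entry)
      qed
      then show ?thesis using Fv[OF x] True lin_on_zero[OF deconcat_lin T_zero] by simp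
    next
      case False
      define n where "n = nat i"
      have i: "i = int n" using False by (simp add: n_def)
      \<comment> \<open>on the summand \<open>D\<^sub>p \<otimes> D\<^sub>q\<close> of the tensor square, \<open>F \<otimes> F\<close> is concatenation of the powers \<open>p\<close>
        and \<open>q\<close> followed by cutting after \<open>p\<close> letters\<close>
      have "sq_map (scl D) (carr D) tscale F (comult D x) =
        (\<Sum>p\<le>n. split_at s p (tensor_fun (scl D) (carr D) s (power_map p) (power_map (n - p)) (comult D x)))"
      proof (rule square_gr_eqI[OF comult_facts(1) comult_facts(3)[OF x] sq_map_lin[OF vD Fl]
            lin_on_sum_fun[OF tens_vector_space lin_on_comp[OF tensor_fun_lin[OF power_map_arg power_map_arg] tensor_fun_T[OF power_map_arg power_map_arg] split_at_lin]]])
        fix a b j k assume ab: "a \<in> gr D j" "b \<in> gr D k" "j + k = i"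
        note abc = gr_carr[OF comult_facts(1) ab(1)] gr_carr[OF comult_facts(1) ab(2)]
        have summand: "split_at s p (tprod s (power_map p a) (power_map (n - p) b)) = (if int p = j then ptens tscale [F a, F b] else 0)"
          if p: "p \<le> n" for p
        proof (cases "int p = j")
          case True
          then have j: "nat j = p" "\<not> j < 0" "nat k = n - p" "\<not> k < 0" using ab(3) i p by auto
          have "split_at s p (tprod s u v) = ptens tscale [u, v]" if u: "u \<in> tensor_power s UNIV p" and v: "v \<in> tensor_algebra s" for u v
          proof (rule power_eqI[OF u])
            show "lin_on (tensor_power s UNIV p) tscale tscale (\<lambda>u. split_at s p (tprod s u v))"
              by (rule tensor_power_lin[OF lin_on_comp[OF tprod_lin_left tprod_T[OF _ v] split_at_lin]])
            show "lin_on (tensor_power s UNIV p) tscale tscale (\<lambda>u. ptens tscale [u, v])" by (simp add: lin_on_def ptens_add2)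
            fix xs :: "'v list" assume xs: "xs \<in> words UNIV p"
            show "split_at s p (tprod s (ptens s xs) v) = ptens tscale [ptens s xs, v]"
              by (rule T_eqI[OF v lin_on_comp[OF tprod_lin_right[OF ptens_in_T] tprod_T[OF ptens_in_T] split_at_lin]])
                (use xs in \<open>simp_all add: lin_on_def ptens_add2 tprod_ptens split_at_ptens words_def\<close>)
          qed
          then show ?thesis
            using True Fv[OF ab(1)] Fv[OF ab(2)] j power_map_tensor_power[OF abc(1), of p] tens_homD(4)[OF power_map_arg abc(2)] by simp
        next
          case False
          then have "power_map p a = 0" using power_map_degree[OF ab(1)] by metis
          then show ?thesis using False lin_on_zero[OF split_at_lin T_zero] by simp
        qed
        have "(\<Sum>p\<le>n. split_at s p (tensor_fun (scl D) (carr D) s (power_map p) (power_map (n - p)) (ptens (scl D) [a, b]))) =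
          (\<Sum>p\<le>n. if int p = j then ptens tscale [F a, F b] else 0)"
          by (rule sum.cong) (simp_all add: tensor_fun_ptens[OF power_map_arg power_map_arg abc] summand)
        also have "\<dots> = ptens tscale [F a, F b]"
        proof (cases "0 \<le> j \<and> 0 \<le> k")
          case True
          have "(\<Sum>p\<le>n. if int p = j then ptens tscale [F a, F b] else 0) = (\<Sum>p\<le>n. if p = nat j then ptens tscale [F a, F b] else 0)"
            using True by (intro sum.cong) auto
          also have "\<dots> = ptens tscale [F a, F b]"
          proof -
            have "nat j \<le> n" using True ab(3) i by linarith
            then show ?thesis by simp
          qed
          finally show ?thesis .
        next
          case False
          then have z: "ptens tscale [F a, F b] = 0" using Fv[OF ab(1)] Fv[OF ab(2)] by (auto simp: ptens_zero_entry)
          have "(\<Sum>p\<le>n. if int p = j then ptens tscale [F a, F b] else 0) = 0"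
            by (rule sum.neutral) (use z in auto)
          with z show ?thesis by (simp only:)
        qed
        finally show "sq_map (scl D) (carr D) tscale F (ptens (scl D) [a, b]) =
          (\<Sum>p\<le>n. split_at s p (tensor_fun (scl D) (carr D) s (power_map p) (power_map (n - p)) (ptens (scl D) [a, b])))"
          by (simp add: sq_map_ptens[OF vD Fl abc])
      qed
      also have "\<dots> = (\<Sum>p\<le>n. split_at s p (power_map n x))"
      proof (rule sum.cong[OF refl])
        fix p assume "p \<in> {..n}"
        then have "p + (n - p) = n" by simp
        with conv_pow_add[OF degree_one_arg xc, of p "n - p"]
        show "split_at s p (tensor_fun (scl D) (carr D) s (power_map p) (power_map (n - p)) (comult D x)) = split_at s p (power_map n x)"
          by (simp only: conv_def)
      qed
      also have "\<dots> = deconcat s (F x)" using deconcat_split[OF power_map_tensor_power[OF xc]] Fv[OF x] i by simp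
      finally show ?thesis .
    qed
  qed
  have "coalg_morphism D ?K F" unfolding coalg_morphism_def using gm comult counit by blast
  then show ?thesis using proj by blast
qed

end

end

section \<open>Symmetrization and the quadratic relations\<close>

lemma symmetrize_lin: "lin_on A tscale tscale (symmetrize s)"
  by (auto simp: lin_on_def symmetrize_def tscale_def fun_eq_iff)

lemma sym_of_lin: "lin_on A tscale tscale (sym_of s)"
  by (auto simp: lin_on_def sym_of_def tscale_def fun_eq_iff)

lemma sym_q_lin: "lin_on A tscale tscale (sym_q s)"
  by (auto simp: lin_on_def sym_q_def tscale_def fun_eq_iff)

lemma sym_form_multilinear: "sym_form s \<mu> \<Longrightarrow> multilinear s \<mu>"
  by (simp add: sym_form_def)

lemma sym_form_mset: "sym_form s \<mu> \<Longrightarrow> mset xs = mset ys \<Longrightarrow> \<mu> xs = \<mu> ys"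
  unfolding sym_form_def by blast

lemma sym_form_double:
  fixes s :: "'k::field \<Rightarrow> 'v::ab_group_add \<Rightarrow> 'v"
  assumes "multilinear s \<mu>"
  shows "sym_form s (\<lambda>xs. if length xs = 2 then \<mu> xs + \<mu> (rev xs) else 0)"
  unfolding sym_form_def
proof (intro conjI allI impI)
  show "multilinear s (\<lambda>xs. if length xs = 2 then \<mu> xs + \<mu> (rev xs) else 0)"
    by (rule multilinearI) (simp_all add: multilinear_add[OF assms] multilinear_scale[OF assms] algebra_simps)
  fix xs ys :: "'v list" assume m: "mset xs = mset ys"
  then have len: "length xs = length ys" by (rule mset_eq_length)
  show "(if length xs = 2 then \<mu> xs + \<mu> (rev xs) else 0) = (if length ys = 2 then \<mu> ys + \<mu> (rev ys) else 0)"
  proof (cases "length xs = 2")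
    case True
    then obtain a b c d where "xs = [a, b]" "ys = [c, d]"
      using len by (auto simp: numeral_2_eq_2 length_Suc_conv)
    then show ?thesis using m by (auto simp: add_eq_conv_ex add.commute)
  qed (use len in simp)
qed

lemma symmetrize_ptens: "symmetrize s (sym_of s (ptens s [v, w])) = ptens s [v, w] + ptens s [w, v]"
proof
  fix \<mu>
  show "symmetrize s (sym_of s (ptens s [v, w])) \<mu> = (ptens s [v, w] + ptens s [w, v]) \<mu>"
  proof (cases "multilinear s \<mu>")
    case True
    define \<nu> where "\<nu> xs = (if length xs = 2 then \<mu> xs + \<mu> (rev xs) else 0)" for xs
    have \<nu>: "sym_form s \<nu>" unfolding \<nu>_def by (rule sym_form_double[OF True])
    have "symmetrize s (sym_of s (ptens s [v, w])) \<mu> = sym_of s (ptens s [v, w]) \<nu>"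
      unfolding symmetrize_def \<nu>_def using True by (simp only: if_True)
    also have "\<dots> = \<nu> [v, w]" using \<nu> by (simp add: sym_of_def ptens_def sym_form_multilinear)
    also have "\<dots> = (ptens s [v, w] + ptens s [w, v]) \<mu>" using True by (simp add: \<nu>_def ptens_def)
    finally show ?thesis .
  qed (simp add: symmetrize_def ptens_def)
qed

text \<open>
  A symmetric form does not distinguish a tensor from its flip. As symmetric forms separate the
  elements of \<open>Sym\<^sup>2(V)\<close>, symmetrization is injective when \<open>2\<close> is invertible.
\<close>

lemma symmetrize_sym:
  fixes s :: "'k::field \<Rightarrow> 'v::ab_group_add \<Rightarrow> 'v"
  assumes z: "z \<in> tensor_power s UNIV 2" and \<mu>: "sym_form s \<mu>"
  shows "symmetrize s (sym_of s z) \<mu> = 2 * z \<mu>"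
proof (rule power_eqI[OF z, of "(*)"])
  show "lin_on (tensor_power s UNIV 2) tscale (*) (\<lambda>z. symmetrize s (sym_of s z) \<mu>)"
  proof -
    have c: "lin_on UNIV tscale tscale (\<lambda>z. symmetrize s (sym_of s z))"
      by (rule lin_on_comp[OF sym_of_lin UNIV_I symmetrize_lin])
    show ?thesis
      by (rule lin_onI) (simp_all add: lin_on_add[OF c UNIV_I UNIV_I] lin_on_scale[OF c UNIV_I] tscale_apply)
  qed
  show "lin_on (tensor_power s UNIV 2) tscale (*) (\<lambda>z. 2 * z \<mu>)"
    by (auto simp: lin_on_def tscale_def algebra_simps)
  fix xs :: "'v list" assume "xs \<in> words UNIV 2"
  then obtain v w where xs: "xs = [v, w]" by (auto simp: words_2)
  have "\<mu> [w, v] = \<mu> [v, w]" by (rule sym_form_mset[OF \<mu>]) (simp add: add_mset_commute)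
  then show "symmetrize s (sym_of s (ptens s xs)) \<mu> = 2 * ptens s xs \<mu>"
    unfolding xs symmetrize_ptens using sym_form_multilinear[OF \<mu>] by (simp add: ptens_def)
qed

lemma symmetrize_inj:
  fixes s :: "'k::field_char_0 \<Rightarrow> 'v::ab_group_add \<Rightarrow> 'v"
  assumes "z \<in> tensor_power s UNIV 2" "z' \<in> tensor_power s UNIV 2" "symmetrize s (sym_of s z) = symmetrize s (sym_of s z')"
  shows "sym_of s z = sym_of s z'"
proof
  fix \<mu> show "sym_of s z \<mu> = sym_of s z' \<mu>"
    using symmetrize_sym[OF assms(1), of \<mu>] symmetrize_sym[OF assms(2), of \<mu>] assms(3) by (auto simp: sym_of_def)
qed

lemma sym_q_sym_of: "t \<in> tensor_algebra s \<Longrightarrow> sym_q s (sym_of s t) = sym_of s (tensor_proj s 2 t)"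
proof (rule T_eqI[OF _ lin_on_comp[OF sym_of_lin UNIV_I sym_q_lin] lin_on_comp[OF tensor_proj_lin UNIV_I sym_of_lin]])
  fix xs :: "'a list"
  have form: "sym_form s (\<lambda>xs. if length xs = 2 then \<mu> xs else 0)" if \<mu>: "sym_form s \<mu>" for \<mu>
    unfolding sym_form_def
  proof (intro conjI allI impI)
    show "multilinear s (\<lambda>xs. if length xs = 2 then \<mu> xs else 0)"
      using multilinear_length[OF sym_form_multilinear[OF \<mu>], of "\<lambda>n. n = 2"] .
    fix xs ys :: "'a list" assume m: "mset xs = mset ys"
    then show "(if length xs = 2 then \<mu> xs else 0) = (if length ys = 2 then \<mu> ys else 0)"
      using mset_eq_length[OF m] sym_form_mset[OF \<mu> m] by simp
  qed
  show "sym_q s (sym_of s (ptens s xs)) = sym_of s (tensor_proj s 2 (ptens s xs))"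
  proof
    fix \<mu> show "sym_q s (sym_of s (ptens s xs)) \<mu> = sym_of s (tensor_proj s 2 (ptens s xs)) \<mu>"
      using form[of \<mu>] sym_form_multilinear[of s \<mu>] sym_form_multilinear[OF form[of \<mu>]]
      unfolding tensor_proj_ptens by (auto simp: sym_q_def sym_of_def ptens_def)
  qed
qed

lemma qR_sym_of:
  assumes "R \<subseteq> Sym_le s 2" "y \<in> qR s R"
  shows "\<exists>z\<in>tensor_power s UNIV 2. y = sym_of s z"
proof -
  obtain t where t: "t \<in> tens.span (ptens s ` {xs. length xs \<le> 2})" "y = sym_q s (sym_of s t)"
    using assms by (auto simp: Sym_le_def)
  have "t \<in> tensor_algebra s" using t(1) tens.span_mono[of "ptens s ` {xs. length xs \<le> 2}" "range (ptens s)"]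
    by (auto simp: tensor_algebra_def)
  then show ?thesis using t(2) sym_q_sym_of tensor_proj_power by metis
qed

text \<open>
  Membership in \<open>R'\<close> can be tested after symmetrization, where the Lie side sees it.
\<close>

lemma R_assoc_iff:
  fixes s :: "'k::field_char_0 \<Rightarrow> 'v::ab_group_add \<Rightarrow> 'v"
  assumes "R \<subseteq> Sym_le s 2" "z \<in> tensor_power s UNIV 2"
  shows "z \<in> R_assoc s R \<longleftrightarrow> symmetrize s (sym_of s z) \<in> symmetrize s ` qR s R"
proof
  assume "symmetrize s (sym_of s z) \<in> symmetrize s ` qR s R"
  then obtain y where y: "y \<in> qR s R" "symmetrize s (sym_of s z) = symmetrize s y" by blast
  obtain z' where "z' \<in> tensor_power s UNIV 2" "y = sym_of s z'" using qR_sym_of[OF assms(1) y(1)] by blast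
  then show "z \<in> R_assoc s R" using symmetrize_inj[OF assms(2)] y assms(2) by (auto simp: R_assoc_def)
qed (auto simp: R_assoc_def)

lemma qR_subspace: "tens.subspace R \<Longrightarrow> tens.subspace (qR s R)"
  by (rule lin_on_image_subspace[OF tens_vector_space _ sym_q_lin tens_vector_space])

lemma R_assoc_subspace: "tens.subspace R \<Longrightarrow> tens.subspace (R_assoc s R)"
  using qR_subspace[of R s] tensor_power_subspace[of s UNIV 2] lin_on_zero[OF sym_of_lin UNIV_I, of s]
    lin_on_add[OF sym_of_lin UNIV_I UNIV_I, of s] lin_on_scale[OF sym_of_lin UNIV_I, of s]
  by (intro tens.subspaceI) (simp_all add: R_assoc_def tens.subspace_0 tens.subspace_add tens.subspace_scale)

text \<open>
  \<open>\<gamma>\<close> is nonzero only in degree \<open>1\<close>, where the Koszul sign of the flip is \<open>-1\<close>: the commutator of the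
  coproduct becomes an anticommutator, that is, a symmetrization.
\<close>

lemma cobracket_symmetrize:
  assumes D: "gr_cop D (comult D)" and \<gamma>: "map_to_sV s D \<gamma>" and x: "x \<in> carr D"
  shows "sq_map (scl D) (carr D) s \<gamma> (cobr (Liec D) x) = symmetrize s (sym_of s (sq_map (scl D) (carr D) s \<gamma> (comult D x)))"
proof -
  note D' = gr_copD[OF D]
  note vs = graded_space_vs[OF D'(1)] carr_subspace[OF D'(1)]
  have g: "lin_on (carr D) (scl D) s \<gamma>" using \<gamma> by (simp add: map_to_sV_def linear_on_iff)
  note q = sq_map_lin[OF vs g]
  have "sq_map (scl D) (carr D) s \<gamma> (y - twist D y) = symmetrize s (sym_of s (sq_map (scl D) (carr D) s \<gamma> y))"
    if y: "y \<in> tensor_power (scl D) (carr D) 2" for y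
  proof (rule square_homog_eqI[OF D'(1) y])
    show "lin_on (tensor_power (scl D) (carr D) 2) tscale tscale (\<lambda>y. sq_map (scl D) (carr D) s \<gamma> (y - twist D y))"
      by (rule lin_on_comp[OF lin_on_minus[OF tens_vector_space lin_on_id twist_lin[OF D'(1)]] _ q])
        (simp add: twist_power[OF D'(1)] tens.subspace_diff[OF tensor_power_subspace])
    show "lin_on (tensor_power (scl D) (carr D) 2) tscale tscale (\<lambda>y. symmetrize s (sym_of s (sq_map (scl D) (carr D) s \<gamma> y)))"
      by (rule lin_on_comp[OF q UNIV_I lin_on_comp[OF sym_of_lin UNIV_I symmetrize_lin]])
    fix a b i j assume ab: "a \<in> gr D i" "b \<in> gr D j"
    note abc = ab[THEN gr_carr[OF D'(1)]]
    note p = ptens_tensor_power_2[OF abc] ptens_tensor_power_2[OF abc(2,1)]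
    have "sq_map (scl D) (carr D) s \<gamma> (ptens (scl D) [a, b] - twist D (ptens (scl D) [a, b])) =
      ptens s [\<gamma> a, \<gamma> b] - tscale (ksign (i * j)) (ptens s [\<gamma> b, \<gamma> a])"
      using lin_on_diff[OF tens_vector_space tensor_power_subspace q p(1) twist_power[OF D'(1) p(1)]]
      by (simp add: twist_ptens[OF D'(1) ab] lin_on_scale[OF q p(2)] sq_map_ptens[OF vs g abc] sq_map_ptens[OF vs g abc(2,1)])
    also have "\<dots> = ptens s [\<gamma> a, \<gamma> b] + ptens s [\<gamma> b, \<gamma> a]"
    proof (cases "i = 1 \<and> j = 1")
      case False
      then have "\<gamma> a = 0 \<or> \<gamma> b = 0" using \<gamma> ab by (auto simp: map_to_sV_def)
      then show ?thesis by (auto simp: ptens_zero_entry)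
    qed (simp add: ksign_def)
    finally show "sq_map (scl D) (carr D) s \<gamma> (ptens (scl D) [a, b] - twist D (ptens (scl D) [a, b])) =
      symmetrize s (sym_of s (sq_map (scl D) (carr D) s \<gamma> (ptens (scl D) [a, b])))"
      by (simp add: sq_map_ptens[OF vs g abc] symmetrize_ptens)
  qed
  from this[OF gr_cop_power[OF D x]] show ?thesis by (simp add: cobr_Liec)
qed

text \<open>
  Linear functionals separate the vectors of \<open>V\<close>.
\<close>

lemma ptens1_inj:
  assumes vs: "vector_space s" and eq: "ptens s [v] = ptens s [w]"
  shows "v = w"
proof (rule ccontr)
  assume "v \<noteq> w"
  interpret V: vector_space s by (rule vs)
  interpret K: vector_space "(*) :: 'a \<Rightarrow> 'a \<Rightarrow> 'a" by unfold_locales (simp_all add: algebra_simps)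
  interpret vector_space_pair s "(*) :: 'a \<Rightarrow> 'a \<Rightarrow> 'a" ..
  have "V.independent {v - w}" using \<open>v \<noteq> w\<close> by simp
  from linear_independent_extend[OF this, of "\<lambda>_. 1"]
  obtain g where g: "Vector_Spaces.linear s (*) g" "g (v - w) = 1" by auto
  have gl: "lin_on UNIV s (*) g" by (rule linear_lin_on[OF g(1)])
  \<comment> \<open>a functional \<open>g\<close> on \<open>V\<close>, extended by zero to words of other lengths\<close>
  define \<mu> where "\<mu> xs = (if length xs = 1 then g (hd xs) else 0)" for xs
  have "multilinear s \<mu>"
  proof (rule multilinearI)
    fix xs ys a b c
    show "\<mu> (xs @ (a + b) # ys) = \<mu> (xs @ a # ys) + \<mu> (xs @ b # ys)" "\<mu> (xs @ s c a # ys) = c * \<mu> (xs @ a # ys)"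
      by (cases xs; simp add: \<mu>_def lin_on_add[OF gl] lin_on_scale[OF gl])+
  qed
  then have "g v = g w" using fun_cong[OF eq, of \<mu>] by (simp add: ptens_def \<mu>_def)
  then show False using g(2) lin_on_diff[OF vs V.subspace_UNIV gl, of v w] by simp
qed

lemma tensor_power_1: assumes "vector_space s" "t \<in> tensor_power s UNIV 1" shows "\<exists>v. t = ptens s [v]"
proof -
  interpret V: vector_space s by fact
  have "tens.subspace (range (\<lambda>v. ptens s [v]))"
    by (rule lin_on_image_subspace[OF assms(1) V.subspace_UNIV lin_on_ptens1 tens_vector_space])
  moreover have "ptens s ` words UNIV 1 \<subseteq> range (\<lambda>v. ptens s [v])" by (auto simp: words_def length_Suc_conv)
  ultimately have "tensor_power s UNIV 1 \<subseteq> range (\<lambda>v. ptens s [v])" unfolding tensor_power_def by (intro tens.span_minimal)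
  then show ?thesis using assms(2) by blast
qed

section \<open>Lie subcoalgebras\<close>

abbreviation sub_lie :: "('k, 'l) lie_coalg \<Rightarrow> 'l set \<Rightarrow> ('k, 'l) lie_coalg" where
  "sub_lie L H \<equiv> L\<lparr>gr := \<lambda>i. H \<inter> gr L i\<rparr>"

lemma lie_subcoalgebraD:
  assumes L: "graded_space L" and H: "lie_subcoalgebra L H"
  shows "module.subspace (scl L) H" "H \<subseteq> carr L" "carr (sub_lie L H) = H" "graded_space (sub_lie L H)"
    "\<And>x. x \<in> H \<Longrightarrow> cobr L x \<in> tensor_power (scl L) H 2"
proof -
  interpret vector_space "scl L" using L by (rule graded_space_vs)
  have sp: "span (H \<inter> homog L) = H" using H by (simp add: lie_subcoalgebra_def)
  show sub: "subspace H" using subspace_span[of "H \<inter> homog L"] sp by simp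
  show "H \<subseteq> carr L" using span_mono[of "H \<inter> homog L" "homog L"] sp by (simp add: carr_def)
  have "homog (sub_lie L H) = H \<inter> homog L" by (auto simp: homog_def)
  then show "carr (sub_lie L H) = H" using sp by (simp add: carr_def)
  show "graded_space (sub_lie L H)"
    by (rule graded_space_sub[OF L]) (auto simp: subspace_inter sub gr_subspace[OF L])
  show "cobr L x \<in> tensor_power (scl L) H 2" if "x \<in> H" for x using H that by (simp add: lie_subcoalgebra_def)
qed

text \<open>
  A graded subspace has a graded complement.
\<close>

lemma graded_projection:
  assumes L: "graded_space L" and H: "lie_subcoalgebra L H"
  shows "\<exists>P. Vector_Spaces.linear (scl L) (scl L) P \<and> (\<forall>i. \<forall>x\<in>gr L i. P x \<in> H \<inter> gr L i) \<and> (\<forall>x\<in>H. P x = x)"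
proof -
  note vs = graded_space_vs[OF L]
  interpret vector_space "scl L" by (rule vs)
  note Hs = lie_subcoalgebraD[OF L H]
  have "\<exists>P. Vector_Spaces.linear (scl L) (scl L) P \<and> (\<forall>x. P x \<in> H \<inter> gr L i) \<and> (\<forall>x\<in>H \<inter> gr L i. P x = x)" for i
    by (rule subspace_projection[OF vs subspace_inter[OF Hs(1) gr_subspace[OF L]]])
  then obtain p where p: "\<And>i. Vector_Spaces.linear (scl L) (scl L) (p i)" "\<And>i x. p i x \<in> H \<inter> gr L i"
    "\<And>i x. x \<in> H \<inter> gr L i \<Longrightarrow> p i x = x" by metis
  obtain P where P: "Vector_Spaces.linear (scl L) (scl L) P" "\<And>i x. x \<in> gr L i \<Longrightarrow> P x = p i x"
    using graded_extension[OF L vs, of p] linear_lin_on[OF p(1)] by blast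
  have "P x = x" if "x \<in> H" for x
    by (rule carr_eqI[OF Hs(4), of "scl L" P "\<lambda>x. x"])
      (use linear_lin_on[OF P(1)] lin_on_id P(2) p(3) that Hs(3) in auto)
  then show ?thesis using P p(2) by metis
qed

text \<open>
  The cobracket of an element of \<open>H\<close> of degree \<open>i\<close> lies in \<open>H \<otimes> H\<close> and in the degree \<open>i\<close> part of \<open>L \<otimes> L\<close>. A
  degree preserving projection onto \<open>H\<close> shows that it lies in the degree \<open>i\<close> part of \<open>H \<otimes> H\<close>.
\<close>

lemma sub_lie_coalgebra:
  assumes L: "lie_coalgebra L" and H: "lie_subcoalgebra L H"
  shows "lie_coalgebra (sub_lie L H)"
proof -
  note cop = lie_coalgebra_cop[OF L]
  note L' = gr_copD[OF cop]
  note Hs = lie_subcoalgebraD[OF L'(1) H]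
  let ?G = "sub_lie L H"
  obtain P where P: "Vector_Spaces.linear (scl L) (scl L) P" "\<And>i x. x \<in> gr L i \<Longrightarrow> P x \<in> H \<inter> gr L i" "\<And>x. x \<in> H \<Longrightarrow> P x = x"
    using graded_projection[OF L'(1) H] by blast
  note Pl = tensor_map_lin[OF P(1)]
  \<comment> \<open>\<open>P \<otimes> P\<close> is the identity on \<open>H \<otimes> H\<close> and preserves degrees\<close>
  have fixed: "tensor_map (scl L) (scl L) P t = t" if "t \<in> tensor_power (scl L) H 2" for t
    by (rule power_eqI[OF that tensor_power_lin[OF Pl] lin_on_id])
      (auto simp: tensor_map_ptens[OF P(1)] words_def P(3) map_idI subset_iff)
  have gr: "cobr L x \<in> square_gr ?G i" if x: "x \<in> H" "x \<in> gr L i" for x i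
  proof -
    have "tensor_map (scl L) (scl L) P (cobr L x) \<in> square_gr ?G i"
    proof (rule square_gr_imageI[OF L'(1) L'(3)[OF x(2)] tensor_power_lin[OF Pl] tens_vector_space square_gr_subspace])
      fix a b j k assume ab: "a \<in> gr L j" "b \<in> gr L k" "j + k = i"
      have "P a \<in> gr ?G j" "P b \<in> gr ?G k" using P(2) ab by simp_all
      from ptens_square_gr[OF this ab(3)]
      show "tensor_map (scl L) (scl L) P (ptens (scl L) [a, b]) \<in> square_gr ?G i" by (simp add: tensor_map_ptens[OF P(1)])
    qed
    then show ?thesis using fixed[OF Hs(5)[OF x(1)]] by simp
  qed
  have copG: "gr_cop ?G (cobr ?G)"
    using Hs(3,4) gr lin_on_subset[OF L'(2) Hs(2)] by (auto simp: gr_cop_def)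
  have HT: "tensor_power (scl L) H n \<subseteq> tensor_power (scl L) (carr L) n" for n by (rule tensor_power_mono[OF Hs(2)])
  have tw: "twist ?G t = twist L t" if t: "t \<in> tensor_power (scl L) H 2" for t
  proof (rule square_homog_eqI[OF Hs(4), where F = "twist ?G" and G = "twist L" and s' = tscale and t = t])
    show "t \<in> tensor_power (scl ?G) (carr ?G) 2" using t Hs(3) by simp
    show "lin_on (tensor_power (scl ?G) (carr ?G) 2) tscale tscale (twist ?G)" by (rule twist_lin[OF Hs(4)])
    show "lin_on (tensor_power (scl ?G) (carr ?G) 2) tscale tscale (twist L)"
      using lin_on_subset[OF twist_lin[OF L'(1)] HT] Hs(3) by simp
    fix a b i j assume "a \<in> gr ?G i" "b \<in> gr ?G j"
    then show "twist ?G (ptens (scl ?G) [a, b]) = twist L (ptens (scl ?G) [a, b])"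
      using twist_ptens[OF Hs(4), of a i b j] twist_ptens[OF L'(1), of a i b j] by simp
  qed
  have cy: "cycle ?G t = cycle L t" if t: "t \<in> tensor_power (scl L) H 3" for t
  proof (rule cube_eqI[OF Hs(4), where F = "cycle ?G" and G = "cycle L" and s' = tscale and t = t])
    show "t \<in> tensor_power (scl ?G) (carr ?G) 3" using t Hs(3) by simp
    show "lin_on (tensor_power (scl ?G) (carr ?G) 3) tscale tscale (cycle ?G)" by (rule cycle_lin[OF Hs(4)])
    show "lin_on (tensor_power (scl ?G) (carr ?G) 3) tscale tscale (cycle L)"
      using lin_on_subset[OF cycle_lin[OF L'(1)] HT] Hs(3) by simp
    fix a b c i j k assume "a \<in> gr ?G i" "b \<in> gr ?G j" "c \<in> gr ?G k"
    then show "cycle ?G (ptens (scl ?G) [a, b, c]) = cycle L (ptens (scl ?G) [a, b, c])"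
      using cycle_ptens[OF Hs(4), of a i b j c k] cycle_ptens[OF L'(1), of a i b j c k] by simp
  qed
  have anti: "twist ?G (cobr ?G x) = - cobr ?G x" if "x \<in> H" for x
    using tw[OF Hs(5)[OF that]] L that Hs(2) by (auto simp: lie_coalgebra_def)
  have jac: "(let t = tensor_fun (scl ?G) (carr ?G) (scl ?G) (cobr ?G) (\<lambda>a. ptens (scl ?G) [a]) (cobr ?G x)
        in t + cycle ?G t + cycle ?G (cycle ?G t) = 0)" if x: "x \<in> H" for x
  proof -
    define t where "t = tensor_fun (scl L) (carr L) (scl L) (cobr L) (\<lambda>a. ptens (scl L) [a]) (cobr L x)"
    have eq: "tensor_fun (scl L) H (scl L) (cobr L) (\<lambda>a. ptens (scl L) [a]) (cobr L x) = t"
      unfolding t_def by (rule tensor_fun_restrict[OF gr_cop_hom[OF cop] tens_hom_carr_id[OF L'(1)] Hs(1,2) Hs(5)[OF x]])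
    have "tensor_fun (scl ?G) (carr ?G) (scl ?G) (cobr ?G) (\<lambda>a. ptens (scl ?G) [a]) (cobr ?G x) \<in> tensor_power (scl ?G) (carr ?G) 3"
      by (rule gr_cop_left_power[OF copG gr_cop_power[OF copG]]) (use x Hs(3) in simp)
    then have t3: "t \<in> tensor_power (scl L) H 3" using eq Hs(3) by simp
    have "cycle ?G t \<in> tensor_power (scl ?G) (carr ?G) 3" by (rule cycle_power[OF Hs(4)]) (use t3 Hs(3) in simp)
    then have c3: "cycle L t \<in> tensor_power (scl L) H 3" using Hs(3) cy[OF t3] by simp
    have "t + cycle L t + cycle L (cycle L t) = 0"
      using L x Hs(2) by (auto simp: lie_coalgebra_def t_def Let_def)
    then show ?thesis using eq Hs(3) cy[OF t3] cy[OF c3] by (simp add: Let_def)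
  qed
  show ?thesis
    unfolding lie_coalgebra_def linear_on_iff
    using gr_copD[OF copG] anti jac Hs(3) by blast
qed

lemma lie_morphism_sub_iff:
  "lie_morphism N (sub_lie L H) f \<longleftrightarrow> lie_morphism N L f \<and> (\<forall>i. f ` gr N i \<subseteq> H)"
  by (simp add: lie_morphism_def graded_map_def image_subset_iff) blast

lemma sub_lie_inclusion:
  assumes L: "graded_space L" and H: "lie_subcoalgebra L H"
  shows "lie_morphism (sub_lie L H) L (\<lambda>x. x)"
  unfolding lie_morphism_def graded_map_def linear_on_iff
  using lie_subcoalgebraD[OF L H] sq_map_id[OF graded_space_vs[OF L], of H] lin_on_id by auto

text \<open>
  The source of the Lie subcoalgebras needed: any image of a Lie morphism is one.
\<close>

lemma image_lie_subcoalgebra: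
  assumes N: "gr_cop N (cobr N)" and f: "lie_morphism N L f" and L: "graded_space L"
  shows "lie_subcoalgebra L (f ` carr N)"
proof -
  note N' = gr_copD[OF N] and f' = lie_morphismD[OF f]
  note vs = graded_space_vs[OF N'(1)] carr_subspace[OF N'(1)]
  interpret vector_space "scl L" using L by (rule graded_space_vs)
  have sub: "subspace (f ` carr N)"
    by (rule lin_on_image_subspace[OF vs graded_mapD(1)[OF f'(1)] graded_space_vs[OF L]])
  have "f x \<in> span (f ` carr N \<inter> homog L)" if "x \<in> carr N" for x
    by (rule carr_imageI[OF N'(1) graded_mapD(1)[OF f'(1)] graded_space_vs[OF L] subspace_span _ that])
      (use gr_carr[OF N'(1)] gr_homog[OF graded_mapD(2)[OF f'(1)]] in \<open>auto intro!: span_base\<close>)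
  then have "span (f ` carr N \<inter> homog L) = f ` carr N" using span_minimal[OF _ sub] by blast
  moreover have "cobr L (f x) \<in> tensor_power (scl L) (f ` carr N) 2" if "x \<in> carr N" for x
    using sq_map_power[OF vs graded_mapD(1)[OF f'(1)] _ gr_cop_power[OF N that], of "f ` carr N"] f'(2)[OF that] by simp
  ultimately show ?thesis by (auto simp: lie_subcoalgebra_def)
qed

section \<open>The Koszul dual Lie coalgebra and its coenveloping coalgebra\<close>

lemma lie_koszul_dual_sub: "lie_koszul_dual s R L pr = sub_lie L (lie_koszul_carrier s R L pr)"
  by (simp add: lie_koszul_dual_def)

lemma coenvelopingD:
  assumes "coenveloping TYPE('d::ab_group_add) N U \<eta>"
  shows "lie_coalgebra N" "graded_coalgebra U" "lie_morphism (Liec U) N \<eta>"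
    "\<And>(D :: ('k::field, 'd) coalg) f. graded_coalgebra D \<Longrightarrow> lie_morphism (Liec D) N f \<Longrightarrow>
      \<exists>F. coalg_morphism D U F \<and> (\<forall>x\<in>carr D. \<eta> (F x) = f x)"
    "\<And>(D :: ('k, 'd) coalg) f F F'. graded_coalgebra D \<Longrightarrow> lie_morphism (Liec D) N f \<Longrightarrow>
      coalg_morphism D U F \<Longrightarrow> \<forall>x\<in>carr D. \<eta> (F x) = f x \<Longrightarrow>
      coalg_morphism D U F' \<Longrightarrow> \<forall>x\<in>carr D. \<eta> (F' x) = f x \<Longrightarrow> \<forall>x\<in>carr D. F x = F' x"
proof -
  note a = assms[unfolded coenveloping_def]
  show "lie_coalgebra N" "graded_coalgebra U" "lie_morphism (Liec U) N \<eta>" using a by blast+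
  show "\<exists>F. coalg_morphism D U F \<and> (\<forall>x\<in>carr D. \<eta> (F x) = f x)"
    if "graded_coalgebra D" "lie_morphism (Liec D) N f" for D :: "('k, 'd) coalg" and f
    using a that by blast
  show "\<forall>x\<in>carr D. F x = F' x"
    if D: "graded_coalgebra D" "lie_morphism (Liec D) N f"
      and F: "coalg_morphism D U F" "\<forall>x\<in>carr D. \<eta> (F x) = f x"
      and F': "coalg_morphism D U F'" "\<forall>x\<in>carr D. \<eta> (F' x) = f x" for D :: "('k, 'd) coalg" and f F F'
  proof -
    obtain F0 where "\<And>F'. coalg_morphism D U F' \<Longrightarrow> \<forall>x\<in>carr D. \<eta> (F' x) = f x \<Longrightarrow> \<forall>x\<in>carr D. F' x = F0 x"
      using a D by blast
    then show ?thesis using F F' by metis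
  qed
qed

context
  fixes s :: "'k::field_char_0 \<Rightarrow> 'v::ab_group_add \<Rightarrow> 'v" and R :: "('k, 'v) tens set"
    and L :: "('k, 'l::ab_group_add) lie_coalg" and pr :: "'l \<Rightarrow> 'v"
  assumes QLC: "comm_QLC s R" and cofree: "cofree_conilpotent_lie s L pr"
begin

lemma QLC_vector_space: "vector_space s" and QLC_subspace: "tens.subspace R" and QLC_quadratic: "R \<subseteq> Sym_le s 2"
  using QLC by (auto simp: comm_QLC_def)

lemmas L_cop = cofree_cop[OF cofree QLC_vector_space] and L_graded = cofree_graded(1)[OF cofree QLC_vector_space] and pr_lin = cofree_pr_lin[OF cofree QLC_vector_space]
lemmas L_subspace = graded_space_vs[OF L_graded] carr_subspace[OF L_graded]

abbreviation (input) LieKc where "LieKc \<equiv> lie_koszul_carrier s R L pr"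
abbreviation (input) LieK where "LieK \<equiv> lie_koszul_dual s R L pr"
abbreviation (input) AssK where "AssK \<equiv> assoc_koszul_dual s R"
text \<open>
  \<open>s\<^sup>2qR\<close> inside \<open>sV \<otimes> sV\<close>.
\<close>

abbreviation (input) wedgeR where "wedgeR \<equiv> symmetrize s ` qR s R"

lemma wedgeR_subspace: "tens.subspace wedgeR"
  by (rule lin_on_image_subspace[OF tens_vector_space qR_subspace[OF QLC_subspace] symmetrize_lin tens_vector_space])

lemma wedge2_lin: "lin_on (carr L) (scl L) tscale (wedge2_proj s L pr)"
  unfolding wedge2_proj_def
  by (rule lin_on_comp[OF gr_copD(2)[OF L_cop] gr_cop_power[OF L_cop] sq_map_lin[OF L_subspace pr_lin]])

lemma subcoalgebra_le_carrier:
  assumes "lie_subcoalgebra L H" "\<And>x. x \<in> H \<Longrightarrow> wedge2_proj s L pr x \<in> wedgeR"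
  shows "H \<subseteq> LieKc"
proof -
  interpret vector_space "scl L" by (rule L_subspace)
  have "H \<in> {H. lie_subcoalgebra L H \<and> (\<forall>x\<in>H. wedge2_proj s L pr x \<in> wedgeR)}" using assms by simp
  then show ?thesis unfolding lie_koszul_carrier_def by (rule order_trans[OF Union_upper span_superset])
qed

text \<open>
  Both properties are linear in the element, so they pass from the Lie subcoalgebras to their sum.
\<close>

lemma carrier_subcoalgebra: "lie_subcoalgebra L LieKc"
  and carrier_wedge2: "x \<in> LieKc \<Longrightarrow> wedge2_proj s L pr x \<in> wedgeR"
proof -
  interpret vector_space "scl L" by (rule L_subspace)
  let ?U = "\<Union>{H. lie_subcoalgebra L H \<and> (\<forall>x\<in>H. wedge2_proj s L pr x \<in> wedgeR)}"
  have carrier: "LieKc = span ?U" by (simp add: lie_koszul_carrier_def)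
  have U: "?U \<subseteq> carr L" using lie_subcoalgebraD(2)[OF L_graded] by blast
  have CL: "span ?U \<subseteq> carr L" by (rule span_minimal[OF U L_subspace(2)])
  have "?U \<subseteq> span (LieKc \<inter> homog L)"
  proof
    fix x assume "x \<in> ?U"
    then obtain H where H: "x \<in> H" "lie_subcoalgebra L H" "\<forall>x\<in>H. wedge2_proj s L pr x \<in> wedgeR" by blast
    then have "H \<subseteq> LieKc" using subcoalgebra_le_carrier by blast
    then have "span (H \<inter> homog L) \<subseteq> span (LieKc \<inter> homog L)" by (intro span_mono) blast
    then show "x \<in> span (LieKc \<inter> homog L)" using H by (auto simp: lie_subcoalgebra_def)
  qed
  then have 1: "LieKc \<subseteq> span (LieKc \<inter> homog L)" unfolding carrier by (intro span_minimal) auto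
  have 2: "span (LieKc \<inter> homog L) \<subseteq> LieKc" by (rule span_minimal) (auto simp: carrier)
  have "cobr L x \<in> tensor_power (scl L) LieKc 2" if "x \<in> LieKc" for x
  proof (rule lin_on_image_span[OF L_subspace(1) lin_on_subset[OF gr_copD(2)[OF L_cop] CL] tens_vector_space tensor_power_subspace])
    show "x \<in> span ?U" using that by (simp add: carrier)
    fix y assume "y \<in> ?U"
    then obtain H where H: "y \<in> H" "lie_subcoalgebra L H" "\<forall>x\<in>H. wedge2_proj s L pr x \<in> wedgeR" by blast
    then have "H \<subseteq> LieKc" using subcoalgebra_le_carrier by blast
    then show "cobr L y \<in> tensor_power (scl L) LieKc 2"
      using tensor_power_mono lie_subcoalgebraD(5)[OF L_graded H(2,1)] by blast
  qed
  then show "lie_subcoalgebra L LieKc" unfolding lie_subcoalgebra_def using 1 2 by blast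
  show "wedge2_proj s L pr x \<in> wedgeR" if "x \<in> LieKc"
    by (rule lin_on_image_span[OF L_subspace(1) lin_on_subset[OF wedge2_lin CL] tens_vector_space wedgeR_subspace])
      (use that carrier in auto)
qed

lemmas lie_koszul_facts = lie_subcoalgebraD[OF L_graded carrier_subcoalgebra, folded lie_koszul_dual_sub]

lemma lie_koszul_dual_lie: "lie_coalgebra LieK"
  unfolding lie_koszul_dual_sub by (rule sub_lie_coalgebra[OF cofree_facts(1)[OF cofree QLC_vector_space] carrier_subcoalgebra])

lemma lie_morphism_koszul_iff: "lie_morphism N LieK f \<longleftrightarrow> lie_morphism N L f \<and> (\<forall>i. f ` gr N i \<subseteq> LieKc)"
  unfolding lie_koszul_dual_sub by (rule lie_morphism_sub_iff)

lemma lie_morphism_koszul_carr: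
  assumes "lie_morphism N LieK f" "graded_space N" "x \<in> carr N" shows "f x \<in> LieKc"
  using graded_map_carr[OF lie_morphismD(1)[OF assms(1)] assms(2) lie_koszul_facts(4) assms(3)] lie_koszul_facts(3) by simp

lemma morphism_to_sV:
  assumes D: "gr_cop D (comult D)" and f: "lie_morphism (Liec D) L f"
  shows "map_to_sV s D (\<lambda>x. pr (f x))"
proof -
  note f' = graded_mapD[OF lie_morphismD(1)[OF f]]
  have "lin_on (carr D) (scl D) s (\<lambda>x. pr (f x))"
    using lin_on_comp[OF f'(1) graded_map_carr[OF lie_morphismD(1)[OF f] _ L_graded] pr_lin] gr_copD(1)[OF D] by simp
  moreover have "pr (f x) = 0" if "i \<noteq> 1" "x \<in> gr D i" for i x
    using cofree_facts(3)[OF cofree QLC_vector_space] f'(2)[of x i] that by (auto simp: map_to_sV_def)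
  ultimately show ?thesis by (auto simp: map_to_sV_def linear_on_iff)
qed

text \<open>
  The weight \<open>2\<close> part of a Lie morphism \<open>f\<close> is the symmetrized convolution square of \<open>pr \<circ> f\<close>. This
  translates the condition that defines \<open>(qA)\<^sup>\<exclamdown>\<close> into the one that defines \<open>(qA\<^sup>+)\<^sup>\<exclamdown>\<close>.
\<close>

lemma wedge2_morphism:
  assumes D: "gr_cop D (comult D)" and f: "lie_morphism (Liec D) L f" and x: "x \<in> carr D"
  shows "wedge2_proj s L pr (f x) = symmetrize s (sym_of s (conv D s (\<lambda>x. ptens s [pr (f x)]) (\<lambda>x. ptens s [pr (f x)]) x))"
proof -
  have gD: "graded_space (Liec D)" using gr_copD(1)[OF D] by simp
  have "wedge2_proj s L pr (f x) = sq_map (scl L) (carr L) s pr (sq_map (scl D) (carr D) (scl L) f (cobr (Liec D) x))"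
    using lie_morphismD(2)[OF f, of x] x by (simp add: wedge2_proj_def)
  also have "\<dots> = sq_map (scl D) (carr D) s (\<lambda>x. pr (f x)) (cobr (Liec D) x)"
    using sq_map_comp[OF lie_morphismD(1)[OF f] gD L_graded pr_lin gr_cop_power[OF gr_cop_Liec[OF D]], of x] x by simp
  also have "\<dots> = symmetrize s (sym_of s (sq_map (scl D) (carr D) s (\<lambda>x. pr (f x)) (comult D x)))"
    by (rule cobracket_symmetrize[OF D morphism_to_sV[OF D f] x])
  finally show ?thesis by (simp add: conv_def)
qed

lemma lie_morphism_L_unique:
  assumes "gr_cop N (cobr N)" "lie_morphism N L f" "lie_morphism N L g"
    "\<And>x. x \<in> carr N \<Longrightarrow> pr (f x) = pr (g x)" "x \<in> carr N"
  shows "f x = g x"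
  by (rule lie_morphism_to_cofree_unique[OF cofree QLC_vector_space assms])

lemma koszul_proj_2: assumes "x \<in> carr AssK" shows "tensor_proj s 2 x \<in> R_assoc s R"
proof (rule carr_imageI[OF koszul_graded, where F = "tensor_proj s 2" and s' = tscale])
  show "lin_on (carr AssK) (scl AssK) tscale (tensor_proj s 2)"
    unfolding koszul_simps by (rule lin_on_subset[OF tensor_proj_lin]) (auto simp: koszul_carr_T)
  fix i x assume x: "x \<in> gr AssK i"
  show "tensor_proj s 2 x \<in> R_assoc s R"
  proof (cases "i = 2")
    case True
    then have x2: "x \<in> assoc_koszul_gr s R 2" using x by simp
    \<comment> \<open>for \<open>i = j = 0\<close> the outer factors are scalars, so the relations in degree \<open>2\<close> are \<open>R'\<close>
      itself\<close>
    have scalar: "\<exists>c. t = tscale c (ptens s [])" if "t \<in> tensor_power s UNIV 0" for t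
    proof -
      have "ptens s ` words UNIV 0 = {ptens s []}" by (auto simp: words_def)
      then show ?thesis using that by (auto simp: tensor_power_def tens.span_singleton)
    qed
    have "rel_space s R 0 0 \<subseteq> R_assoc s R"
    proof (rule tens.span_minimal[OF _ R_assoc_subspace[OF QLC_subspace]], clarify)
      fix a r b assume "a \<in> tensor_power s UNIV 0" "r \<in> R_assoc s R" "b \<in> tensor_power s UNIV 0"
      moreover then obtain c d where "a = tscale c (ptens s [])" "b = tscale d (ptens s [])" using scalar by blast
      moreover have "r \<in> tensor_algebra s" using calculation R_assoc_power tensor_power_T by blast
      ultimately show "tprod s (tprod s a r) b \<in> R_assoc s R"
        by (simp add: tprod_scale_left tprod_scale_right tprod_one_left tprod_one_right T_closed
            tens.subspace_scale[OF R_assoc_subspace[OF QLC_subspace]])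
    qed
    moreover have "x \<in> rel_space s R 0 0" by (rule koszul_rel[OF x2]) simp
    ultimately show ?thesis using tensor_proj_eq[OF koszul_power[OF x2], of 2] by auto
  next
    case False
    have "tensor_proj s 2 x = 0"
    proof (cases "i < 0")
      case True
      then show ?thesis using x lin_on_zero[OF tensor_proj_lin T_zero] by simp
    next
      case nonneg: False
      then have "x \<in> tensor_power s UNIV (nat i)" using x koszul_power by simp
      from tensor_proj_eq[OF this, of 2] show ?thesis using False nonneg by auto
    qed
    then show ?thesis by (simp add: tens.subspace_0[OF R_assoc_subspace[OF QLC_subspace]])
  qed
qed (use assms R_assoc_subspace[OF QLC_subspace] tens_vector_space in auto)

text \<open>
  The projection of \<open>(qA\<^sup>+)\<^sup>\<exclamdown>\<close> to \<open>sV\<close> lifts to a Lie morphism into \<open>L\<close>. Its image is a Lie subcoalgebra,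
  and on weight \<open>2\<close> it meets the relations since the degree \<open>2\<close> part of \<open>(qA\<^sup>+)\<^sup>\<exclamdown>\<close> is \<open>R'\<close>; hence it is
  contained in \<open>(qA)\<^sup>\<exclamdown>\<close>.
\<close>

theorem canonical_counit_exists: "\<exists>\<epsilon>. canonical_counit s R L pr \<epsilon>"
proof -
  have "\<forall>x. \<exists>v. x \<in> carr AssK \<longrightarrow> ptens s [v] = tensor_proj s 1 x"
    using tensor_power_1[OF QLC_vector_space tensor_proj_power[OF koszul_carr_T]] by metis
  then obtain \<gamma> where \<gamma>: "\<And>x. x \<in> carr AssK \<Longrightarrow> ptens s [\<gamma> x] = tensor_proj s 1 x" by metis
  interpret Kc: vector_space tscale by (rule tens_vector_space)
  note Ksub = carr_subspace[OF koszul_graded[of s R], unfolded koszul_simps]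
  have "map_to_sV s (Liec AssK) \<gamma>"
    unfolding map_to_sV_def linear_on_iff
  proof (intro conjI allI impI)
    show "lin_on (carr (Liec AssK)) (scl (Liec AssK)) s \<gamma>"
    proof (rule lin_onI)
      fix x y assume xy: "x \<in> carr (Liec AssK)" "y \<in> carr (Liec AssK)"
      then have xy': "x \<in> carr AssK" "y \<in> carr AssK" "x + y \<in> carr AssK" using tens.subspace_add[OF Ksub] by auto
      have "ptens s [\<gamma> (x + y)] = ptens s [\<gamma> x + \<gamma> y]"
        using xy' by (simp add: \<gamma> lin_on_add[OF tensor_proj_lin koszul_carr_T koszul_carr_T] lin_on_add[OF lin_on_ptens1 UNIV_I UNIV_I])
      then show "\<gamma> (x + y) = \<gamma> x + \<gamma> y" by (rule ptens1_inj[OF QLC_vector_space])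
    next
      fix c x assume "x \<in> carr (Liec AssK)"
      then have x: "x \<in> carr AssK" "tscale c x \<in> carr AssK" using tens.subspace_scale[OF Ksub] by auto
      have "ptens s [\<gamma> (tscale c x)] = ptens s [s c (\<gamma> x)]"
        using x by (simp add: \<gamma> lin_on_scale[OF tensor_proj_lin koszul_carr_T] lin_on_scale[OF lin_on_ptens1 UNIV_I])
      then show "\<gamma> (scl (Liec AssK) c x) = s c (\<gamma> x)" unfolding scl_Liec koszul_simps by (rule ptens1_inj[OF QLC_vector_space])
    qed
    fix i x assume ix: "i \<noteq> 1 \<and> x \<in> gr (Liec AssK) i"
    then have x: "x \<in> gr AssK i" by simp
    have "tensor_proj s 1 x = 0"
    proof (cases "i < 0")
      case True
      then show ?thesis using x lin_on_zero[OF tensor_proj_lin T_zero] by simp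
    next
      case nonneg: False
      then have "x \<in> tensor_power s UNIV (nat i)" using x koszul_power by simp
      from tensor_proj_eq[OF this, of 1] show ?thesis using ix nonneg by (auto simp: nat_eq_iff)
    qed
    then have "ptens s [\<gamma> x] = ptens s [0]" using \<gamma>[OF gr_carr[OF koszul_graded x]] by (simp add: ptens_zero_entry)
    then show "\<gamma> x = 0" by (rule ptens1_inj[OF QLC_vector_space])
  qed
  then obtain h where h: "lie_morphism (Liec AssK) L h" "\<forall>x\<in>carr (Liec AssK). pr (h x) = \<gamma> x"
    using cofree_lift[OF cofree_facts(5,1)[OF cofree QLC_vector_space] lie_coalgebra_Liec[OF koszul_coalgebra] _ cofree_facts(3)[OF cofree QLC_vector_space]] by blast
  have proj: "ptens s [pr (h x)] = tensor_proj s 1 x" if "x \<in> carr AssK" for x using h(2) \<gamma> that by simp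
  note copK = koszul_cop[of s R]
  have "h ` carr (Liec AssK) \<subseteq> LieKc"
  proof (rule subcoalgebra_le_carrier[OF image_lie_subcoalgebra[OF gr_cop_Liec[OF copK] h(1) L_graded]])
    fix y assume "y \<in> h ` carr (Liec AssK)"
    then obtain x where x: "x \<in> carr AssK" "y = h x" by auto
    have "conv AssK s (\<lambda>x. ptens s [pr (h x)]) (\<lambda>x. ptens s [pr (h x)]) x =
      conv AssK s (tensor_proj s 1) (tensor_proj s 1) x"
      using conv_cong[of AssK "\<lambda>x. ptens s [pr (h x)]" "tensor_proj s 1" "\<lambda>x. ptens s [pr (h x)]" "tensor_proj s 1" s] proj by simp
    also have "\<dots> = tensor_proj s 2 x"
      unfolding conv_def koszul_simps koszul_restrict[OF tensor_proj_hom tensor_proj_hom x(1)]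
      using proj_conv[OF koszul_carr_T[OF x(1)], of 1 1] by (simp add: numeral_2_eq_2)
    finally have "wedge2_proj s L pr y = symmetrize s (sym_of s (tensor_proj s 2 x))"
      using wedge2_morphism[OF copK h(1) x(1)] x(2) by simp
    then show "wedge2_proj s L pr y \<in> wedgeR"
      using koszul_proj_2[OF x(1)] by (auto simp: R_assoc_def)
  qed
  then have "h ` gr (Liec AssK) i \<subseteq> LieKc" for i using gr_carr[of "Liec AssK"] koszul_graded[of s R] by fastforce
  then have "lie_morphism (Liec AssK) LieK h" using h(1) by (simp add: lie_morphism_koszul_iff)
  then show ?thesis using proj unfolding canonical_counit_def by blast
qed

text \<open>
  Given \<open>f\<close>, its component \<open>\<gamma> = pr \<circ> f\<close> satisfies the quadratic condition and yields \<open>F\<close>. Both \<open>\<epsilon> \<circ> F\<close> and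
  \<open>f\<close> are Lie morphisms to \<open>L\<close> over \<open>\<gamma>\<close>, hence equal, and \<open>F\<close> is unique because \<open>\<epsilon> \<circ> F'\<close> determines the
  component of \<open>F'\<close> in \<open>sV\<close>.
\<close>

theorem koszul_coenveloping:
  assumes "canonical_counit s R L pr \<epsilon>"
  shows "coenveloping TYPE('d::ab_group_add) LieK AssK \<epsilon>"
proof -
  have \<epsilon>LieK: "lie_morphism (Liec AssK) LieK \<epsilon>" and proj: "\<And>x. x \<in> carr AssK \<Longrightarrow> ptens s [pr (\<epsilon> x)] = tensor_proj s 1 x"
    using assms by (auto simp: canonical_counit_def)
  have \<epsilon>: "lie_morphism (Liec AssK) L \<epsilon>" using \<epsilon>LieK by (simp add: lie_morphism_koszul_iff)
  have "\<exists>F. coalg_morphism D AssK F \<and> (\<forall>x\<in>carr D. \<epsilon> (F x) = f x) \<and>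
           (\<forall>F'. coalg_morphism D AssK F' \<and> (\<forall>x\<in>carr D. \<epsilon> (F' x) = f x) \<longrightarrow> (\<forall>x\<in>carr D. F' x = F x))"
    if D: "graded_coalgebra D" and fG: "lie_morphism (Liec D) LieK f" for D :: "('k, 'd) coalg" and f
  proof -
    note cop = graded_coalgebra_cop[OF D]
    note D' = gr_copD[OF cop]
    have f: "lie_morphism (Liec D) L f" using fG by (simp add: lie_morphism_koszul_iff)
    note \<gamma> = morphism_to_sV[OF cop f]
    note hom = degree_one_arg[OF D \<gamma> QLC_vector_space]
    have "conv_pow D s (\<lambda>x. ptens s [pr (f x)]) 2 x \<in> R_assoc s R" if x: "x \<in> carr D" for x
      unfolding R_assoc_iff[OF QLC_quadratic power_map_tensor_power[OF D \<gamma> QLC_vector_space x]]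
      using wedge2_morphism[OF cop f x] carrier_wedge2[OF lie_morphism_koszul_carr[OF fG, of x]] x D'(1)
      by (simp add: conv_pow_2[OF D hom x])
    from coalg_morphism_exists[OF D \<gamma> QLC_vector_space this]
    obtain F where F: "coalg_morphism D AssK F" and Fp: "\<And>x. x \<in> carr D \<Longrightarrow> tensor_proj s 1 (F x) = ptens s [pr (f x)]"
      by blast
    have carrK: "F' x \<in> carr AssK" if "coalg_morphism D AssK F'" "x \<in> carr D" for F' x
      by (rule graded_map_carr[OF coalg_morphismD(1)[OF that(1)] D'(1) koszul_graded that(2)])
    have eF: "\<epsilon> (F x) = f x" if x: "x \<in> carr D" for x
    proof (rule lie_morphism_L_unique[OF gr_cop_Liec[OF cop] _ f])
      show "lie_morphism (Liec D) L (\<lambda>x. \<epsilon> (F x))"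
        by (rule lie_morphism_comp[OF Liec_morphism[OF F cop koszul_graded] \<epsilon> gr_cop_Liec[OF cop]]) (simp add: koszul_graded)
      fix y assume "y \<in> carr (Liec D)"
      then have y: "y \<in> carr D" by simp
      show "pr (\<epsilon> (F y)) = pr (f y)"
        by (rule ptens1_inj[OF QLC_vector_space]) (simp only: proj[OF carrK[OF F y]] Fp[OF y])
    qed (use x in simp)
    have "F' x = F x" if F': "coalg_morphism D AssK F'" "\<forall>x\<in>carr D. \<epsilon> (F' x) = f x" and x: "x \<in> carr D" for F' x
    proof (rule coalg_morphism_unique[OF D F'(1) F _ x])
      fix y assume y: "y \<in> carr D"
      show "tensor_proj s 1 (F' y) = tensor_proj s 1 (F y)"
        using proj[OF carrK[OF F'(1) y]] F'(2) y Fp[OF y] by simp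
    qed
    then show ?thesis using F eF by blast
  qed
  then show ?thesis unfolding coenveloping_def using lie_koszul_dual_lie koszul_coalgebra \<epsilon>LieK by blast
qed

text \<open>
  Two objects with the same universal property. The property of \<open>U\<close> is used for test coalgebras in
  its own type and in the type of tensors, where the other model lives.
\<close>

theorem canonical_iso_exists:
  fixes U :: "('k, 'u::ab_group_add) coalg"
  assumes U: "is_Uc_koszul s R L pr U \<eta>"
  shows "\<exists>\<Phi>. canonical_iso s R pr U \<eta> \<Phi> \<and> (\<forall>\<Phi>'. canonical_iso s R pr U \<eta> \<Phi>' \<longrightarrow> (\<forall>x\<in>carr U. \<Phi>' x = \<Phi> x))"
proof -
  obtain \<epsilon> where \<epsilon>: "canonical_counit s R L pr \<epsilon>" using canonical_counit_exists by blast
  have proj: "\<And>x. x \<in> carr AssK \<Longrightarrow> ptens s [pr (\<epsilon> x)] = tensor_proj s 1 x"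
    using \<epsilon> by (auto simp: canonical_counit_def)
  have U1: "coenveloping TYPE('u) LieK U \<eta>" and U2: "coenveloping TYPE(('k, 'v) tens) LieK U \<eta>"
    using U by (auto simp: is_Uc_koszul_def)
  note K1 = koszul_coenveloping[OF \<epsilon>, where 'd = 'u] and K2 = koszul_coenveloping[OF \<epsilon>, where 'd = "('k, 'v) tens"]
  note Ug = coenvelopingD(2)[OF U1] and Um = coenvelopingD(3)[OF U1]
  note Kg = coenvelopingD(2)[OF K1] and Km = coenvelopingD(3)[OF K1]
  note copU = graded_coalgebra_cop[OF Ug] and copK = graded_coalgebra_cop[OF Kg]
  note gU = gr_copD(1)[OF copU] and gK = gr_copD(1)[OF copK]
  obtain \<Phi> where \<Phi>: "coalg_morphism U AssK \<Phi>" "\<forall>x\<in>carr U. \<epsilon> (\<Phi> x) = \<eta> x"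
    using coenvelopingD(4)[OF K1 Ug Um] by blast
  obtain \<Psi> where \<Psi>: "coalg_morphism AssK U \<Psi>" "\<forall>x\<in>carr AssK. \<eta> (\<Psi> x) = \<epsilon> x"
    using coenvelopingD(4)[OF U2 Kg Km] by blast
  have \<Phi>c: "\<Phi> x \<in> carr AssK" if "x \<in> carr U" for x by (rule graded_map_carr[OF coalg_morphismD(1)[OF \<Phi>(1)] gU gK that])
  have \<Psi>c: "\<Psi> x \<in> carr U" if "x \<in> carr AssK" for x by (rule graded_map_carr[OF coalg_morphismD(1)[OF \<Psi>(1)] gK gU that])
  have 1: "\<forall>x\<in>carr U. \<Psi> (\<Phi> x) = x"
    by (rule coenvelopingD(5)[OF U1 Ug Um coalg_morphism_comp[OF \<Phi>(1) \<Psi>(1) copU gK] _ coalg_morphism_id[OF copU]])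
      (use \<Phi>(2) \<Psi>(2) \<Phi>c in auto)
  have 2: "\<forall>x\<in>carr AssK. \<Phi> (\<Psi> x) = x"
    by (rule coenvelopingD(5)[OF K2 Kg Km coalg_morphism_comp[OF \<Psi>(1) \<Phi>(1) copK gU] _ coalg_morphism_id[OF copK]])
      (use \<Phi>(2) \<Psi>(2) \<Psi>c in auto)
  have "bij_betw \<Phi> (carr U) (carr AssK)"
    by (rule bij_betw_byWitness[where f' = \<Psi>]) (use \<Phi>c \<Psi>c 1 2 in auto)
  moreover have "tensor_proj s 1 (\<Phi> x) = ptens s [pr (\<eta> x)]" if "x \<in> carr U" for x
    using proj[OF \<Phi>c[OF that]] \<Phi>(2) that by simp
  ultimately have iso: "canonical_iso s R pr U \<eta> \<Phi>" using \<Phi>(1) by (simp add: canonical_iso_def coalg_iso_def)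
  have "\<Phi>' x = \<Phi> x" if "canonical_iso s R pr U \<eta> \<Phi>'" "x \<in> carr U" for \<Phi>' x
    by (rule coalg_morphism_unique[OF Ug, of s R])
      (use that iso in \<open>auto simp: canonical_iso_def coalg_iso_def\<close>)
  with iso show ?thesis by blast
qed

end

section \<open>Naturality\<close>

text \<open>
  The projection \<open>T(V) \<rightarrow> Sym(V)\<close> is natural in \<open>V\<close>.
\<close>

lemma sym_of_tensor_map:
  fixes s :: "'k::field \<Rightarrow> 'v::ab_group_add \<Rightarrow> 'v"
  assumes \<phi>: "Vector_Spaces.linear s s' \<phi>" and t: "t \<in> tensor_algebra s"
  shows "sym_of s' (tensor_map s s' \<phi> t) = sym_map s' \<phi> (sym_of s t)"
proof (rule T_eqI[OF t lin_on_comp[OF tensor_map_lin[OF \<phi>] UNIV_I sym_of_lin]])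
  have "lin_on UNIV tscale tscale (sym_map s' \<phi>)"
    by (auto simp: lin_on_def sym_map_def tscale_def fun_eq_iff)
  then show "lin_on (tensor_algebra s) tscale tscale (\<lambda>t. sym_map s' \<phi> (sym_of s t))"
    by (rule lin_on_comp[OF sym_of_lin UNIV_I])
  fix xs :: "'v list"
  have form: "sym_form s (\<lambda>xs. \<mu> (map \<phi> xs))" if \<mu>: "sym_form s' \<mu>" for \<mu>
    unfolding sym_form_def
  proof (intro conjI allI impI)
    show "multilinear s (\<lambda>xs. \<mu> (map \<phi> xs))" by (rule multilinear_map[OF sym_form_multilinear[OF \<mu>] \<phi>])
    fix xs ys :: "'v list" assume "mset xs = mset ys"
    then show "\<mu> (map \<phi> xs) = \<mu> (map \<phi> ys)" by (intro sym_form_mset[OF \<mu>]) simp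
  qed
  show "sym_of s' (tensor_map s s' \<phi> (ptens s xs)) = sym_map s' \<phi> (sym_of s (ptens s xs))"
  proof
    fix \<mu> show "sym_of s' (tensor_map s s' \<phi> (ptens s xs)) \<mu> = sym_map s' \<phi> (sym_of s (ptens s xs)) \<mu>"
      unfolding tensor_map_ptens[OF \<phi>]
      using form[of \<mu>] sym_form_multilinear[of s' \<mu>] sym_form_multilinear[OF form[of \<mu>]]
      by (auto simp: sym_of_def sym_map_def ptens_def)
  qed
qed

lemma tensor_map_power:
  assumes \<phi>: "Vector_Spaces.linear s s' \<phi>" and t: "t \<in> tensor_power s UNIV n"
  shows "tensor_map s s' \<phi> t \<in> tensor_power s' UNIV n"
  by (rule power_imageI[OF t tensor_power_lin[OF tensor_map_lin[OF \<phi>]] tens_vector_space tensor_power_subspace])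
    (auto simp: tensor_map_ptens[OF \<phi>] words_def intro!: ptens_tensor_power)

lemma tensor_map_symmetrize:
  fixes s :: "'k::field \<Rightarrow> 'v::ab_group_add \<Rightarrow> 'v"
  assumes \<phi>: "Vector_Spaces.linear s s' \<phi>" and z: "z \<in> tensor_power s UNIV 2"
  shows "tensor_map s s' \<phi> (symmetrize s (sym_of s z)) = symmetrize s' (sym_map s' \<phi> (sym_of s z))"
proof -
  have "symmetrize s (sym_of s z) \<in> tensor_algebra s" if "z \<in> tensor_power s UNIV 2" for z
    by (rule power_imageI[OF that lin_on_comp[OF sym_of_lin UNIV_I symmetrize_lin] tens_vector_space T_subspace])
      (auto simp: words_2 symmetrize_ptens T_closed)
  then have "tensor_map s s' \<phi> (symmetrize s (sym_of s z)) = symmetrize s' (sym_of s' (tensor_map s s' \<phi> z))"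
  proof (intro power_eqI[OF z, where F = "\<lambda>z. tensor_map s s' \<phi> (symmetrize s (sym_of s z))"])
    assume T: "\<And>z. z \<in> tensor_power s UNIV 2 \<Longrightarrow> symmetrize s (sym_of s z) \<in> tensor_algebra s"
    show "lin_on (tensor_power s UNIV 2) tscale tscale (\<lambda>z. tensor_map s s' \<phi> (symmetrize s (sym_of s z)))"
      by (rule lin_on_comp[OF lin_on_comp[OF sym_of_lin UNIV_I symmetrize_lin] T tensor_map_lin[OF \<phi>]])
    show "lin_on (tensor_power s UNIV 2) tscale tscale (\<lambda>z. symmetrize s' (sym_of s' (tensor_map s s' \<phi> z)))"
      by (rule lin_on_comp[OF tensor_power_lin[OF tensor_map_lin[OF \<phi>]] UNIV_I lin_on_comp[OF sym_of_lin UNIV_I symmetrize_lin]])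
    fix xs :: "'v list" assume "xs \<in> words UNIV 2"
    then obtain v w where xs: "xs = [v, w]" by (auto simp: words_2)
    show "tensor_map s s' \<phi> (symmetrize s (sym_of s (ptens s xs))) = symmetrize s' (sym_of s' (tensor_map s s' \<phi> (ptens s xs)))"
      by (simp add: xs symmetrize_ptens tensor_map_ptens[OF \<phi>] lin_on_add[OF tensor_map_lin[OF \<phi>]])
  qed
  then show ?thesis by (simp add: sym_of_tensor_map[OF \<phi> tensor_power_T[OF z]])
qed

lemma tensor_map_R_assoc:
  assumes "quadratic_map s R s' R' \<phi>" "r \<in> R_assoc s R"
  shows "tensor_map s s' \<phi> r \<in> R_assoc s' R'"
proof -
  have \<phi>: "Vector_Spaces.linear s s' \<phi>" using assms(1) by (simp add: quadratic_map_def)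
  show ?thesis
    using assms(2,1) tensor_map_power[OF \<phi> R_assoc_power[OF assms(2)]]
      sym_of_tensor_map[OF \<phi> tensor_power_T[OF R_assoc_power[OF assms(2)]]]
    by (auto simp: R_assoc_def quadratic_map_def)
qed

lemma tensor_map_koszul:
  assumes q: "quadratic_map s R s' R' \<phi>" and t: "t \<in> assoc_koszul_gr s R n"
  shows "tensor_map s s' \<phi> t \<in> assoc_koszul_gr s' R' n"
proof (rule koszulI)
  have \<phi>: "Vector_Spaces.linear s s' \<phi>" using q by (simp add: quadratic_map_def)
  show "tensor_map s s' \<phi> t \<in> tensor_power s' UNIV n" by (rule tensor_map_power[OF \<phi> koszul_power[OF t]])
  fix i j assume ij: "i + 2 + j = n"
  have T: "x \<in> tensor_algebra s" "r \<in> tensor_algebra s" "y \<in> tensor_algebra s"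
    if "x \<in> tensor_power s UNIV i" "r \<in> R_assoc s R" "y \<in> tensor_power s UNIV j" for x r y
    using that tensor_power_T R_assoc_power by blast+
  have sub: "rel_space s R i j \<subseteq> tensor_algebra s"
    by (rule tens.span_minimal[OF _ T_subspace]) (use T in \<open>auto intro!: tprod_T\<close>)
  show "tensor_map s s' \<phi> t \<in> rel_space s' R' i j"
  proof (rule lin_on_image_span[OF tens_vector_space lin_on_subset[OF tensor_map_lin[OF \<phi>] sub] tens_vector_space tens.subspace_span _ koszul_rel[OF t ij]])
    fix z assume "z \<in> {tprod s (tprod s x r) y | x r y. x \<in> tensor_power s UNIV i \<and> r \<in> R_assoc s R \<and> y \<in> tensor_power s UNIV j}"
    then obtain x r y where z: "z = tprod s (tprod s x r) y" and xry: "x \<in> tensor_power s UNIV i" "r \<in> R_assoc s R" "y \<in> tensor_power s UNIV j"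
      by blast
    have "tensor_map s s' \<phi> z = tprod s' (tprod s' (tensor_map s s' \<phi> x) (tensor_map s s' \<phi> r)) (tensor_map s s' \<phi> y)"
      using T[OF xry] by (simp add: z tensor_map_tprod[OF \<phi>] tprod_T)
    then show "tensor_map s s' \<phi> z \<in> rel_space s' R' i j"
      using tensor_map_power[OF \<phi> xry(1)] tensor_map_R_assoc[OF q xry(2)] tensor_map_power[OF \<phi> xry(3)]
      by (intro tens.span_base) blast
  qed
qed

lemma tensor_map_coalg_morphism:
  assumes q: "quadratic_map s R s' R' \<phi>"
  shows "coalg_morphism (assoc_koszul_dual s R) (assoc_koszul_dual s' R') (tensor_map s s' \<phi>)"
proof -
  have \<phi>: "Vector_Spaces.linear s s' \<phi>" using q by (simp add: quadratic_map_def)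
  note tl = tensor_map_lin[OF \<phi>]
  let ?K = "assoc_koszul_dual s R"
  have KT: "carr ?K \<subseteq> tensor_algebra s" by (auto simp: koszul_carr_T)
  have 1: "graded_map ?K (assoc_koszul_dual s' R') (tensor_map s s' \<phi>)"
    unfolding graded_map_def linear_on_iff
    using lin_on_subset[OF tl KT] tensor_map_koszul[OF q] lin_on_zero[OF tl T_zero] by auto
  note h = T_tens_hom_ptens1[OF tl]
  have 2: "sq_map tscale (carr ?K) tscale (tensor_map s s' \<phi>) (deconcat s x) = deconcat s' (tensor_map s s' \<phi> x)"
    if x: "x \<in> carr ?K" for x
    unfolding koszul_restrict[OF h h x]
  proof (rule T_eqI[OF koszul_carr_T[OF x] tensor_fun_deconcat_lin[OF h h] lin_on_comp[OF tl tensor_map_T[OF \<phi>] deconcat_lin]])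
    fix xs
    show "sq_map tscale (tensor_algebra s) tscale (tensor_map s s' \<phi>) (deconcat s (ptens s xs)) = deconcat s' (tensor_map s s' \<phi> (ptens s xs))"
      unfolding tensor_fun_deconcat_ptens[OF h h]
      by (simp add: tensor_map_ptens[OF \<phi>] deconcat_ptens tprod_ptens take_map drop_map)
  qed
  have 3: "counit (tensor_coalg s') (tensor_map s s' \<phi> x) = counit (tensor_coalg s) x" if x: "x \<in> carr ?K" for x
    by (rule T_eqI[OF koszul_carr_T[OF x] lin_on_comp[OF tl UNIV_I counit_lin] counit_lin])
      (simp add: tensor_map_ptens[OF \<phi>] counit_ptens)
  show ?thesis unfolding coalg_morphism_def koszul_simps using 1 2 3 by blast
qed

lemma tensor_map_proj:
  assumes \<phi>: "Vector_Spaces.linear s s' \<phi>" and t: "t \<in> tensor_algebra s"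
  shows "tensor_proj s' n (tensor_map s s' \<phi> t) = tensor_map s s' \<phi> (tensor_proj s n t)"
  by (rule T_eqI[OF t lin_on_comp[OF tensor_map_lin[OF \<phi>] tensor_map_T[OF \<phi>] tensor_proj_lin]
        lin_on_comp[OF tensor_proj_lin tensor_proj_T tensor_map_lin[OF \<phi>]]])
    (auto simp: tensor_map_ptens[OF \<phi>] tensor_proj_ptens lin_on_zero[OF tensor_map_lin[OF \<phi>] T_zero])

text \<open>
  The image of \<open>(qA)\<^sup>\<exclamdown>\<close> in \<open>L'\<close> is a Lie subcoalgebra, and its weight \<open>2\<close> part is the image of \<open>s\<^sup>2qR\<close> under
  \<open>\<phi> \<otimes> \<phi>\<close>, which is contained in \<open>s\<^sup>2qR'\<close>.
\<close>

lemma lie_koszul_dual_morphism: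
  fixes s :: "'k::field_char_0 \<Rightarrow> 'v::ab_group_add \<Rightarrow> 'v" and s' :: "'k \<Rightarrow> 'w::ab_group_add \<Rightarrow> 'w"
  assumes Q: "comm_QLC s R" "cofree_conilpotent_lie s L pr" and Q': "comm_QLC s' R'" "cofree_conilpotent_lie s' L' pr'"
    and q: "quadratic_map s R s' R' \<phi>" and h: "lie_lift L pr L' pr' \<phi> h"
  shows "lie_morphism (lie_koszul_dual s R L pr) (lie_koszul_dual s' R' L' pr') h"
proof -
  have \<phi>: "Vector_Spaces.linear s s' \<phi>" using q by (simp add: quadratic_map_def)
  have hm: "lie_morphism L L' h" and hp: "\<And>x. x \<in> carr L \<Longrightarrow> pr' (h x) = \<phi> (pr x)"
    using h by (auto simp: lie_lift_def)
  let ?G = "lie_koszul_dual s R L pr" and ?C = "lie_koszul_carrier s R L pr"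
  note C = lie_koszul_facts[OF Q]
  note L_graded = L_graded[OF Q] L_graded[OF Q']
  note copG = lie_coalgebra_cop[OF lie_koszul_dual_lie[OF Q]]
  have inc: "lie_morphism ?G L (\<lambda>x. x)"
    unfolding lie_koszul_dual_sub by (rule sub_lie_inclusion[OF L_graded(1) carrier_subcoalgebra[OF Q]])
  have hG: "lie_morphism ?G L' h" using lie_morphism_comp[OF inc hm copG L_graded(1)] by simp
  note cl = L_subspace[OF Q]
  have w: "wedge2_proj s' L' pr' (h x) = tensor_map s s' \<phi> (wedge2_proj s L pr x)" if x: "x \<in> carr L" for x
  proof -
    note cx = gr_cop_power[OF L_cop[OF Q] x]
    have "wedge2_proj s' L' pr' (h x) = sq_map (scl L') (carr L') s' pr' (sq_map (scl L) (carr L) (scl L') h (cobr L x))"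
      using lie_morphismD(2)[OF hm x] by (simp add: wedge2_proj_def)
    also have "\<dots> = sq_map (scl L) (carr L) s' (\<lambda>x. pr' (h x)) (cobr L x)"
      by (rule sq_map_comp[OF lie_morphismD(1)[OF hm] L_graded pr_lin[OF Q'] cx, symmetric])
    also have "\<dots> = sq_map (scl L) (carr L) s' (\<lambda>x. \<phi> (pr x)) (cobr L x)"
      by (rule fun_cong[OF tensor_fun_cong]) (simp_all add: hp)
    also have "\<dots> = sq_map s UNIV s' \<phi> (sq_map (scl L) (carr L) s pr (cobr L x))"
    proof -
      interpret V: vector_space s by (rule QLC_vector_space[OF Q])
      note h1 = tens_hom_ptens1[OF V.vector_space_axioms V.subspace_UNIV linear_lin_on[OF \<phi>]]
      show ?thesis
        by (rule tensor_fun_comp[OF cl pr_lin[OF Q] pr_lin[OF Q] UNIV_I UNIV_I cx h1 h1, symmetric])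
    qed
    also have "\<dots> = tensor_map s s' \<phi> (wedge2_proj s L pr x)"
    proof -
      interpret V: vector_space s by (rule QLC_vector_space[OF Q])
      have "sq_map (scl L) (carr L) s pr (cobr L x) \<in> tensor_power s UNIV 2"
        by (rule sq_map_power[OF cl pr_lin[OF Q] UNIV_I cx])
      then show ?thesis
        unfolding wedge2_proj_def by (rule sq_map_tensor_map[OF V.vector_space_axioms V.subspace_UNIV \<phi>])
    qed
    finally show ?thesis .
  qed
  have "h ` carr ?G \<subseteq> lie_koszul_carrier s' R' L' pr'"
  proof (rule subcoalgebra_le_carrier[OF Q' image_lie_subcoalgebra[OF copG hG L_graded(2)]])
    fix y assume "y \<in> h ` carr ?G"
    then obtain x where x: "x \<in> ?C" "y = h x" using C(3) by auto
    from carrier_wedge2[OF Q x(1)] obtain r where r: "r \<in> qR s R" "wedge2_proj s L pr x = symmetrize s r" by blast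
    obtain z where z: "z \<in> tensor_power s UNIV 2" "r = sym_of s z" using qR_sym_of[OF QLC_quadratic[OF Q] r(1)] by blast
    have "x \<in> carr L" using x(1) C(2) by blast
    from w[OF this] have "wedge2_proj s' L' pr' y = symmetrize s' (sym_map s' \<phi> r)"
      using tensor_map_symmetrize[OF \<phi> z(1)] r(2) x(2) z(2) by simp
    moreover have "sym_map s' \<phi> r \<in> qR s' R'" using q r(1) by (auto simp: quadratic_map_def)
    ultimately show "wedge2_proj s' L' pr' y \<in> symmetrize s' ` qR s' R'" by blast
  qed
  then have "h ` gr ?G i \<subseteq> lie_koszul_carrier s' R' L' pr'" for i using gr_carr[OF C(4)] by blast
  then show ?thesis using hG by (simp add: lie_morphism_koszul_iff[OF Q'])
qed

text \<open>
  Both sides are coalgebra morphisms into \<open>T\<^sup>c(sV')\<close> with the component \<open>\<phi> \<circ> pr \<circ> \<eta>\<close> in \<open>sV'\<close>.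
\<close>

lemma canonical_iso_natural:
  fixes s :: "'k::field_char_0 \<Rightarrow> 'v::ab_group_add \<Rightarrow> 'v" and s' :: "'k \<Rightarrow> 'w::ab_group_add \<Rightarrow> 'w"
  assumes Q: "comm_QLC s R" "cofree_conilpotent_lie s L pr" and Q': "comm_QLC s' R'" "cofree_conilpotent_lie s' L' pr'"
    and q: "quadratic_map s R s' R' \<phi>" and h: "lie_lift L pr L' pr' \<phi> h"
    and U: "is_Uc_koszul s R L pr U \<eta>" and U': "is_Uc_koszul s' R' L' pr' U' \<eta>'"
    and u: "coalg_morphism U U' u" "\<forall>x\<in>carr U. \<eta>' (u x) = h (\<eta> x)"
    and \<Phi>: "canonical_iso s R pr U \<eta> \<Phi>" and \<Phi>': "canonical_iso s' R' pr' U' \<eta>' \<Phi>'" and x: "x \<in> carr U"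
  shows "\<Phi>' (u x) = tensor_map s s' \<phi> (\<Phi> x)"
proof -
  have \<phi>: "Vector_Spaces.linear s s' \<phi>" using q by (simp add: quadratic_map_def)
  have Uc: "graded_coalgebra U" "graded_coalgebra U'" and \<eta>: "lie_morphism (Liec U) (lie_koszul_dual s R L pr) \<eta>"
    using U U' by (auto simp: is_Uc_koszul_def coenveloping_def)
  note cop = graded_coalgebra_cop[OF Uc(1)]
  note gr = gr_copD(1)[OF cop] gr_copD(1)[OF graded_coalgebra_cop[OF Uc(2)]]
  have m: "coalg_morphism U (assoc_koszul_dual s R) \<Phi>" "coalg_morphism U' (assoc_koszul_dual s' R') \<Phi>'"
    and p: "\<And>x. x \<in> carr U \<Longrightarrow> tensor_proj s 1 (\<Phi> x) = ptens s [pr (\<eta> x)]"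
    and p': "\<And>x. x \<in> carr U' \<Longrightarrow> tensor_proj s' 1 (\<Phi>' x) = ptens s' [pr' (\<eta>' x)]"
    using \<Phi> \<Phi>' by (auto simp: canonical_iso_def coalg_iso_def)
  show ?thesis
  proof (rule coalg_morphism_unique[OF Uc(1) coalg_morphism_comp[OF u(1) m(2) cop gr(2)]
        coalg_morphism_comp[OF m(1) tensor_map_coalg_morphism[OF q] cop koszul_graded] _ x])
    fix y assume y: "y \<in> carr U"
    have uy: "u y \<in> carr U'" by (rule graded_map_carr[OF coalg_morphismD(1)[OF u(1)] gr y])
    have \<Phi>y: "\<Phi> y \<in> tensor_algebra s"
      by (rule koszul_carr_T[OF graded_map_carr[OF coalg_morphismD(1)[OF m(1)] gr(1) koszul_graded y]])
    have "\<eta> y \<in> lie_koszul_carrier s R L pr" by (rule lie_morphism_koszul_carr[OF Q \<eta>]) (use y gr in simp_all)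
    then have "\<eta> y \<in> carr L" using lie_koszul_facts(2)[OF Q] by blast
    then have "pr' (h (\<eta> y)) = \<phi> (pr (\<eta> y))" using h by (simp add: lie_lift_def)
    then show "tensor_proj s' 1 (\<Phi>' (u y)) = tensor_proj s' 1 (tensor_map s s' \<phi> (\<Phi> y))"
      using u(2) y p'[OF uy] p[OF y] tensor_map_ptens[OF \<phi>, of "[pr (\<eta> y)]"] tensor_map_proj[OF \<phi> \<Phi>y, of 1] by simp
  qed
qed

theorem theorem1p3:
  fixes s :: "'k::field_char_0 \<Rightarrow> 'v::ab_group_add \<Rightarrow> 'v"
    and R :: "('k, 'v) tens set"
    and L :: "('k, 'l::ab_group_add) lie_coalg"
    and pr :: "'l \<Rightarrow> 'v"
  assumes "comm_QLC s R"
    and "cofree_conilpotent_lie s L pr"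
  shows
    "(\<comment> \<open>the coalgebra \<open>(qA\<^sup>+)\<^sup>\<exclamdown>\<close>, with its canonical morphism, is \<open>\<U>\<^sup>c((qA)\<^sup>\<exclamdown>)\<close>\<close>
      (\<exists>\<epsilon>. canonical_counit s R L pr \<epsilon>) \<and>
      (\<forall>\<epsilon>. canonical_counit s R L pr \<epsilon> \<longrightarrow>
         coenveloping TYPE('d::ab_group_add) (lie_koszul_dual s R L pr) (assoc_koszul_dual s R) \<epsilon>)) \<and>
     (\<comment> \<open>whence the canonical isomorphism from any other model of \<open>\<U>\<^sup>c((qA)\<^sup>\<exclamdown>)\<close>\<close>
      \<forall>(U :: ('k, 'u::ab_group_add) coalg) \<eta>. is_Uc_koszul s R L pr U \<eta> \<longrightarrow>
         (\<exists>\<Phi>. canonical_iso s R pr U \<eta> \<Phi> \<and>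
            (\<forall>\<Phi>'. canonical_iso s R pr U \<eta> \<Phi>' \<longrightarrow> (\<forall>x\<in>carr U. \<Phi>' x = \<Phi> x)))) \<and>
     (\<comment> \<open>naturality\<close>
      \<forall>(s' :: 'k \<Rightarrow> 'w::ab_group_add \<Rightarrow> 'w) R' (L' :: ('k, 'm::ab_group_add) lie_coalg) pr' \<phi> h.
         comm_QLC s' R' \<and> cofree_conilpotent_lie s' L' pr' \<and>
         quadratic_map s R s' R' \<phi> \<and> lie_lift L pr L' pr' \<phi> h \<longrightarrow>
           lie_morphism (lie_koszul_dual s R L pr) (lie_koszul_dual s' R' L' pr') h \<and>
           coalg_morphism (assoc_koszul_dual s R) (assoc_koszul_dual s' R') (tensor_map s s' \<phi>) \<and>
           (\<forall>(U :: ('k, 'u) coalg) \<eta> (U' :: ('k, 'u'::ab_group_add) coalg) \<eta>' u \<Phi> \<Phi>'.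
              is_Uc_koszul s R L pr U \<eta> \<and> is_Uc_koszul s' R' L' pr' U' \<eta>' \<and>
              coalg_morphism U U' u \<and> (\<forall>x\<in>carr U. \<eta>' (u x) = h (\<eta> x)) \<and>
              canonical_iso s R pr U \<eta> \<Phi> \<and> canonical_iso s' R' pr' U' \<eta>' \<Phi>' \<longrightarrow>
                (\<forall>x\<in>carr U. \<Phi>' (u x) = tensor_map s s' \<phi> (\<Phi> x))))"
proof -
  note Q = assms
  have 1: "(\<exists>\<epsilon>. canonical_counit s R L pr \<epsilon>) \<and> (\<forall>\<epsilon>. canonical_counit s R L pr \<epsilon> \<longrightarrow>
      coenveloping TYPE('d) (lie_koszul_dual s R L pr) (assoc_koszul_dual s R) \<epsilon>)"
    using canonical_counit_exists[OF Q] koszul_coenveloping[OF Q, where 'd = 'd] by blast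
  have 2: "\<forall>(U :: ('k, 'u) coalg) \<eta>. is_Uc_koszul s R L pr U \<eta> \<longrightarrow>
      (\<exists>\<Phi>. canonical_iso s R pr U \<eta> \<Phi> \<and>
        (\<forall>\<Phi>'. canonical_iso s R pr U \<eta> \<Phi>' \<longrightarrow> (\<forall>x\<in>carr U. \<Phi>' x = \<Phi> x)))"
    using canonical_iso_exists[OF Q] by blast
  show ?thesis
  proof (intro conjI[OF 1] conjI[OF 2] allI impI)
    fix s' :: "'k \<Rightarrow> 'w \<Rightarrow> 'w" and R' and L' :: "('k, 'm) lie_coalg" and pr' \<phi> h
    assume "comm_QLC s' R' \<and> cofree_conilpotent_lie s' L' pr' \<and>
      quadratic_map s R s' R' \<phi> \<and> lie_lift L pr L' pr' \<phi> h"
    then have Q': "comm_QLC s' R'" "cofree_conilpotent_lie s' L' pr'"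
      and q: "quadratic_map s R s' R' \<phi>" and h: "lie_lift L pr L' pr' \<phi> h" by blast+
    show "lie_morphism (lie_koszul_dual s R L pr) (lie_koszul_dual s' R' L' pr') h \<and>
      coalg_morphism (assoc_koszul_dual s R) (assoc_koszul_dual s' R') (tensor_map s s' \<phi>) \<and>
      (\<forall>(U :: ('k, 'u) coalg) \<eta> (U' :: ('k, 'u') coalg) \<eta>' u \<Phi> \<Phi>'.
        is_Uc_koszul s R L pr U \<eta> \<and> is_Uc_koszul s' R' L' pr' U' \<eta>' \<and>
        coalg_morphism U U' u \<and> (\<forall>x\<in>carr U. \<eta>' (u x) = h (\<eta> x)) \<and>
        canonical_iso s R pr U \<eta> \<Phi> \<and> canonical_iso s' R' pr' U' \<eta>' \<Phi>' \<longrightarrow>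
          (\<forall>x\<in>carr U. \<Phi>' (u x) = tensor_map s s' \<phi> (\<Phi> x)))"
      using lie_koszul_dual_morphism[OF Q Q' q h] tensor_map_coalg_morphism[OF q]
        canonical_iso_natural[OF Q Q' q h] by blast
  qed
qed

end
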